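(* Let $n$ be a positive integer and write $8n+15=3^{\beta}n_1$ with $n_1$ a positive integer and $3\nmid n_1$. Then $$t(1,1,1,12;n)=\frac 12\Big(3^{\beta+1}\Big(\frac 3{n_1}\Big)+1\Big)\sum_{d\mid n_1}d\Big(\frac 3d\Big)+3\sum_{\substack{a,b\in\mathbb N,\ 2\nmid a\\ 4(8n+15)=a^2+3b^2}}(-1)^{\frac{b-1}2}b,$$ where $d$ runs over positive divisors of $n_1$.
   Context: $\mathbb N$ is the set of positive integers and $\left(\frac{a}{m}\right)$ is the Legendre–Jacobi–Kronecker symbol. For positive integers $a,b,c,d$ and a nonnegative integer $n$, $t(a,b,c,d;n)$ denotes the number of $(x,y,z,w)\in\mathbb Z^4$ with $n=a\frac{x(x-1)}2+b\frac{y(y-1)}2+c\frac{z(z-1)}2+d\frac{w(w-1)}2$. *)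

theory Defs
  imports Complex_Main "HOL-Number_Theory.Number_Theory"
begin

text \<open>
  The Legendre--Jacobi--Kronecker symbol $(a/m)$ for arbitrary integers $a$, $m$: the completely
  multiplicative extension in $m$ of the Legendre symbol, with the usual conventions at
  $2$, $-1$ and $0$.
\<close>

definition kronecker_prime :: "int \<Rightarrow> nat \<Rightarrow> int" where
  "kronecker_prime a p =
     (if p = 2 then (if even a then 0 else if a mod 8 = 1 \<or> a mod 8 = 7 then 1 else -1)
      else Legendre a (int p))"

definition kronecker :: "int \<Rightarrow> int \<Rightarrow> int" where
  "kronecker a m =
     (if m = 0 then (if \<bar>a\<bar> = 1 then 1 else 0)
      else (if m < 0 \<and> a < 0 then -1 else 1) *
           (\<Prod>p\<in>prime_factors (nat \<bar>m\<bar>). kronecker_prime a p ^ multiplicity p (nat \<bar>m\<bar>)))"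

text \<open>
  For positive coefficients the set below is finite; the divisions by 2 are exact.
\<close>

definition t :: "nat \<Rightarrow> nat \<Rightarrow> nat \<Rightarrow> nat \<Rightarrow> nat \<Rightarrow> nat" where
  "t a b c d n = card {(x :: int, y :: int, z :: int, w :: int).
     int n = int a * (x * (x - 1) div 2) + int b * (y * (y - 1) div 2)
           + int c * (z * (z - 1) div 2) + int d * (w * (w - 1) div 2)}"

end

theory Submission
  imports Defs
begin

text \<open>
  Write \<open>N = 8n + 15\<close>, let \<open>\<chi>\<^sub>4\<close>, \<open>\<chi>\<^sub>3\<close> be the odd characters modulo 4 and 3, and note that
  \<open>(3/d) = \<chi>\<^sub>4(d) \<chi>\<^sub>3(d)\<close> for \<open>d\<close> prime to 6. Completing squares, \<open>t(1,1,1,12;n)\<close> is the number \<open>T\<close> of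
  representations \<open>N = x\<^sup>2 + y\<^sup>2 + z\<^sup>2 + 3v\<^sup>2\<close> with \<open>x\<close>, \<open>y\<close> odd. Let \<open>D\<close> and \<open>K\<close> count the representations
  \<open>N = 3x\<^sup>2 + 3y\<^sup>2 + z\<^sup>2 + 3v\<^sup>2\<close> with \<open>x\<close>, \<open>y\<close> both odd, respectively both even.

  The binary forms \<open>x\<^sup>2 + y\<^sup>2\<close> and \<open>z\<^sup>2 + 3v\<^sup>2\<close> are counted by divisor sums of \<open>\<chi>\<^sub>4\<close> and \<open>\<chi>\<^sub>3\<close>, because both
  sides satisfy the same recurrence: for the forms it says that \<open>3x\<^sup>2 - n\<close> and \<open>(x + y + z)\<^sup>2 - n\<close> sum to zero
  over the sphere \<open>x\<^sup>2 + y\<^sup>2 + z\<^sup>2 = n\<close>, for the divisor sums it follows from involutions on indefinite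
  binary forms. Thus \<open>T\<close>, \<open>D\<close>, \<open>K\<close> become sums over \<open>dk + el = N\<close>. Liouville's bijection
  \<open>(d, k, e, l) \<mapsto> (d - e, k, e, k + l)\<close>, applied to a suitable periodic function, evaluates
  \<open>2T + 3(D - K)\<close> as \<open>\<Sum>\<^bsub>dm = N\<^esub> \<chi>\<^sub>4(d) \<chi>\<^sub>3(d) (3m + d)\<close>. Finally, rotations of the hexagonal lattice
  turn \<open>D - K\<close> into a signed count that Jacobi's identity for the cube of the eta function collapses to
  \<open>\<Sum> y \<chi>\<^sub>4(y)\<close> over \<open>z\<^sup>2 + 3y\<^sup>2 = N\<close>, and one more rotation gives the sum over \<open>a\<^sup>2 + 3b\<^sup>2 = 4N\<close>.
\<close>

section \<open>Characters and divisor sums\<close>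

text \<open>A periodic kernel yields only divisor sums, whereas \<open>T\<close> also contains the
  sum over \<open>a^2 + 3 b^2 = 4 N\<close>, the contribution of a cusp form; so such an argument
  cannot evaluate \<open>T\<close> alone. The counts \<open>D\<close> and \<open>K\<close>, in which
  \<open>x^2 + y^2\<close> is dilated by 3, are brought in because \<open>D - K\<close> is a
  multiple of that same sum: adding \<open>3 (D - K)\<close> removes it from \<open>2 T\<close> and
  leaves a pure divisor sum. The removed part is then recovered by evaluating \<open>D - K\<close>
  separately.

  The parity conditions come from \<open>z^2 + 3 v^2\<close>. The count of its representations is
  twice the divisor sum of \<open>chi3\<close> at odd arguments, but not in general: 4 has six
  representations while its divisor sum is 1. As N is odd, prescribing equal parity for x and y
  keeps the value left for \<open>z^2 + 3 v^2\<close> odd.\<close>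

definition chi4 :: "int \<Rightarrow> int" where
  "chi4 x = (if x mod 4 = 1 then 1 else if x mod 4 = 3 then - 1 else 0)"

definition chi3 :: "int \<Rightarrow> int" where
  "chi3 x = (if x mod 3 = 1 then 1 else if x mod 3 = 2 then - 1 else 0)"

lemma chi4_cong: "x mod 4 = y mod 4 \<Longrightarrow> chi4 x = chi4 y"
  by (simp add: chi4_def)

lemma chi3_cong: "x mod 3 = y mod 3 \<Longrightarrow> chi3 x = chi3 y"
  by (simp add: chi3_def)

lemma chi4_minus [simp]: "chi4 (- x) = - chi4 x"
proof -
  have "x mod 4 = 0 \<or> x mod 4 = 1 \<or> x mod 4 = 2 \<or> x mod 4 = 3" by presburger
  moreover have "(- x) mod 4 = (- (x mod 4)) mod 4" by (simp add: mod_minus_eq)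
  ultimately show ?thesis by (auto simp: chi4_def)
qed

lemma chi3_minus [simp]: "chi3 (- x) = - chi3 x"
proof -
  have "x mod 3 = 0 \<or> x mod 3 = 1 \<or> x mod 3 = 2" by presburger
  moreover have "(- x) mod 3 = (- (x mod 3)) mod 3" by (simp add: mod_minus_eq)
  ultimately show ?thesis by (auto simp: chi3_def)
qed

lemma chi4_mult: "chi4 (x * y) = chi4 x * chi4 y"
proof -
  have m1: "chi4 (a * b) = chi4 a * chi4 b" if "a \<in> {0, 1, 2, 3}" "b \<in> {0, 1, 2, 3}" for a b
    using that by (auto simp: chi4_def)
  have m2: "x mod 4 \<in> {0, 1, 2, 3}" "y mod 4 \<in> {0, 1, 2, 3}"
    unfolding insert_iff empty_iff by presburger+
  have "chi4 ((x mod 4) * (y mod 4)) = chi4 (x mod 4) * chi4 (y mod 4)" by (rule m1[OF m2])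
  moreover have "chi4 ((x mod 4) * (y mod 4)) = chi4 (x * y)"
    by (rule chi4_cong) (rule mod_mult_eq)
  moreover have "chi4 (x mod 4) = chi4 x" "chi4 (y mod 4) = chi4 y"
    by (rule chi4_cong, simp)+
  ultimately show ?thesis by metis
qed

lemma chi3_mult: "chi3 (x * y) = chi3 x * chi3 y"
proof -
  have m1: "chi3 (a * b) = chi3 a * chi3 b" if "a \<in> {0, 1, 2}" "b \<in> {0, 1, 2}" for a b
    using that by (auto simp: chi3_def)
  have m2: "x mod 3 \<in> {0, 1, 2}" "y mod 3 \<in> {0, 1, 2}"
    unfolding insert_iff empty_iff by presburger+
  have "chi3 ((x mod 3) * (y mod 3)) = chi3 (x mod 3) * chi3 (y mod 3)" by (rule m1[OF m2])
  moreover have "chi3 ((x mod 3) * (y mod 3)) = chi3 (x * y)"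
    by (rule chi3_cong) (rule mod_mult_eq)
  moreover have "chi3 (x mod 3) = chi3 x" "chi3 (y mod 3) = chi3 y"
    by (rule chi3_cong, simp)+
  ultimately show ?thesis by metis
qed

lemma odd_mod4: "odd x \<Longrightarrow> x mod 4 = 1 \<or> x mod 4 = (3::int)"
  by presburger

lemma chi4_even: "even x \<Longrightarrow> chi4 x = 0"
proof -
  assume "even x"
  hence "x mod 4 \<noteq> 1" "x mod 4 \<noteq> 3" by presburger+
  thus ?thesis by (simp add: chi4_def)
qed

lemma chi3_dvd: "3 dvd x \<Longrightarrow> chi3 x = 0"
  by (auto simp: chi3_def)

lemma chi4_add2: "odd x \<Longrightarrow> chi4 (x + 2) = - chi4 x"
proof -
  assume "odd x"
  hence "x mod 4 = 1 \<and> (x + 2) mod 4 = 3 \<or> x mod 4 = 3 \<and> (x + 2) mod 4 = 1" by presburger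
  thus ?thesis by (auto simp: chi4_def)
qed

lemma chi4_odd_square: "odd x \<Longrightarrow> chi4 x * chi4 x = 1"
  using odd_mod4[of x] by (auto simp: chi4_def)

definition dpairs :: "int \<Rightarrow> (int \<times> int) set" where
  "dpairs m = {(d, k). d > 0 \<and> k > 0 \<and> d * k = m}"

definition lam4 :: "int \<Rightarrow> int" where "lam4 m = (\<Sum>(d, k)\<in>dpairs m. chi4 d)"

definition lam3 :: "int \<Rightarrow> int" where "lam3 m = (\<Sum>(d, k)\<in>dpairs m. chi3 d)"

lemma pos_factor_le: "d > 0 \<Longrightarrow> k > 0 \<Longrightarrow> d * k \<le> (N::int) \<Longrightarrow> d \<le> N \<and> k \<le> N"
proof -
  assume a: "d > 0" "k > 0" "d * k \<le> N"
  have "d * 1 \<le> d * k" by (rule mult_left_mono) (use a in auto)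
  moreover have "1 * k \<le> d * k" by (rule mult_right_mono) (use a in auto)
  ultimately show ?thesis using a by linarith
qed

lemma finite_dpairs [simp]: "finite (dpairs m)"
proof (rule finite_subset)
  show "dpairs m \<subseteq> {0..m} \<times> {0..m}"
  proof
    fix p assume "p \<in> dpairs m"
    then obtain d k where "p = (d, k)" "d > 0" "k > 0" "d * k = m" by (auto simp: dpairs_def)
    thus "p \<in> {0..m} \<times> {0..m}" using pos_factor_le[of d k m] by simp
  qed
qed simp

lemma square_le_imp: "x^2 \<le> (n::int) \<Longrightarrow> - n \<le> x \<and> x \<le> n"
proof -
  assume a: "x^2 \<le> n"
  have "\<bar>x\<bar> \<le> x^2"
  proof (cases "x = 0")
    case False
    hence "1 \<le> \<bar>x\<bar>" by linarith
    hence "\<bar>x\<bar> * 1 \<le> \<bar>x\<bar> * \<bar>x\<bar>" by (intro mult_left_mono) auto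
    thus ?thesis by (simp add: power2_eq_square)
  qed simp
  thus ?thesis using a by linarith
qed

lemma odd_square_mod8: "odd x \<Longrightarrow> (x::int)^2 mod 8 = 1"
proof -
  assume "odd x"
  then obtain k where k: "x = 2 * k + 1" by (auto elim: oddE)
  have "even (k * (k + 1))" by simp
  then obtain j where j: "k * (k + 1) = 2 * j" by (rule evenE)
  have "x^2 = 8 * j + 1" using j k by (simp add: power2_eq_square algebra_simps)
  thus ?thesis by presburger
qed

lemma even_square_mod4: "even x \<Longrightarrow> (x::int)^2 mod 4 = 0"
  by (auto elim!: evenE simp: power2_eq_square)

lemma square_mod4: "(z::int)^2 mod 4 = (if odd z then 1 else 0)"
proof (cases "even z")
  case False
  have "r mod 8 = 1 \<Longrightarrow> r mod 4 = 1" for r :: int by presburger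
  thus ?thesis using odd_square_mod8[of z] False by simp
qed (simp add: even_square_mod4)

section \<open>Sign-reversing involutions and convolutions\<close>

lemma sum_antisym:
  fixes h :: "'a \<Rightarrow> int"
  assumes "\<And>p. p \<in> A \<Longrightarrow> i p \<in> A" "\<And>p. p \<in> A \<Longrightarrow> i (i p) = p" "\<And>p. p \<in> A \<Longrightarrow> h (i p) = - h p"
  shows "sum h A = 0"
proof -
  have "sum h A = (\<Sum>p\<in>A. - h p)"
    by (rule sum.reindex_bij_witness[of _ i i]) (use assms in auto)
  thus ?thesis by (simp add: sum_negf)
qed

text \<open>Sorts the pairs by \<open>c = f p\<close>; nonnegativity of f and g together with
  \<open>m \<ge> 1\<close> confines c to \<open>{0..N}\<close>. Applied both to divisor pairs and to
  lattice points, it gives the two kinds of sum the same convolution shape, in which they can be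
  compared term by term.\<close>

lemma sum_conv:
  fixes f :: "'a \<Rightarrow> int" and g :: "'b \<Rightarrow> int" and u v :: "_ \<Rightarrow> int"
  assumes fin: "\<And>c. finite {p. P p \<and> f p = c}" "\<And>b. finite {q. R q \<and> g q = b}"
    and nn: "\<And>p. P p \<Longrightarrow> f p \<ge> 0" "\<And>q. R q \<Longrightarrow> g q \<ge> 0" and m: "m \<ge> 1"
  shows "(\<Sum>(p, q)\<in>{(p, q). P p \<and> R q \<and> m * f p + g q = N}. u p * v q)
    = (\<Sum>c\<in>{0..N}. (\<Sum>p | P p \<and> f p = c. u p) * (\<Sum>q | R q \<and> g q = N - m * c. v q))"
proof -
  define A where "A c = {p. P p \<and> f p = c}" for c
  define B where "B c = {q. R q \<and> g q = N - m * c}" for c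
  have le: "f p \<le> N" if "P p" "R q" "m * f p + g q = N" for p q
  proof -
    have "1 * f p \<le> m * f p" using m nn(1)[OF that(1)] by (intro mult_right_mono) auto
    thus ?thesis using that nn(2)[OF that(2)] by linarith
  qed
  have eq: "{(p, q). P p \<and> R q \<and> m * f p + g q = N} = (\<Union>c\<in>{0..N}. A c \<times> B c)"
    using le nn by (fastforce simp: A_def B_def)
  have "(\<Sum>(p, q)\<in>(\<Union>c\<in>{0..N}. A c \<times> B c). u p * v q)
      = (\<Sum>c\<in>{0..N}. \<Sum>(p, q)\<in>A c \<times> B c. u p * v q)"
    by (rule sum.UNION_disjoint) (use fin in \<open>auto simp: A_def B_def\<close>)
  also have "\<dots> = (\<Sum>c\<in>{0..N}. sum u (A c) * sum v (B c))"
    by (simp add: sum_product sum.cartesian_product)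
  finally show ?thesis unfolding eq A_def B_def .
qed

section \<open>Sums of two squares\<close>

text \<open>
  The three involutions are changes of basis of the indefinite form \<open>2dX\<^sup>2 + 2xXY - kY\<^sup>2\<close>; which of
  them preserves the signs of the outer coefficients depends on the signs of \<open>d + 2x - 2k\<close> and
  \<open>k - 2x - 2d\<close>.
\<close>

lemma windmill_sum:
  fixes n :: int and w :: "int \<Rightarrow> int \<Rightarrow> int \<Rightarrow> int"
  assumes n: "n mod 4 = 3"
    and refl: "\<And>d x k. x^2 + 2 * d * k = n \<Longrightarrow> w d (- x) k = w d x k"
    and swap: "\<And>d x k. x^2 + 2 * d * k = n \<Longrightarrow> w k (- x) d = w d x k"
    and iota: "\<And>d x k. x^2 + 2 * d * k = n \<Longrightarrow> w (d + 2 * x - 2 * k) (2 * k - x) k = w d x k"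
    and kappa: "\<And>d x k. x^2 + 2 * d * k = n \<Longrightarrow>
       w (2 * k - d - 2 * x) (2 * d + 3 * x - 2 * k) (2 * d + 2 * x - k) = - w d x k"
  shows "(\<Sum>(d, x, k)\<in>{(d, x, k). d > 0 \<and> k > 0 \<and> x^2 + 2 * d * k = n}. (x^2 - d * k) * w d x k) = 0"
proof -
  define Om where "Om = {(d, x, k). d > 0 \<and> k > 0 \<and> x^2 + 2 * d * k = n}"
  \<comment> \<open>Oddness of d and k keeps \<open>d + 2 * x - 2 * k\<close> and
    \<open>k - 2 * x - 2 * d\<close> from vanishing, so that no form lies on a boundary between the
    regions \<open>P\<close>, \<open>P'\<close> and \<open>M\<close>.\<close>
  have odds: "odd d \<and> odd k" if "x^2 + 2 * d * k = n" for d x k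
  proof -
    have "odd n" using n by presburger
    hence "odd x" using that by auto
    hence "x^2 mod 4 = 1" using odd_square_mod8[of x] by presburger
    hence "(2 * (d * k)) mod 4 = 2" using n that by (simp add: mult.assoc) presburger
    moreover have "odd q" if "(2 * q) mod 4 = 2" for q :: int using that by presburger
    ultimately have "odd (d * k)" by blast
    thus ?thesis by simp
  qed
  \<comment> \<open>The factor \<open>x^2 - d * k\<close> equals
    \<open>(x - k) * (x + d) + x * (k - d)\<close>. The product changes sign under the map of
    \<open>iota\<close> and is fixed by those of \<open>swap\<close> and \<open>kappa\<close>, where
    on \<open>M\<close> the sign comes from \<open>w\<close> instead. The remaining term is odd in x
    and vanishes in \<open>gOm\<close>.\<close>
  define h where "h = (\<lambda>(d, x, k). (x - k) * (x + d) * w d x k)"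
  define P where "P = {(d, x, k). (d, x, k) \<in> Om \<and> d + 2 * x - 2 * k > 0}"
  define P' where "P' = {(d, x, k). (d, x, k) \<in> Om \<and> k - 2 * x - 2 * d > 0}"
  define M where "M = {(d, x, k). (d, x, k) \<in> Om \<and> 2 * k - d - 2 * x > 0 \<and> 2 * d + 2 * x - k > 0}"
  have finOm: "finite Om"
  proof (rule finite_subset)
    show "Om \<subseteq> {0..n} \<times> {- n..n} \<times> {0..n}"
    proof
      fix p assume "p \<in> Om"
      then obtain d x k where p: "p = (d, x, k)" and a: "d > 0" "k > 0" "x^2 + 2 * d * k = n"
        by (auto simp: Om_def)
      have "d * k > 0" using a by simp
      hence "d * k \<le> n" "x^2 \<le> n" using a zero_le_power2[of x] by (auto simp: mult.assoc)
      thus "p \<in> {0..n} \<times> {- n..n} \<times> {0..n}"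
        using p pos_factor_le[of d k n] square_le_imp[of x n] a by auto
    qed
  qed simp
  have part: "Om = P \<union> (P' \<union> M)"
  proof -
    have "d + 2 * x - 2 * k \<noteq> 0 \<and> k - 2 * x - 2 * d \<noteq> 0" if "(d, x, k) \<in> Om" for d x k
      using odds[of x d k] that by (auto simp: Om_def) presburger+
    thus ?thesis unfolding P_def P'_def M_def by fastforce
  qed
  have hP: "sum h P = 0"
  proof (rule sum_antisym[of _ "\<lambda>(d, x, k). (d + 2 * x - 2 * k, 2 * k - x, k)"], goal_cases)
    case (1 p) thus ?case by (cases p) (auto simp: P_def Om_def power2_eq_square algebra_simps)
  next
    case (2 p) thus ?case by (cases p) auto
  next
    case (3 p) thus ?case by (cases p) (auto simp: P_def Om_def h_def iota, simp add: algebra_simps)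
  qed
  have hP': "sum h P' = sum h P"
  proof (rule sum.reindex_bij_witness[of _ "\<lambda>(d, x, k). (k, - x, d)" "\<lambda>(d, x, k). (k, - x, d)"], goal_cases)
    case (5 p) thus ?case by (cases p) (auto simp: P'_def Om_def h_def swap, simp add: algebra_simps)
  qed (auto simp: P_def P'_def Om_def algebra_simps)
  have hM: "sum h M = 0"
  proof (rule sum_antisym[of _ "\<lambda>(d, x, k). (2 * k - d - 2 * x, 2 * d + 3 * x - 2 * k, 2 * d + 2 * x - k)"], goal_cases)
    case (1 p) thus ?case by (cases p) (auto simp: M_def Om_def power2_eq_square algebra_simps)
  next
    case (2 p) thus ?case by (cases p) auto
  next
    case (3 p) thus ?case by (cases p) (auto simp: M_def Om_def h_def kappa)
  qed
  have "sum h Om = sum h P + (sum h P' + sum h M)"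
  proof -
    have f: "finite P" "finite P'" "finite M"
      using finOm by (auto intro: finite_subset simp: part)
    have "P' \<inter> M = {}" by (auto simp: P'_def M_def)
    moreover have "P \<inter> (P' \<union> M) = {}" by (auto simp: P_def P'_def M_def Om_def)
    ultimately show ?thesis unfolding part using f by (simp add: sum.union_disjoint)
  qed
  hence hOm: "sum h Om = 0" using hP hP' hM by simp
  have gOm: "(\<Sum>(d, x, k)\<in>Om. x * (k - d) * w d x k) = 0"
    by (rule sum_antisym[of _ "\<lambda>(d, x, k). (d, - x, k)"]) (auto simp: Om_def refl)
  have "(\<Sum>(d, x, k)\<in>Om. (x^2 - d * k) * w d x k) = sum h Om + (\<Sum>(d, x, k)\<in>Om. x * (k - d) * w d x k)"
    unfolding sum.distrib[symmetric]
    by (rule sum.cong) (auto simp: h_def power2_eq_square algebra_simps)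
  thus ?thesis using hOm gOm by (simp add: Om_def)
qed

section \<open>Counting representations by x^2 + y^2\<close>

definition r2 :: "int \<Rightarrow> int" where
  "r2 m = int (card {(x::int, y::int). x^2 + y^2 = m})"

lemma finite_r2 [simp]: "finite {(x::int, y::int). x^2 + y^2 = m}"
proof (rule finite_subset)
  show "{(x::int, y::int). x^2 + y^2 = m} \<subseteq> {- m..m} \<times> {- m..m}"
  proof clarify
    fix x y :: int
    have "x^2 \<ge> 0" "y^2 \<ge> 0" by simp_all
    thus "x \<in> {- (x^2 + y^2)..x^2 + y^2} \<and> y \<in> {- (x^2 + y^2)..x^2 + y^2}"
      using square_le_imp[of x "x^2 + y^2"] square_le_imp[of y "x^2 + y^2"] by simp
  qed
qed simp

lemma card_bij_witness:
  assumes "\<And>p. p \<in> A \<Longrightarrow> j p \<in> B" "\<And>q. q \<in> B \<Longrightarrow> i q \<in> A"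
    and "\<And>p. p \<in> A \<Longrightarrow> i (j p) = p" "\<And>q. q \<in> B \<Longrightarrow> j (i q) = q"
  shows "card A = card B"
  by (rule bij_betw_same_card[of j], rule bij_betw_byWitness[of _ i]) (use assms in auto)

text \<open>Conjugation followed by multiplication by 1 + i in the Gaussian integers. Every vector
  of norm 2m is reached because its coordinates have equal parity.\<close>

lemma r2_double: "r2 (2 * m) = r2 m"
proof -
  have "card {(x, y). x^2 + y^2 = m} = card {(x, y). x^2 + y^2 = 2 * m}"
  proof (rule card_bij_witness[of _ "\<lambda>(x, y). (x + y, x - y)" _ "\<lambda>(x, y). ((x + y) div 2, (x - y) div 2)"], goal_cases)
    case (1 p) thus ?case by (cases p) (simp add: power2_eq_square algebra_simps)
  next
    case (2 p)
    then obtain x y where p: "p = (x, y)" "x^2 + y^2 = 2 * m" by (cases p) auto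
    hence "even (x^2 + y^2)" by simp
    hence "even (x + y)" "even (x - y)" by auto
    then obtain a b where ab: "x + y = 2 * a" "x - y = 2 * b" by (meson evenE)
    have "4 * (a^2 + b^2) = (2 * a)^2 + (2 * b)^2" by (simp add: power2_eq_square)
    also have "\<dots> = 2 * (x^2 + y^2)" unfolding ab[symmetric] by (simp add: power2_eq_square algebra_simps)
    finally have "a^2 + b^2 = m" using p(2) by simp
    thus ?case using p ab by simp
  next
    case (3 p) thus ?case by (cases p) auto
  next
    case (4 p)
    then obtain x y where p: "p = (x, y)" "x^2 + y^2 = 2 * m" by (cases p) auto
    hence "even (x^2 + y^2)" by simp
    hence "even (x + y)" "even (x - y)" by auto
    then obtain a b where ab: "x + y = 2 * a" "x - y = 2 * b" by (meson evenE)
    hence "x = a + b" "y = a - b" by auto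
    thus ?case using p ab by simp
  qed
  thus ?thesis by (simp add: r2_def)
qed

lemma r2_mod4: "m mod 4 = 3 \<Longrightarrow> r2 m = 0"
proof -
  assume m: "m mod 4 = 3"
  have sq: "z^2 mod 4 = 0 \<or> z^2 mod 4 = 1" for z :: int by (simp add: square_mod4)
  have "x^2 + y^2 \<noteq> m" for x y :: int
    using sq[of x] sq[of y] m by presburger
  hence "{(x::int, y::int). x^2 + y^2 = m} = {}" by auto
  thus ?thesis by (simp add: r2_def)
qed

lemma r2_neg: "m < 0 \<Longrightarrow> r2 m = 0"
proof -
  assume "m < 0"
  hence "x^2 + y^2 \<noteq> m" for x y :: int using zero_le_power2[of x] zero_le_power2[of y] by linarith
  hence "{(x::int, y::int). x^2 + y^2 = m} = {}" by auto
  thus ?thesis by (simp add: r2_def)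
qed

lemma r2_0: "r2 0 = 1"
proof -
  have "{(x::int, y::int). x^2 + y^2 = 0} = {(0, 0)}" by (auto simp: sum_power2_eq_zero_iff)
  thus ?thesis by (simp add: r2_def)
qed

lemma r2_1: "r2 1 = 4"
proof -
  have "{(x::int, y::int). x^2 + y^2 = 1} = {(1, 0), (- 1, 0), (0, 1), (0, - 1)}"
  proof (intro equalityI subsetI)
    fix p assume "p \<in> {(x::int, y::int). x^2 + y^2 = 1}"
    then obtain x y where p: "p = (x, y)" "x^2 + y^2 = 1" by auto
    hence "x \<in> {- 1..1}" "y \<in> {- 1..1}"
      using square_le_imp[of x 1] square_le_imp[of y 1] zero_le_power2[of x] zero_le_power2[of y] by auto
    hence "x = - 1 \<or> x = 0 \<or> x = 1" "y = - 1 \<or> y = 0 \<or> y = 1" by auto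
    thus "p \<in> {(1, 0), (- 1, 0), (0, 1), (0, - 1)}" using p by (elim disjE) simp_all
  qed auto
  thus ?thesis by (simp add: r2_def)
qed

lemma lam_neg: "m \<le> 0 \<Longrightarrow> dpairs m = {}"
proof -
  assume "m \<le> 0"
  hence "d * k \<noteq> m" if "d > 0" "k > 0" for d k using mult_pos_pos[OF that] by linarith
  thus ?thesis unfolding dpairs_def by auto
qed

lemma dpairs_1: "dpairs 1 = {(1, 1)}"
  by (auto simp: dpairs_def pos_zmult_eq_1_iff)

lemma lam4_1: "lam4 1 = 1"
  by (simp add: lam4_def dpairs_1 chi4_def)

text \<open>Even divisors have \<open>chi4 d = 0\<close>, and m and 2m have the same odd
  divisors.\<close>

lemma lam4_double: "lam4 (2 * m) = lam4 m"
proof -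
  let ?o = "\<lambda>m. {(d, k). (d, k) \<in> dpairs m \<and> odd d}"
  have r: "lam4 m = (\<Sum>(d, k)\<in>?o m. chi4 d)" for m
    unfolding lam4_def by (rule sum.mono_neutral_right) (auto simp: chi4_even)
  have "(\<Sum>(d, k)\<in>?o m. chi4 d) = (\<Sum>(d, k)\<in>?o (2 * m). chi4 d)"
  proof (rule sum.reindex_bij_witness[of _ "\<lambda>(d, k). (d, k div 2)" "\<lambda>(d, k). (d, 2 * k)"], goal_cases)
    case (4 p)
    then obtain d k where p: "p = (d, k)" "d > 0" "k > 0" "d * k = 2 * m" "odd d" by (auto simp: dpairs_def)
    hence "even (d * k)" by simp
    hence "even k" using p(5) by simp
    then obtain k' where "k = 2 * k'" by (rule evenE)
    thus ?case using p by (simp add: dpairs_def)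
  next
    case (3 p)
    then obtain d k where p: "p = (d, k)" "d > 0" "k > 0" "d * k = 2 * m" "odd d" by (auto simp: dpairs_def)
    hence "even (d * k)" by simp
    hence "even k" using p(5) by simp
    then obtain k' where "k = 2 * k'" by (rule evenE)
    thus ?case using p by (simp add: dpairs_def)
  qed (auto simp: dpairs_def)
  thus ?thesis by (simp add: r)
qed

lemma lam4_mod4: "m mod 4 = 3 \<Longrightarrow> lam4 m = 0"
proof -
  assume m: "m mod 4 = 3"
  show ?thesis unfolding lam4_def
  proof (rule sum_antisym[of _ "\<lambda>(d, k). (k, d)"], goal_cases)
    case (3 p)
    then obtain d k where p: "p = (d, k)" "d * k = m" by (auto simp: dpairs_def)
    have "chi4 (d * k) = - 1" using m p by (simp add: chi4_def)
    hence "chi4 d * chi4 k = - 1" by (simp only: chi4_mult)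
    hence "chi4 k = - chi4 d" unfolding chi4_def by (auto split: if_splits)
    thus ?case using p by simp
  qed (auto simp: dpairs_def mult.commute)
qed

text \<open>Permuting coordinates shows that \<open>x^2\<close>, \<open>y^2\<close> and
  \<open>z^2\<close> have equal sums over the sphere, so \<open>3 * x^2\<close> and n do too.
  Slicing by x turns this into a relation between values of \<open>r2\<close>.\<close>

lemma r2_recurrence_sum:
  fixes n :: int
  shows "(\<Sum>x\<in>{- n..n}. (3 * x^2 - n) * r2 (n - x^2)) = 0"
proof -
  define B where "B x = {(y::int, z::int). y^2 + z^2 = n - x^2}" for x
  let ?S = "Sigma {- n..n} B"
  have S: "?S = {(x, y, z). x^2 + y^2 + z^2 = n}"
  proof (intro equalityI subsetI)
    fix p assume "p \<in> {(x::int, y::int, z::int). x^2 + y^2 + z^2 = n}"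
    then obtain x y z where p: "p = (x, y, z)" "x^2 + y^2 + z^2 = n" by auto
    hence "x^2 \<le> n" using zero_le_power2[of y] zero_le_power2[of z] by linarith
    thus "p \<in> ?S" using p square_le_imp[of x n] by (auto simp: B_def)
  qed (auto simp: B_def)
  have a: "(\<Sum>(x, y, z)\<in>?S. x^2) = (\<Sum>(x, y, z)\<in>?S. y^2)"
    by (rule sum.reindex_bij_witness[of _ "\<lambda>(x, y, z). (y, x, z)" "\<lambda>(x, y, z). (y, x, z)"]) (auto simp: S)
  have b: "(\<Sum>(x, y, z)\<in>?S. x^2) = (\<Sum>(x, y, z)\<in>?S. z^2)"
    by (rule sum.reindex_bij_witness[of _ "\<lambda>(x, y, z). (z, y, x)" "\<lambda>(x, y, z). (z, y, x)"]) (auto simp: S)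
  have "(\<Sum>(x, y, z)\<in>?S. 3 * x^2 - n)
      = (\<Sum>(x, y, z)\<in>?S. x^2) + (\<Sum>(x, y, z)\<in>?S. x^2) + (\<Sum>(x, y, z)\<in>?S. x^2) - (\<Sum>(x, y, z)\<in>?S. n)"
    unfolding sum.distrib[symmetric] sum_subtractf[symmetric] by (rule sum.cong) auto
  also have "\<dots> = (\<Sum>(x, y, z)\<in>?S. x^2) + (\<Sum>(x, y, z)\<in>?S. y^2) + (\<Sum>(x, y, z)\<in>?S. z^2) - (\<Sum>(x, y, z)\<in>?S. n)"
    using a b by simp
  also have "\<dots> = (\<Sum>(x, y, z)\<in>?S. x^2 + y^2 + z^2 - n)"
    unfolding sum.distrib[symmetric] sum_subtractf[symmetric] by (rule sum.cong) auto
  also have "\<dots> = 0" by (rule sum.neutral) (auto simp: S)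
  finally have "(\<Sum>(x, q)\<in>?S. 3 * x^2 - n) = 0" by (simp add: case_prod_beta)
  hence "(\<Sum>x\<in>{- n..n}. \<Sum>q\<in>B x. 3 * x^2 - n) = 0"
    by (subst sum.Sigma) (auto simp: B_def)
  thus ?thesis by (simp add: B_def r2_def mult.commute)
qed

lemma finite_odd_range [simp]: "finite {x::int. - n \<le> x \<and> x \<le> n \<and> odd x}"
  by (rule finite_subset[of _ "{- n..n}"]) auto

text \<open>
  Both recurrences express the value at \<open>x = \<plusminus>1\<close>, which belongs to the largest argument, through
  values at smaller arguments.
\<close>

lemma odd_sum_recurrence:
  fixes n :: int and u f g :: "int \<Rightarrow> int"
  assumes n: "n \<ge> 1" and z1: "(\<Sum>x | x \<in> {- n..n} \<and> odd x. u x * f x) = 0"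
    and z2: "(\<Sum>x | x \<in> {- n..n} \<and> odd x. u x * g x) = 0"
    and eq: "\<And>x. odd x \<Longrightarrow> x^2 \<noteq> 1 \<Longrightarrow> f x = g x"
    and sym: "u (- 1) = u 1" "f (- 1) = f 1" "g (- 1) = g 1" and u: "u 1 \<noteq> 0"
  shows "f 1 = g 1"
proof -
  have "(\<Sum>x | x \<in> {- n..n} \<and> odd x. u x * (f x - g x)) = 0"
    using z1 z2 by (simp add: right_diff_distrib sum_subtractf)
  moreover have "(\<Sum>x | x \<in> {- n..n} \<and> odd x. u x * (f x - g x)) = (\<Sum>x\<in>{- 1, 1}. u x * (f x - g x))"
  proof (rule sum.mono_neutral_right)
    show "\<forall>x\<in>{x \<in> {- n..n}. odd x} - {- 1, 1}. u x * (f x - g x) = 0"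
    proof
      fix x assume "x \<in> {x \<in> {- n..n}. odd x} - {- 1, 1}"
      hence "odd x" "x^2 \<noteq> 1" by (auto simp: power2_eq_1_iff)
      thus "u x * (f x - g x) = 0" using eq by simp
    qed
  qed (use n in auto)
  ultimately show ?thesis using sym u by simp
qed

text \<open>The weight \<open>chi4 d\<close> fits \<open>windmill_sum\<close> because
  \<open>n mod 8 = 3\<close> forces \<open>d * k\<close> to be 1 mod 4, so that d and k have the
  same character value. On the forms, \<open>2 * (x^2 - d * k) = 3 * x^2 - n\<close>, which is
  exactly the factor of \<open>r2_recurrence_sum\<close>.\<close>

lemma lam4_recurrence_sum:
  fixes n :: int
  assumes n: "n mod 8 = 3"
  shows "(\<Sum>x | x \<in> {- n..n} \<and> odd x. (3 * x^2 - n) * lam4 ((n - x^2) div 2)) = 0"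
proof -
  have par: "odd x \<and> odd d \<and> odd k \<and> chi4 k = chi4 d" if "x^2 + 2 * d * k = n" for d x k
  proof -
    have "odd n" using n by presburger
    hence x: "odd x" using that by auto
    have "(1 + 2 * q) mod 8 = 3 \<Longrightarrow> q mod 4 = 1" for q :: int by presburger
    moreover have "(1 + 2 * (d * k)) mod 8 = 3"
      using odd_square_mod8[OF x] that n by (metis mod_add_left_eq mult.assoc)
    ultimately have q: "(d * k) mod 4 = 1" by blast
    hence "chi4 (d * k) = 1" by (simp add: chi4_def)
    hence "chi4 d * chi4 k = 1" by (simp only: chi4_mult)
    moreover have "r mod 4 = 1 \<Longrightarrow> odd r" for r :: int by presburger
    hence "odd (d * k)" using q by blast
    ultimately show ?thesis using x by (auto simp: zmult_eq_1_iff)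
  qed
  define B where "B x = {(d, k). d > 0 \<and> k > 0 \<and> x^2 + 2 * d * k = n}" for x
  define I where "I = {x \<in> {- n..n}. odd x}"
  have B: "B x = dpairs ((n - x^2) div 2)" if "odd x" for x
  proof -
    have "even (n - x^2)" using that n by auto presburger
    then obtain c where "n - x^2 = 2 * c" by (rule evenE)
    thus ?thesis by (auto simp: B_def dpairs_def mult.assoc)
  qed
  have w: "(\<Sum>(d, x, k)\<in>{(d, x, k). d > 0 \<and> k > 0 \<and> x^2 + 2 * d * k = n}. (x^2 - d * k) * chi4 d) = 0"
  proof (rule windmill_sum[where w = "\<lambda>d x k. chi4 d"], goal_cases)
    case 1 thus ?case using n by presburger
  next
    case (3 d x k) thus ?case using par by blast
  next
    case (4 d x k)
    hence "odd x" "odd k" using par by blast+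
    thus ?case by (intro chi4_cong) presburger
  next
    case (5 d x k)
    hence "odd x" "odd k" using par by blast+
    hence "chi4 (2 * k - d - 2 * x) = chi4 (- d)" by (intro chi4_cong) presburger
    thus ?case by simp
  qed simp
  have "(\<Sum>(d, x, k)\<in>{(d, x, k). d > 0 \<and> k > 0 \<and> x^2 + 2 * d * k = n}. (x^2 - d * k) * chi4 d)
      = (\<Sum>(x, d, k)\<in>Sigma I B. (x^2 - d * k) * chi4 d)"
  proof (rule sum.reindex_bij_witness[of _ "\<lambda>(x, d, k). (d, x, k)" "\<lambda>(d, x, k). (x, d, k)"], goal_cases)
    case (2 p)
    then obtain d x k where p: "p = (d, x, k)" "d > 0" "k > 0" "x^2 + 2 * d * k = n" by auto
    hence "x^2 + 2 * (d * k) = n" by (simp add: mult.assoc)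
    hence "x^2 \<le> n" using mult_pos_pos[OF p(2,3)] by linarith
    thus ?case using p par[of x d k] square_le_imp[of x n] by (auto simp: I_def B_def)
  qed (auto simp: B_def)
  also have "\<dots> = (\<Sum>x\<in>I. \<Sum>(d, k)\<in>B x. (x^2 - d * k) * chi4 d)"
    by (subst sum.Sigma) (auto simp: I_def B)
  finally have "(\<Sum>x\<in>I. \<Sum>(d, k)\<in>B x. (x^2 - d * k) * chi4 d) = 0" using w by simp
  hence "(\<Sum>x\<in>I. 2 * (\<Sum>(d, k)\<in>B x. (x^2 - d * k) * chi4 d)) = 0"
    by (simp add: sum_distrib_left[symmetric])
  moreover have "2 * (\<Sum>(d, k)\<in>B x. (x^2 - d * k) * chi4 d) = (3 * x^2 - n) * lam4 ((n - x^2) div 2)"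
    if "x \<in> I" for x
  proof -
    have x: "odd x" using that by (simp add: I_def)
    have "2 * (\<Sum>(d, k)\<in>B x. (x^2 - d * k) * chi4 d) = (\<Sum>(d, k)\<in>B x. (3 * x^2 - n) * chi4 d)"
      unfolding sum_distrib_left by (rule sum.cong) (auto simp: B_def algebra_simps)
    thus ?thesis by (simp add: B[OF x] lam4_def sum_distrib_left case_prod_beta)
  qed
  ultimately show ?thesis unfolding I_def by simp
qed

text \<open>Even m reduces to m/2, and for m = 3 mod 4 both sides vanish. For m = 1 mod 4 the
  recurrences are used at \<open>n = 2 * m + 1\<close>: the terms x = 1 and x = -1 have argument 2m,
  every other odd x has a smaller one. Their coefficient 3 - n vanishes only for m = 1, which is
  therefore the base case.\<close>

lemma r2_eq: "m > 0 \<Longrightarrow> r2 m = 4 * lam4 m"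
proof (induction "nat m" arbitrary: m rule: less_induct)
  case less
  have "even m \<or> m mod 4 = 3 \<or> m mod 4 = 1" by presburger
  thus ?case
  proof (elim disjE)
    assume "even m"
    then obtain c where c: "m = 2 * c" by (rule evenE)
    hence "r2 c = 4 * lam4 c" using less by simp
    thus ?thesis by (simp add: c r2_double lam4_double)
  next
    assume "m mod 4 = 3" thus ?thesis by (simp add: r2_mod4 lam4_mod4)
  next
    assume m: "m mod 4 = 1"
    show ?thesis
    proof (cases "m = 1")
      case True thus ?thesis by (simp add: r2_1 lam4_1)
    next
      case False
      define n where "n = 2 * m + 1"
      have n: "n mod 8 = 3" using m unfolding n_def by presburger
      have half: "n - x^2 = 2 * ((n - x^2) div 2)" if "odd x" for x
      proof -
        have "even (n - x^2)" using that by (simp add: n_def)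
        thus ?thesis by simp
      qed
      have "(\<Sum>x | x \<in> {- n..n} \<and> odd x. (3 * x^2 - n) * r2 (n - x^2)) = (\<Sum>x\<in>{- n..n}. (3 * x^2 - n) * r2 (n - x^2))"
      proof (rule sum.mono_neutral_left)
        show "\<forall>x\<in>{- n..n} - {x \<in> {- n..n}. odd x}. (3 * x^2 - n) * r2 (n - x^2) = 0"
        proof
          fix x assume "x \<in> {- n..n} - {x \<in> {- n..n}. odd x}"
          hence "even x" by auto
          hence "x^2 mod 4 = 0" by (rule even_square_mod4)
          hence "(n - x^2) mod 4 = 3" using n by presburger
          thus "(3 * x^2 - n) * r2 (n - x^2) = 0" by (simp add: r2_mod4)
        qed
      qed auto
      hence z1: "(\<Sum>x | x \<in> {- n..n} \<and> odd x. (3 * x^2 - n) * r2 (n - x^2)) = 0"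
        by (simp add: r2_recurrence_sum)
      have "r2 (n - 1^2) = 4 * lam4 ((n - 1^2) div 2)"
      proof (rule odd_sum_recurrence[of n "\<lambda>x. 3 * x^2 - n" "\<lambda>x. r2 (n - x^2)" "\<lambda>x. 4 * lam4 ((n - x^2) div 2)"])
        show "n \<ge> 1" using less.prems by (simp add: n_def)
        show "3 * 1^2 - n \<noteq> 0" using False by (simp add: n_def)
        have "(\<Sum>x | x \<in> {- n..n} \<and> odd x. (3 * x^2 - n) * (4 * lam4 ((n - x^2) div 2)))
           = 4 * (\<Sum>x | x \<in> {- n..n} \<and> odd x. (3 * x^2 - n) * lam4 ((n - x^2) div 2))"
          unfolding sum_distrib_left by (rule sum.cong) auto
        thus "(\<Sum>x | x \<in> {- n..n} \<and> odd x. (3 * x^2 - n) * (4 * lam4 ((n - x^2) div 2))) = 0"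
          using lam4_recurrence_sum[OF n] by simp
        fix x :: int assume x: "odd x" "x^2 \<noteq> 1"
        define c where "c = (n - x^2) div 2"
        have c: "n - x^2 = 2 * c" using half[OF x(1)] by (simp add: c_def)
        have "x^2 mod 8 = 1" by (rule odd_square_mod8[OF x(1)])
        hence "c mod 4 = 1" using c n by presburger
        moreover have "c < m"
        proof -
          have "x \<noteq> 0" using x by auto
          hence "x^2 > 0" by simp
          hence "x^2 > 1" using x(2) by linarith
          thus ?thesis using c unfolding n_def by linarith
        qed
        ultimately have "r2 c = 4 * lam4 c"
        proof (cases "c > 0")
          case True
          thus ?thesis using less.hyps[of c] \<open>c < m\<close> by simp
        next
          case False
          hence "c < 0" using \<open>c mod 4 = 1\<close> by (cases "c = 0") auto
          thus ?thesis by (simp add: r2_neg lam4_def lam_neg)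
        qed
        thus "r2 (n - x^2) = 4 * lam4 ((n - x^2) div 2)" by (simp add: c r2_double)
      qed (use z1 in auto)
      thus ?thesis by (simp add: n_def r2_double)
    qed
  qed
qed

section \<open>The form \<open>z\<^sup>2 + 3v\<^sup>2\<close>\<close>

definition r13 :: "int \<Rightarrow> int" where
  "r13 m = int (card {(z::int, v::int). z^2 + 3 * v^2 = m})"

lemma finite_r13 [simp]: "finite {(z::int, v::int). z^2 + 3 * v^2 = m}"
proof (rule finite_subset)
  show "{(z::int, v::int). z^2 + 3 * v^2 = m} \<subseteq> {- m..m} \<times> {- m..m}"
  proof clarify
    fix x y :: int
    have "x^2 \<ge> 0" "y^2 \<ge> 0" by simp_all
    thus "x \<in> {- (x^2 + 3 * y^2)..x^2 + 3 * y^2} \<and> y \<in> {- (x^2 + 3 * y^2)..x^2 + 3 * y^2}"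
      using square_le_imp[of x "x^2 + 3 * y^2"] square_le_imp[of y "x^2 + 3 * y^2"] by simp
  qed
qed simp

lemma finite_r13_filter [simp]: "finite {(z::int, v::int). z^2 + 3 * v^2 = m \<and> Q z v}"
  by (rule finite_subset[OF _ finite_r13[of m]]) auto

lemma hex_parity:
  fixes u w :: int
  assumes "u^2 + 3 * w^2 = 4 * m"
  shows "even (u - w)"
proof -
  have "even (u^2 + 3 * w^2)" by (simp add: assms)
  thus ?thesis by auto
qed

text \<open>The substitution is multiplication by a sixth root of unity in the Eisenstein integers.\<close>

lemma hex_rotate_sum:
  fixes m :: int and f :: "int \<Rightarrow> int \<Rightarrow> int"
  assumes m: "odd m"
  shows "(\<Sum>(u, w) | u^2 + 3 * w^2 = 4 * m \<and> odd u \<and> 4 dvd u - w. f u w)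
       = (\<Sum>(z, v) | z^2 + 3 * v^2 = m. f (z - 3 * v) (z + v))"
proof (rule sum.reindex_bij_witness[of _ "\<lambda>(z, v). (z - 3 * v, z + v)" "\<lambda>(u, w). (w + (u - w) div 4, - ((u - w) div 4))"], goal_cases)
  case (1 p)
  then obtain u w where p: "p = (u, w)" "u^2 + 3 * w^2 = 4 * m" "4 dvd u - w" by auto
  then obtain t where t: "u - w = 4 * t" by (auto elim: dvdE)
  have "u = w + 4 * t" using t by simp
  thus ?case using p by simp
next
  case (2 p)
  then obtain u w where p: "p = (u, w)" "u^2 + 3 * w^2 = 4 * m" "4 dvd u - w" by auto
  then obtain t where "u - w = 4 * t" by (auto elim: dvdE)
  hence t: "u = w + 4 * t" by simp
  have "4 * ((w + t)^2 + 3 * t^2) = u^2 + 3 * w^2" unfolding t by (simp add: power2_eq_square algebra_simps)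
  hence "(w + t)^2 + 3 * t^2 = m" using p by simp
  thus ?case using p t by simp
next
  case (3 p)
  moreover have "- (4 * b) div 4 = - b" for b :: int by presburger
  ultimately show ?case by (cases p) simp
next
  case (4 p)
  then obtain z v where p: "p = (z, v)" "z^2 + 3 * v^2 = m" by auto
  have "odd (z^2 + 3 * v^2)" using p m by simp
  hence "odd (z - 3 * v)" by auto
  moreover have "(z - 3 * v)^2 + 3 * (z + v)^2 = 4 * m"
    using p(2) by (simp add: power2_eq_square algebra_simps)
  ultimately show ?case using p by simp
next
  case (5 p)
  then obtain u w where p: "p = (u, w)" "u^2 + 3 * w^2 = 4 * m" "4 dvd u - w" by auto
  then obtain t where t: "u - w = 4 * t" by (auto elim: dvdE)
  have "u = w + 4 * t" using t by simp
  thus ?case using p by (simp add: add.commute)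
qed

text \<open>By \<open>hex_parity\<close> w is odd together with u, so exactly one of u - w and u + w
  is divisible by 4, and the reflection of w exchanges the two cases.\<close>

lemma hex_odd_split:
  fixes m :: int and f :: "int \<Rightarrow> int \<Rightarrow> int"
  assumes f: "\<And>u w. f u (- w) = f u w"
  shows "(\<Sum>(u, w) | u^2 + 3 * w^2 = 4 * m \<and> odd u. f u w)
       = 2 * (\<Sum>(u, w) | u^2 + 3 * w^2 = 4 * m \<and> odd u \<and> 4 dvd u - w. f u w)"
proof -
  let ?A = "{(u, w). u^2 + 3 * w^2 = 4 * m \<and> odd u \<and> 4 dvd u - w}"
  let ?B = "{(u, w). u^2 + 3 * w^2 = 4 * m \<and> odd u \<and> 4 dvd u + w}"
  have "{(u, w). u^2 + 3 * w^2 = 4 * m \<and> odd u} = ?A \<union> ?B"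
  proof (intro equalityI subsetI)
    fix p assume "p \<in> {(u, w). u^2 + 3 * w^2 = 4 * m \<and> odd u}"
    then obtain u w where p: "p = (u, w)" "u^2 + 3 * w^2 = 4 * m" "odd u" by auto
    hence "even (u - w)" using hex_parity by blast
    hence "4 dvd u - w \<or> 4 dvd u + w" using p(3) by presburger
    thus "p \<in> ?A \<union> ?B" using p by auto
  qed auto
  moreover have "?A \<inter> ?B = {}"
  proof -
    have "\<not> (4 dvd u - w \<and> 4 dvd u + w)" if "odd u" for u w :: int using that by presburger
    thus ?thesis by auto
  qed
  ultimately have "(\<Sum>(u, w) | u^2 + 3 * w^2 = 4 * m \<and> odd u. f u w) = (\<Sum>(u, w)\<in>?A. f u w) + (\<Sum>(u, w)\<in>?B. f u w)"
    by (simp add: sum.union_disjoint)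
  moreover have "(\<Sum>(u, w)\<in>?B. f u w) = (\<Sum>(u, w)\<in>?A. f u w)"
    by (rule sum.reindex_bij_witness[of _ "\<lambda>(u, w). (u, - w)" "\<lambda>(u, w). (u, - w)"]) (auto simp: f)
  ultimately show ?thesis by simp
qed

text \<open>An Eisenstein integer of odd norm is a unit modulo 2. Of its three products with the
  cube roots of unity exactly one lies in Z[sqrt(-3)], that is, has even u and w. Hence the odd
  solutions are twice as many as the even ones.\<close>

lemma r13_odd4:
  assumes "odd m"
  shows "int (card {(u::int, w::int). u^2 + 3 * w^2 = 4 * m \<and> odd u}) = 2 * r13 m"
  using hex_odd_split[of "\<lambda>_ _. 1" m] hex_rotate_sum[OF assms, of "\<lambda>_ _. 1"]
  by (simp add: r13_def case_prod_beta)

lemma r13_even4: "int (card {(u::int, w::int). u^2 + 3 * w^2 = 4 * m \<and> even u}) = r13 m"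
proof -
  have "card {(z, v). z^2 + 3 * v^2 = m} = card {(u::int, w::int). u^2 + 3 * w^2 = 4 * m \<and> even u}"
  proof (rule card_bij_witness[of _ "\<lambda>(z, v). (2 * z, 2 * v)" _ "\<lambda>(u, w). (u div 2, w div 2)"], goal_cases)
    case (2 p)
    then obtain u w where p: "p = (u, w)" "u^2 + 3 * w^2 = 4 * m" "even u" by auto
    moreover have "even w" using hex_parity[OF p(2)] p(3) by auto
    ultimately obtain a b where "u = 2 * a" "w = 2 * b" by (auto elim!: evenE)
    thus ?case using p by (simp add: power2_eq_square)
  next
    case (4 p)
    then obtain u w where p: "p = (u, w)" "u^2 + 3 * w^2 = 4 * m" "even u" by auto
    moreover have "even w" using hex_parity[OF p(2)] p(3) by auto
    ultimately show ?case by simp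
  qed (auto simp: power2_eq_square)
  thus ?thesis by (simp add: r13_def)
qed

lemma r13_times4: "odd m \<Longrightarrow> r13 (4 * m) = 3 * r13 m"
proof -
  assume m: "odd m"
  let ?A = "{(u::int, w::int). u^2 + 3 * w^2 = 4 * m \<and> odd u}"
  let ?B = "{(u::int, w::int). u^2 + 3 * w^2 = 4 * m \<and> even u}"
  have "{(u::int, w::int). u^2 + 3 * w^2 = 4 * m} = ?A \<union> ?B" by auto
  hence "card {(u::int, w::int). u^2 + 3 * w^2 = 4 * m} = card ?A + card ?B"
    by (simp add: card_Un_disjoint disjoint_iff)
  thus ?thesis using r13_odd4[OF m] r13_even4[of m] by (simp add: r13_def)
qed

lemma lam3_mod3: "m mod 3 = 2 \<Longrightarrow> lam3 m = 0"
proof -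
  assume m: "m mod 3 = 2"
  show ?thesis unfolding lam3_def
  proof (rule sum_antisym[of _ "\<lambda>(d, k). (k, d)"], goal_cases)
    case (3 p)
    then obtain d k where p: "p = (d, k)" "d * k = m" by (auto simp: dpairs_def)
    have "chi3 (d * k) = - 1" using m p by (simp add: chi3_def)
    hence "chi3 d * chi3 k = - 1" by (simp only: chi3_mult)
    hence "chi3 k = - chi3 d" unfolding chi3_def by (auto split: if_splits)
    thus ?case using p by simp
  qed (auto simp: dpairs_def mult.commute)
qed

lemma lam3_swap: "(\<Sum>(d, k)\<in>dpairs m. chi3 k) = lam3 m"
  unfolding lam3_def
  by (rule sum.reindex_bij_witness[of _ "\<lambda>(d, k). (k, d)" "\<lambda>(d, k). (k, d)"]) (auto simp: dpairs_def mult.commute)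

lemma prime3_dvd_mult: "3 dvd a * b \<longleftrightarrow> 3 dvd a \<or> 3 dvd (b::int)"
  by (rule prime_dvd_mult_iff) simp

lemma lam3_triple: "lam3 (3 * m) = lam3 m"
proof -
  let ?o = "\<lambda>m. {(d, k). (d, k) \<in> dpairs m \<and> \<not> 3 dvd d}"
  have r: "lam3 m = (\<Sum>(d, k)\<in>?o m. chi3 d)" for m
    unfolding lam3_def by (rule sum.mono_neutral_right) (auto simp: chi3_dvd)
  have d: "3 dvd k" if "d * k = 3 * m" "\<not> 3 dvd d" for d k
    using that prime3_dvd_mult[of d k] by simp
  have "(\<Sum>(d, k)\<in>?o m. chi3 d) = (\<Sum>(d, k)\<in>?o (3 * m). chi3 d)"
  proof (rule sum.reindex_bij_witness[of _ "\<lambda>(d, k). (d, k div 3)" "\<lambda>(d, k). (d, 3 * k)"], goal_cases)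
    case (4 p)
    then obtain d k where p: "p = (d, k)" "d > 0" "k > 0" "d * k = 3 * m" "\<not> 3 dvd d" by (auto simp: dpairs_def)
    then obtain k' where "k = 3 * k'" using d[of d k] by (auto elim: dvdE)
    thus ?case using p by (simp add: dpairs_def)
  next
    case (3 p)
    then obtain d k where p: "p = (d, k)" "d > 0" "k > 0" "d * k = 3 * m" "\<not> 3 dvd d" by (auto simp: dpairs_def)
    then obtain k' where "k = 3 * k'" using d[of d k] by (auto elim: dvdE)
    thus ?case using p by (simp add: dpairs_def)
  qed (auto simp: dpairs_def)
  thus ?thesis by (simp add: r)
qed

lemma square_mod3: "\<not> 3 dvd x \<Longrightarrow> (x::int)^2 mod 3 = 1"
proof -
  assume "\<not> 3 dvd x"
  hence "x mod 3 = 1 \<or> x mod 3 = 2" by presburger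
  hence "((x mod 3) * (x mod 3)) mod 3 = 1" by auto
  thus ?thesis by (simp only: mod_mult_eq power2_eq_square)
qed

lemma r13_mod3: "m mod 3 = 2 \<Longrightarrow> r13 m = 0"
proof -
  assume m: "m mod 3 = 2"
  have "z^2 + 3 * v^2 \<noteq> m" for z v :: int
  proof (cases "3 dvd z")
    case True
    hence "(z^2 + 3 * v^2) mod 3 = 0" by (auto simp: power2_eq_square elim!: dvdE)
    thus ?thesis using m by auto
  next
    case False
    hence "z^2 mod 3 = 1" by (rule square_mod3)
    hence "(z^2 + 3 * v^2) mod 3 = 1" by presburger
    thus ?thesis using m by auto
  qed
  hence "{(z::int, v::int). z^2 + 3 * v^2 = m} = {}" by auto
  thus ?thesis by (simp add: r13_def)
qed

text \<open>Multiplication by sqrt(-3), up to the sign of one coordinate.\<close>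

lemma r13_triple: "r13 (3 * m) = r13 m"
proof -
  have d: "3 dvd z" if "z^2 + 3 * v^2 = 3 * m" for z v :: int
  proof -
    have "z * z = 3 * (m - v^2)" using that by (simp add: power2_eq_square algebra_simps)
    hence "3 dvd z * z" by simp
    thus ?thesis by (simp add: prime3_dvd_mult)
  qed
  have "card {(z::int, v::int). z^2 + 3 * v^2 = m} = card {(z::int, v::int). z^2 + 3 * v^2 = 3 * m}"
  proof (rule card_bij_witness[of _ "\<lambda>(z, v). (3 * v, z)" _ "\<lambda>(z, v). (v, z div 3)"], goal_cases)
    case (2 p)
    then obtain z v where p: "p = (z, v)" "z^2 + 3 * v^2 = 3 * m" by auto
    obtain t where "z = 3 * t" using d[OF p(2)] by (rule dvdE)
    thus ?case using p by (simp add: power2_eq_square)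
  next
    case (4 p)
    then obtain z v where p: "p = (z, v)" "z^2 + 3 * v^2 = 3 * m" by auto
    thus ?case using d by simp
  qed (auto simp: power2_eq_square)
  thus ?thesis by (simp add: r13_def)
qed

lemma r13_neg: "m < 0 \<Longrightarrow> r13 m = 0"
proof -
  assume "m < 0"
  hence "x^2 + 3 * y^2 \<noteq> m" for x y :: int using zero_le_power2[of x] zero_le_power2[of y] by linarith
  hence "{(x::int, y::int). x^2 + 3 * y^2 = m} = {}" by auto
  thus ?thesis by (simp add: r13_def)
qed

lemma r13_1: "r13 1 = 2"
proof -
  have "{(z::int, v::int). z^2 + 3 * v^2 = 1} = {(1, 0), (- 1, 0)}"
  proof (intro equalityI subsetI)
    fix p assume "p \<in> {(z::int, v::int). z^2 + 3 * v^2 = 1}"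
    then obtain x y where p: "p = (x, y)" "x^2 + 3 * y^2 = 1" by auto
    have "y = 0"
    proof (rule ccontr)
      assume "y \<noteq> 0"
      hence "y^2 > 0" by simp
      thus False using p zero_le_power2[of x] by linarith
    qed
    thus "p \<in> {(1, 0), (- 1, 0)}" using p by (auto simp: power2_eq_1_iff)
  qed auto
  thus ?thesis by (simp add: r13_def)
qed

section \<open>The sphere sliced by planes x + y + z = s: recurrence for \<open>r13\<close>\<close>

lemma triple_cross_sum:
  fixes n :: int
  shows "(\<Sum>(x, y, z) | x^2 + y^2 + z^2 = n. (x + y + z)^2 - n) = 0"
proof -
  let ?S = "{(x, y, z). x^2 + y^2 + z^2 = n}"
  have a: "(\<Sum>(x, y, z)\<in>?S. x * y) = 0"
    by (rule sum_antisym[of _ "\<lambda>(x, y, z). (- x, y, z)"]) auto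
  have b: "(\<Sum>(x, y, z)\<in>?S. y * z) = 0"
    by (rule sum_antisym[of _ "\<lambda>(x, y, z). (x, - y, z)"]) auto
  have c: "(\<Sum>(x, y, z)\<in>?S. x * z) = 0"
    by (rule sum_antisym[of _ "\<lambda>(x, y, z). (- x, y, z)"]) auto
  have "(\<Sum>(x, y, z)\<in>?S. (x + y + z)^2 - n)
      = 2 * (\<Sum>(x, y, z)\<in>?S. x * y) + 2 * (\<Sum>(x, y, z)\<in>?S. y * z) + 2 * (\<Sum>(x, y, z)\<in>?S. x * z)"
    unfolding sum_distrib_left sum.distrib[symmetric]
    by (rule sum.cong) (auto simp: power2_eq_square algebra_simps)
  thus ?thesis using a b c by simp
qed

text \<open>The vectors of \<open>\<int>\<^sup>3\<close> with coordinate sum \<open>s\<close> form a translate of the hexagonal lattice.\<close>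

lemma card_triple_fiber:
  fixes n s m :: int
  assumes m: "2 * m = 3 * n - s^2"
  shows "card {(x, y, z). x^2 + y^2 + z^2 = n \<and> x + y + z = s}
       = card {(u, w). u^2 + 3 * w^2 = 4 * m \<and> 3 dvd u + s}"
proof (rule card_bij_witness[of _ "\<lambda>(x, y, z). (3 * x - s, y - z)" _
    "\<lambda>(u, w). ((u + s) div 3, (s - (u + s) div 3 + w) div 2, (s - (u + s) div 3 - w) div 2)"], goal_cases)
  case (1 p)
  then obtain x y z where p: "p = (x, y, z)" "x^2 + y^2 + z^2 = n" "s = x + y + z" by auto
  have "(3 * x - s)^2 + 3 * (y - z)^2 = 2 * (3 * n - s^2)"
    unfolding p(2)[symmetric] p(3) by (simp add: power2_eq_square algebra_simps)
  thus ?case using p m by simp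
next
  case (2 q)
  then obtain u w where q: "q = (u, w)" "u^2 + 3 * w^2 = 4 * m" "3 dvd u + s" by auto
  obtain x where x: "u + s = 3 * x" using q(3) by (rule dvdE)
  have "even (u - w)" using q(2) by (rule hex_parity)
  moreover have u: "u = 3 * x - s" using x by simp
  ultimately have "even (s - x + w)" by auto
  then obtain y where y: "s - x + w = 2 * y" by (rule evenE)
  define z where "z = y - w"
  have w: "w = y - z" and s: "s = x + y + z" using y by (auto simp: z_def)
  have "2 * (3 * n) = u^2 + 3 * w^2 + 2 * s^2" using q(2) m by simp
  also have "\<dots> = 2 * (3 * (x^2 + y^2 + z^2))"
    unfolding u w s by (simp add: power2_eq_square algebra_simps)
  finally have nn: "x^2 + y^2 + z^2 = n" by simp
  have "s - x - w = 2 * z" using w s by simp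
  hence e: "(u + s) div 3 = x" "(s - x + w) div 2 = y" "(s - x - w) div 2 = z" using x y by simp_all
  show ?case using nn s[symmetric] by (simp add: e q(1))
next
  case (3 p)
  then obtain x y z where p: "p = (x, y, z)" "s = x + y + z" by auto
  have "x + y + z - x + (y - z) = 2 * y" "x + y + z - x - (y - z) = 2 * z" by auto
  thus ?case using p by simp
next
  case (4 q)
  then obtain u w where q: "q = (u, w)" "u^2 + 3 * w^2 = 4 * m" "3 dvd u + s" by auto
  obtain x where x: "u + s = 3 * x" using q(3) by (rule dvdE)
  have "even (u - w)" using q(2) by (rule hex_parity)
  moreover have u: "u = 3 * x - s" using x by simp
  ultimately have "even (s - x + w)" by auto
  then obtain y where y: "s - x + w = 2 * y" by (rule evenE)
  hence "s - x - w = 2 * (y - w)" by simp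
  thus ?case using q x y by simp
qed

text \<open>The fibre consists of the representations of 4m, three times as many as those of m,
  subject to a congruence of u modulo 3. If 3 divides s, so does every u and the congruence is
  automatic. Otherwise u is s or -s modulo 3, and changing the sign of u shows that just half of the
  representations qualify.\<close>

lemma card_triple_fiber_r13:
  fixes n s m :: int
  assumes m: "2 * m = 3 * n - s^2" "odd m"
  shows "2 * int (card {(x, y, z). x^2 + y^2 + z^2 = n \<and> x + y + z = s})
       = 3 * (if 3 dvd s then 2 else 1) * r13 m"
proof -
  let ?H = "\<lambda>s. {(u, w). u^2 + 3 * w^2 = 4 * m \<and> 3 dvd u + s}"
  have c: "card {(x, y, z). x^2 + y^2 + z^2 = n \<and> x + y + z = s} = card (?H s)"
    by (rule card_triple_fiber[OF m(1)])
  have r: "r13 (4 * m) = 3 * r13 m" by (rule r13_times4[OF m(2)])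
  show ?thesis
  proof (cases "3 dvd s")
    case True
    have "3 dvd u + s" if "u^2 + 3 * w^2 = 4 * m" for u w
    proof -
      obtain t where "s = 3 * t" using True by (rule dvdE)
      hence "u * u = 3 * (2 * n - 6 * t^2 - w^2)" using m(1) that by (simp add: power2_eq_square algebra_simps)
      hence "3 dvd u * u" by simp
      thus ?thesis using True by (simp add: prime3_dvd_mult)
    qed
    hence "?H s = {(u, w). u^2 + 3 * w^2 = 4 * m}" by auto
    thus ?thesis using True c r by (simp add: r13_def)
  next
    case False
    have ds: "3 dvd u + s \<or> 3 dvd u - s" if "u^2 + 3 * w^2 = 4 * m" for u w
    proof -
      have "(u + s) * (u - s) = 3 * (2 * n - s^2 - w^2)" using m(1) that by (simp add: power2_eq_square algebra_simps)
      hence "3 dvd (u + s) * (u - s)" by simp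
      thus ?thesis by (simp only: prime3_dvd_mult)
    qed
    have "{(u, w). u^2 + 3 * w^2 = 4 * m} = ?H s \<union> ?H (- s)" using ds by auto
    moreover have "?H s \<inter> ?H (- s) = {}"
    proof -
      have "\<not> (3 dvd u + s \<and> 3 dvd u - s)" for u using False by presburger
      thus ?thesis by auto
    qed
    moreover have "card (?H (- s)) = card (?H s)"
    proof (rule card_bij_witness[of _ "\<lambda>(u, w). (- u, w)" _ "\<lambda>(u, w). (- u, w)"])
      have *: "3 dvd - u + s \<longleftrightarrow> 3 dvd u + - s" "3 dvd - u + - s \<longleftrightarrow> 3 dvd u + s" for u by presburger+
      show "(case p of (u, w) \<Rightarrow> (- u, w)) \<in> ?H s" if "p \<in> ?H (- s)" for p using that * by (cases p) simp
      show "(case p of (u, w) \<Rightarrow> (- u, w)) \<in> ?H (- s)" if "p \<in> ?H s" for p using that * by (cases p) simp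
    qed auto
    ultimately have "card {(u, w). u^2 + 3 * w^2 = 4 * m} = 2 * card (?H s)"
      by (simp add: card_Un_disjoint)
    thus ?thesis using False c r by (simp add: r13_def)
  qed
qed

text \<open>The factor 2 or 1 is the multiplicity from \<open>card_triple_fiber_r13\<close>. The
  condition \<open>n mod 4 = 1\<close> makes s odd and \<open>(3 * n - s^2) div 2\<close> odd, so
  the relation involves odd arguments of \<open>r13\<close> only.\<close>

lemma r13_recurrence_sum:
  fixes n :: int
  assumes n: "n mod 4 = 1"
  shows "(\<Sum>s | s \<in> {- (3 * n)..3 * n} \<and> odd s.
     ((s^2 - n) * (if 3 dvd s then 2 else 1)) * r13 ((3 * n - s^2) div 2)) = 0"
proof -
  define I where "I = {s \<in> {- (3 * n)..3 * n}. odd s}"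
  define B where "B s = {(x, y, z). x^2 + y^2 + z^2 = n \<and> x + y + z = s}" for s
  have finT: "finite {(x::int, y::int, z::int). x^2 + y^2 + z^2 = n}"
  proof (rule finite_subset)
    show "{(x::int, y::int, z::int). x^2 + y^2 + z^2 = n} \<subseteq> {- n..n} \<times> {- n..n} \<times> {- n..n}"
    proof
      fix p assume "p \<in> {(x::int, y::int, z::int). x^2 + y^2 + z^2 = n}"
      then obtain x y z where p: "p = (x, y, z)" "x^2 + y^2 + z^2 = n" by auto
      hence "x^2 \<le> n" "y^2 \<le> n" "z^2 \<le> n"
        using zero_le_power2[of x] zero_le_power2[of y] zero_le_power2[of z] by linarith+
      thus "p \<in> {- n..n} \<times> {- n..n} \<times> {- n..n}"
        using p(1) square_le_imp[of x n] square_le_imp[of y n] square_le_imp[of z n] by auto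
    qed
  qed simp
  have finB: "finite (B s)" for s by (rule finite_subset[OF _ finT]) (auto simp: B_def)
  have disj: "B s \<inter> B t = {}" if "s \<noteq> t" for s t using that by (auto simp: B_def)
  have union: "{(x, y, z). x^2 + y^2 + z^2 = n} = (\<Union>s\<in>I. B s)"
  proof (intro equalityI subsetI)
    fix p assume "p \<in> {(x, y, z). x^2 + y^2 + z^2 = n}"
    then obtain x y z where p: "p = (x, y, z)" "x^2 + y^2 + z^2 = n" by auto
    hence "x^2 \<le> n" "y^2 \<le> n" "z^2 \<le> n"
      using zero_le_power2[of x] zero_le_power2[of y] zero_le_power2[of z] by linarith+
    hence "x + y + z \<in> {- (3 * n)..3 * n}"
      using square_le_imp[of x n] square_le_imp[of y n] square_le_imp[of z n] by auto
    moreover have "odd (x^2 + y^2 + z^2)" using p(2) n by presburger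
    hence "odd (x + y + z)" by auto
    ultimately have "x + y + z \<in> I" by (simp add: I_def)
    thus "p \<in> (\<Union>s\<in>I. B s)" using p by (auto simp: B_def)
  qed (auto simp: B_def)
  have "(\<Sum>(x, y, z) | x^2 + y^2 + z^2 = n. (x + y + z)^2 - n) = (\<Sum>s\<in>I. \<Sum>(x, y, z)\<in>B s. (x + y + z)^2 - n)"
    unfolding union by (rule sum.UNION_disjoint) (use finB disj in \<open>auto simp: I_def\<close>)
  also have "\<dots> = (\<Sum>s\<in>I. (s^2 - n) * int (card (B s)))"
  proof (rule sum.cong)
    fix s
    have "(\<Sum>(x, y, z)\<in>B s. (x + y + z)^2 - n) = (\<Sum>p\<in>B s. s^2 - n)"
      by (rule sum.cong) (auto simp: B_def)
    thus "(\<Sum>(x, y, z)\<in>B s. (x + y + z)^2 - n) = (s^2 - n) * int (card (B s))" by simp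
  qed simp
  finally have "0 = 2 * (\<Sum>s\<in>I. (s^2 - n) * int (card (B s)))" by (simp add: triple_cross_sum)
  also have "\<dots> = (\<Sum>s\<in>I. 3 * (((s^2 - n) * (if 3 dvd s then 2 else 1)) * r13 ((3 * n - s^2) div 2)))"
    unfolding sum_distrib_left
  proof (rule sum.cong)
    fix s assume "s \<in> I"
    hence s: "odd s" by (simp add: I_def)
    define m where "m = (3 * n - s^2) div 2"
    have s8: "s^2 mod 8 = 1" by (rule odd_square_mod8[OF s])
    have "even (3 * n - s^2)" using s8 n by presburger
    hence m: "2 * m = 3 * n - s^2" by (simp add: m_def)
    hence "odd m" using s8 n by presburger
    hence "2 * int (card (B s)) = 3 * (if 3 dvd s then 2 else 1) * r13 m"
      unfolding B_def by (rule card_triple_fiber_r13[OF m])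
    thus "2 * ((s^2 - n) * int (card (B s))) = 3 * (((s^2 - n) * (if 3 dvd s then 2 else 1)) * r13 ((3 * n - s^2) div 2))"
      unfolding m_def[symmetric] by (simp add: algebra_simps)
  qed simp
  finally show ?thesis by (simp add: sum_distrib_left[symmetric] I_def)
qed

section \<open>The matching recurrence for \<open>lam3\<close>\<close>

lemma hex_form_mod3:
  fixes d x k n :: int
  assumes "x^2 + 2 * d * k = 3 * n"
  shows "x mod 3 = 0 \<and> d mod 3 = 0 \<or> x mod 3 = 0 \<and> k mod 3 = 0
    \<or> x mod 3 \<noteq> 0 \<and> d mod 3 = k mod 3 \<and> k mod 3 \<noteq> 0"
proof -
  define a b c where "a = x div 3" "b = d div 3" "c = k div 3"
  define a' b' c' where abc: "a' = x mod 3" "b' = d mod 3" "c' = k mod 3"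
  have x: "x = 3 * a + a'" and d: "d = 3 * b + b'" and k: "k = 3 * c + c'"
    by (simp_all add: a_b_c_def abc)
  have "a' * a' + 2 * b' * c' = 3 * (n - 3 * a * a - 2 * a * a' - 6 * b * c - 2 * b * c' - 2 * b' * c)"
    using assms unfolding x d k by (simp add: power2_eq_square algebra_simps)
  hence "3 dvd a' * a' + 2 * b' * c'" by simp
  moreover have "a' = 0 \<or> a' = 1 \<or> a' = 2" "b' = 0 \<or> b' = 1 \<or> b' = 2" "c' = 0 \<or> c' = 1 \<or> c' = 2"
    unfolding abc by presburger+
  ultimately have "a' = 0 \<and> b' = 0 \<or> a' = 0 \<and> c' = 0 \<or> a' \<noteq> 0 \<and> b' = c' \<and> c' \<noteq> 0"
    by (elim disjE) simp_all
  thus ?thesis by (simp add: abc)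
qed

text \<open>The weight \<open>w\<close> is, up to sign, the genus character at 3 of the form 2dX^2 +
  2xXY - kY^2. Its discriminant is divisible by 3, so modulo 3 the form is a constant times the
  square of a linear form and \<open>chi3\<close> is constant on its values prime to 3; whichever of
  d and k is prime to 3 may be used. The \<open>iota\<close> map is a change of basis and preserves
  \<open>w\<close>, while the \<open>kappa\<close> map also negates the form and so negates
  \<open>w\<close>.\<close>

lemma lam3_recurrence_sum:
  fixes n :: int
  assumes n: "n mod 4 = 1"
  shows "(\<Sum>s | s \<in> {- (3 * n)..3 * n} \<and> odd s.
     ((s^2 - n) * (if 3 dvd s then 2 else 1)) * lam3 ((3 * n - s^2) div 2)) = 0"
proof -
  define w where "w = (\<lambda>(d::int) (x::int) (k::int). if 3 dvd k then chi3 d else chi3 k)"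
  define B where "B x = {(d, k). d > 0 \<and> k > 0 \<and> x^2 + 2 * d * k = 3 * n}" for x
  define I where "I = {x \<in> {- (3 * n)..3 * n}. odd x}"
  have xodd: "odd x" if "x^2 + 2 * d * k = 3 * n" for d x k
  proof -
    have "odd (3 * n)" using n by presburger
    hence "odd (x^2 + 2 * (d * k))" using that by (simp add: mult.assoc)
    thus ?thesis by simp
  qed
  have B: "B x = dpairs ((3 * n - x^2) div 2)" if "odd x" for x
  proof -
    have "odd (3 * n)" using n by presburger
    hence "even (3 * n - x^2)" using that by simp
    then obtain c where "3 * n - x^2 = 2 * c" by (rule evenE)
    thus ?thesis by (auto simp: B_def dpairs_def mult.assoc)
  qed
  have w: "(\<Sum>(d, x, k)\<in>{(d, x, k). d > 0 \<and> k > 0 \<and> x^2 + 2 * d * k = 3 * n}. (x^2 - d * k) * w d x k) = 0"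
  proof (rule windmill_sum[of "3 * n" w], goal_cases)
    case 1 thus ?case using n by presburger
  next
    case (2 d x k) thus ?case by (simp add: w_def)
  next
    case (3 d x k)
    thus ?case using hex_form_mod3[OF 3] by (auto simp: w_def chi3_def mod_eq_0_iff_dvd)
  next
    case (4 d x k)
    show ?case
    proof (cases "3 dvd k")
      case True
      hence "3 dvd x" using hex_form_mod3[OF 4] by presburger
      hence "chi3 (d + 2 * x - 2 * k) = chi3 d" using True by (intro chi3_cong) presburger
      thus ?thesis using True by (simp add: w_def)
    qed (simp add: w_def)
  next
    case (5 d x k)
    let ?D = "2 * k - d - 2 * x" and ?K = "2 * d + 2 * x - k"
    have "3 dvd ?K \<and> 3 dvd k \<and> (?D + d) mod 3 = 0 \<or> 3 dvd ?K \<and> \<not> 3 dvd k \<and> (?D + k) mod 3 = 0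
      \<or> \<not> 3 dvd ?K \<and> 3 dvd k \<and> (?K + d) mod 3 = 0 \<or> \<not> 3 dvd ?K \<and> \<not> 3 dvd k \<and> (?K + k) mod 3 = 0"
      using hex_form_mod3[OF 5]
    proof (elim disjE conjE)
      assume "x mod 3 = 0" "d mod 3 = 0"
      hence "(?K + k) mod 3 = 0" "(?D + k) mod 3 = 0" by presburger+
      thus ?thesis using \<open>d mod 3 = 0\<close> by presburger
    next
      assume "x mod 3 = 0" "k mod 3 = 0"
      hence "(?K + d) mod 3 = 0" "(?D + d) mod 3 = 0" by presburger+
      thus ?thesis using \<open>k mod 3 = 0\<close> by presburger
    next
      assume a: "x mod 3 \<noteq> 0" "d mod 3 = k mod 3" "k mod 3 \<noteq> 0"
      hence "x mod 3 = d mod 3 \<or> (x + d) mod 3 = 0" by presburger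
      thus ?thesis
      proof
        assume "x mod 3 = d mod 3"
        hence "3 dvd ?K" "(?D + k) mod 3 = 0" using a(2) by presburger+
        thus ?thesis using a(3) by presburger
      next
        assume "(x + d) mod 3 = 0"
        hence "(?K + k) mod 3 = 0" using a(2) by presburger
        thus ?thesis using a(3) by presburger
      qed
    qed
    moreover have "chi3 a = - chi3 b" if "(a + b) mod 3 = 0" for a b
    proof -
      have "chi3 a = chi3 (- b)" using that by (intro chi3_cong) presburger
      thus ?thesis by simp
    qed
    ultimately show ?case unfolding w_def by auto
  qed
  have "(\<Sum>(d, x, k)\<in>{(d, x, k). d > 0 \<and> k > 0 \<and> x^2 + 2 * d * k = 3 * n}. (x^2 - d * k) * w d x k)
      = (\<Sum>(x, d, k)\<in>Sigma I B. (x^2 - d * k) * w d x k)"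
  proof (rule sum.reindex_bij_witness[of _ "\<lambda>(x, d, k). (d, x, k)" "\<lambda>(d, x, k). (x, d, k)"], goal_cases)
    case (2 p)
    then obtain d x k where p: "p = (d, x, k)" "d > 0" "k > 0" "x^2 + 2 * d * k = 3 * n" by auto
    hence "x^2 + 2 * (d * k) = 3 * n" by (simp add: mult.assoc)
    hence "x^2 \<le> 3 * n" using mult_pos_pos[OF p(2,3)] by linarith
    thus ?case using p xodd[of x d k] square_le_imp[of x "3 * n"] by (auto simp: I_def B_def)
  qed (auto simp: B_def)
  also have "\<dots> = (\<Sum>x\<in>I. \<Sum>(d, k)\<in>B x. (x^2 - d * k) * w d x k)"
    by (subst sum.Sigma) (auto simp: I_def B)
  finally have "(\<Sum>x\<in>I. \<Sum>(d, k)\<in>B x. (x^2 - d * k) * w d x k) = 0" using w by simp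
  hence "(\<Sum>x\<in>I. 2 * (\<Sum>(d, k)\<in>B x. (x^2 - d * k) * w d x k)) = 0"
    by (simp add: sum_distrib_left[symmetric])
  moreover have "2 * (\<Sum>(d, k)\<in>B x. (x^2 - d * k) * w d x k)
     = 3 * (((x^2 - n) * (if 3 dvd x then 2 else 1)) * lam3 ((3 * n - x^2) div 2))"
    if "x \<in> I" for x
  proof -
    have x: "odd x" using that by (simp add: I_def)
    have "2 * (\<Sum>(d, k)\<in>B x. (x^2 - d * k) * w d x k) = (\<Sum>(d, k)\<in>B x. (3 * (x^2 - n)) * w d x k)"
      unfolding sum_distrib_left
    proof (rule sum.cong)
      fix p assume "p \<in> B x"
      then obtain d k where p: "p = (d, k)" "x^2 + 2 * d * k = 3 * n" by (auto simp: B_def)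
      hence e: "2 * (x^2 - d * k) = 3 * (x^2 - n)" by (simp add: mult.assoc)
      show "2 * (case p of (d, k) \<Rightarrow> (x^2 - d * k) * w d x k) = (case p of (d, k) \<Rightarrow> (3 * (x^2 - n)) * w d x k)"
        unfolding p(1) prod.case mult.assoc[symmetric] by (simp only: e)
    qed simp
    also have "\<dots> = 3 * (x^2 - n) * (\<Sum>(d, k)\<in>B x. w d x k)"
      by (simp add: sum_distrib_left case_prod_beta)
    \<comment> \<open>If 3 divides x, it divides d or k, so \<open>w\<close> is the sum of the two
      characters; otherwise \<open>w\<close> is \<open>chi3 k\<close>. This reproduces the
      multiplicities 2 and 1 of the lattice count.\<close>
    also have "(\<Sum>(d, k)\<in>B x. w d x k) = (if 3 dvd x then 2 else 1) * lam3 ((3 * n - x^2) div 2)"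
    proof (cases "3 dvd x")
      case True
      have "(\<Sum>(d, k)\<in>B x. w d x k) = (\<Sum>(d, k)\<in>B x. chi3 d) + (\<Sum>(d, k)\<in>B x. chi3 k)"
        unfolding sum.distrib[symmetric]
      proof (rule sum.cong)
        fix p assume "p \<in> B x"
        then obtain d k where p: "p = (d, k)" "x^2 + 2 * d * k = 3 * n" by (auto simp: B_def)
        have "3 dvd d \<or> 3 dvd k"
        proof -
          obtain t where "x = 3 * t" using True by (rule dvdE)
          hence "2 * d * k = 3 * (n - 3 * t^2)" using p(2) by (simp add: power2_eq_square algebra_simps)
          hence "3 dvd 2 * d * k" by simp
          thus ?thesis by (simp add: prime3_dvd_mult)
        qed
        thus "(case p of (d, k) \<Rightarrow> w d x k) = (case p of (d, k) \<Rightarrow> chi3 d) + (case p of (d, k) \<Rightarrow> chi3 k)"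
          using p by (auto simp: w_def chi3_dvd)
      qed simp
      thus ?thesis using True by (simp add: B[OF x] lam3_swap lam3_def[symmetric])
    next
      case False
      have "(\<Sum>(d, k)\<in>B x. w d x k) = (\<Sum>(d, k)\<in>B x. chi3 k)"
      proof (rule sum.cong)
        fix p assume "p \<in> B x"
        then obtain d k where p: "p = (d, k)" "x^2 + 2 * d * k = 3 * n" by (auto simp: B_def)
        have "\<not> 3 dvd k" using hex_form_mod3[OF p(2)] False by presburger
        thus "(case p of (d, k) \<Rightarrow> w d x k) = (case p of (d, k) \<Rightarrow> chi3 k)" using p by (simp add: w_def)
      qed simp
      thus ?thesis using False by (simp add: B[OF x] lam3_swap)
    qed
    finally show ?thesis by simp
  qed
  ultimately have "(\<Sum>x\<in>I. 3 * (((x^2 - n) * (if 3 dvd x then 2 else 1)) * lam3 ((3 * n - x^2) div 2))) = 0"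
    by simp
  thus ?thesis by (simp add: sum_distrib_left[symmetric] I_def)
qed

text \<open>Induction as in \<open>r2_eq\<close>, with multiples of 3 and the residue 2 modulo 3
  settled directly. For m = 6j + 1 the recurrences are used at n = 4j + 1, since
  \<open>2 * m = 3 * n - 1\<close> makes m the argument at s = 1 and s = -1. The coefficient 1 - n
  is nonzero because m = 1 is treated apart.\<close>

lemma r13_eq: "odd m \<Longrightarrow> r13 m = 2 * lam3 m"
proof (induction "nat m" arbitrary: m rule: less_induct)
  case less
  have "m < 0 \<or> m > 0 \<and> m mod 3 = 0 \<or> m mod 3 = 2 \<or> m = 1 \<or> m > 1 \<and> m mod 3 = 1"
    using less.prems by presburger
  then consider "m < 0" | "m > 0" "m mod 3 = 0" | "m mod 3 = 2" | "m = 1" | "m > 1" "m mod 3 = 1"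
    by blast
  thus ?case
  proof cases
    case 1 thus ?thesis by (simp add: r13_neg lam3_def lam_neg)
  next
    case 2
    then obtain c where c: "m = 3 * c" by (auto elim: dvdE)
    hence "r13 c = 2 * lam3 c" using 2 less.prems by (intro less.hyps) auto
    thus ?thesis by (simp add: c r13_triple lam3_triple)
  next
    case 3 thus ?thesis by (simp add: r13_mod3 lam3_mod3)
  next
    case 4 thus ?thesis by (simp add: r13_1 lam3_def dpairs_1 chi3_def)
  next
    case 5
    obtain j where j: "m = 6 * j + 1"
    proof -
      have "m mod 6 = 1" using 5 less.prems by presburger
      hence "m = 6 * (m div 6) + 1" by presburger
      thus ?thesis by (rule that)
    qed
    define n where "n = 4 * j + 1"
    have n: "n mod 4 = 1" unfolding n_def by presburger
    have nm: "2 * m = 3 * n - 1" by (simp add: n_def j)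
    have j0: "j > 0" using 5 j by simp
    have "r13 ((3 * n - 1^2) div 2) = 2 * lam3 ((3 * n - 1^2) div 2)"
    proof (rule odd_sum_recurrence[of "3 * n" "\<lambda>s. (s^2 - n) * (if 3 dvd s then 2 else 1)"
          "\<lambda>s. r13 ((3 * n - s^2) div 2)" "\<lambda>s. 2 * lam3 ((3 * n - s^2) div 2)"])
      show "3 * n \<ge> 1" using j0 by (simp add: n_def)
      show "(1^2 - n) * (if 3 dvd (1::int) then 2 else 1) \<noteq> 0" using j0 by (simp add: n_def)
      show "(\<Sum>s | s \<in> {- (3 * n)..3 * n} \<and> odd s.
         ((s^2 - n) * (if 3 dvd s then 2 else 1)) * r13 ((3 * n - s^2) div 2)) = 0"
        by (rule r13_recurrence_sum[OF n])
      have "(\<Sum>s | s \<in> {- (3 * n)..3 * n} \<and> odd s.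
         ((s^2 - n) * (if 3 dvd s then 2 else 1)) * (2 * lam3 ((3 * n - s^2) div 2)))
         = 2 * (\<Sum>s | s \<in> {- (3 * n)..3 * n} \<and> odd s.
         ((s^2 - n) * (if 3 dvd s then 2 else 1)) * lam3 ((3 * n - s^2) div 2))"
        unfolding sum_distrib_left by (rule sum.cong) simp_all
      also have "\<dots> = 0" by (simp only: lam3_recurrence_sum[OF n] mult_zero_right)
      finally show "(\<Sum>s | s \<in> {- (3 * n)..3 * n} \<and> odd s.
         ((s^2 - n) * (if 3 dvd s then 2 else 1)) * (2 * lam3 ((3 * n - s^2) div 2))) = 0" .
      fix s :: int assume s: "odd s" "s^2 \<noteq> 1"
      define c where "c = (3 * n - s^2) div 2"
      have s8: "s^2 mod 8 = 1" by (rule odd_square_mod8[OF s(1)])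
      have "even (3 * n - s^2)" using s8 n by presburger
      hence c: "2 * c = 3 * n - s^2" by (simp add: c_def)
      hence "odd c" using s8 n by presburger
      moreover have "c < m"
      proof -
        have "s \<noteq> 0" using s by auto
        hence "s^2 > 0" by simp
        hence "s^2 > 1" using s(2) by linarith
        thus ?thesis using c nm by linarith
      qed
      ultimately show "r13 ((3 * n - s^2) div 2) = 2 * lam3 ((3 * n - s^2) div 2)"
        unfolding c_def[symmetric] using less.hyps[of c] 5 by (cases "c > 0") (auto simp: r13_neg lam3_def lam_neg)
    qed auto
    moreover have "(3 * n - 1^2) div 2 = m" using nm by simp
    ultimately show ?thesis by simp
  qed
qed

section \<open>Jacobi's identity for signed representations by \<open>x\<^sup>2 + 8p\<^sup>2 + 8q\<^sup>2\<close>\<close>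

definition sgn2 :: "int \<Rightarrow> int" where "sgn2 k = (if even k then 1 else - 1)"

lemma finite_forms8: "finite {(d::int, x::int, k::int). d > 0 \<and> k > 0 \<and> x^2 + 8 * d * k = M}"
proof (rule finite_subset)
  show "{(d::int, x::int, k::int). d > 0 \<and> k > 0 \<and> x^2 + 8 * d * k = M} \<subseteq> {0..M} \<times> {- M..M} \<times> {0..M}"
  proof
    fix p assume "p \<in> {(d::int, x::int, k::int). d > 0 \<and> k > 0 \<and> x^2 + 8 * d * k = M}"
    then obtain d x k where p: "p = (d, x, k)" and a: "d > 0" "k > 0" "x^2 + 8 * (d * k) = M"
      by (auto simp: mult.assoc)
    have "d * k > 0" using a by simp
    hence "d * k \<le> M" "x^2 \<le> M" using a(3) zero_le_power2[of x] by linarith+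
    thus "p \<in> {0..M} \<times> {- M..M} \<times> {0..M}"
      using p pos_factor_le[of d k M] square_le_imp[of x M] a by auto
  qed
qed simp

text \<open>
  As in \<open>windmill_sum\<close>, now for \<open>dX\<^sup>2 + xXY - 2kY\<^sup>2\<close>: each change of basis reverses the sign of
  the weight, so that only the forms with a rational zero at \<open>(1, 1)\<close> survive.
\<close>

lemma jacobi_lambert_half:
  fixes M :: int
  shows "(\<Sum>(d, x, k) | d > 0 \<and> k > 0 \<and> odd d \<and> odd x \<and> \<not> 4 dvd x + d \<and> x^2 + 8 * d * k = M. sgn2 k * chi4 d)
    = (\<Sum>(d, k) | d > 0 \<and> k > 0 \<and> odd d \<and> odd k \<and> (2 * k + d)^2 = M. - chi4 d)"
proof -
  \<comment> \<open>The condition on x + d makes (x + d)/2 odd, so the maps that move k by this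
    amount change \<open>sgn2 k\<close>. All three maps preserve x + d up to sign, hence preserve
    the condition. On \<open>P\<close> the sign comes from \<open>chi4\<close> instead, as d changes
    by 2 modulo 4.\<close>
  define Om where "Om = {(d, x, k). d > 0 \<and> k > 0 \<and> odd d \<and> odd x \<and> \<not> 4 dvd x + d \<and> x^2 + 8 * d * k = M}"
  define P where "P = {(d, x, k). (d, x, k) \<in> Om \<and> x + d > 2 * k \<and> d + 2 * x - 8 * k > 0}"
  define P' where "P' = {(d, x, k). (d, x, k) \<in> Om \<and> x + d < 2 * k}"
  define Mi where "Mi = {(d, x, k). (d, x, k) \<in> Om \<and> x + d > 2 * k \<and> d + 2 * x - 8 * k < 0}"
  define B where "B = {(d, x, k). (d, x, k) \<in> Om \<and> x + d = 2 * k}"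
  define h where "h = (\<lambda>(d, x :: int, k). sgn2 k * chi4 d)"
  have finOm: "finite Om" by (rule finite_subset[OF _ finite_forms8[of M]]) (auto simp: Om_def)
  have part: "Om = P \<union> (P' \<union> (Mi \<union> B))"
  proof -
    have "d + 2 * x - 8 * k \<noteq> 0" if "(d, x, k) \<in> Om" for d x k
      using that unfolding Om_def by clarsimp presburger
    thus ?thesis unfolding P_def P'_def Mi_def B_def by fastforce
  qed
  have hP: "sum h P = 0"
  proof (rule sum_antisym[of _ "\<lambda>(d, x, k). (d + 2 * x - 8 * k, 8 * k - x, k)"], goal_cases)
    case (1 p)
    then obtain d x k where p: "p = (d, x, k)" "d > 0" "k > 0" "odd d" "odd x" "\<not> 4 dvd x + d"
      "x^2 + 8 * d * k = M" "x + d > 2 * k" "d + 2 * x - 8 * k > 0" by (auto simp: P_def Om_def)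
    have "8 * k - x + (d + 2 * x - 8 * k) = x + d" by simp
    moreover have "(8 * k - x)^2 + 8 * (d + 2 * x - 8 * k) * k = M"
      using p(7) by (simp add: power2_eq_square algebra_simps)
    ultimately show ?case using p by (simp add: P_def Om_def)
  next
    case (2 p) thus ?case by (cases p) simp
  next
    case (3 p)
    then obtain d x k where p: "p = (d, x, k)" "odd d" "odd x" by (auto simp: P_def Om_def)
    have "chi4 (d + 2 * x - 8 * k) = chi4 (d + 2)" using p(3) by (intro chi4_cong) presburger
    thus ?case using p by (simp add: h_def chi4_add2)
  qed
  have hP': "sum h P' = 0"
  proof (rule sum_antisym[of _ "\<lambda>(d, x, k). (d, - x - 2 * d, k - (x + d) div 2)"], goal_cases)
    case (1 p)
    then obtain d x k where p: "p = (d, x, k)" "d > 0" "k > 0" "odd d" "odd x" "\<not> 4 dvd x + d"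
      "x^2 + 8 * d * k = M" "x + d < 2 * k" by (auto simp: P'_def Om_def)
    obtain t where t: "x + d = 2 * t" using p(4,5) by (meson even_add evenE)
    hence x: "x = 2 * t - d" by simp
    have "(- x - 2 * d)^2 + 8 * d * (k - t) = M"
      using p(7) unfolding x by (simp add: power2_eq_square algebra_simps)
    moreover have "\<not> 4 dvd - x - 2 * d + d" using p(6) by presburger
    ultimately show ?case using p t by (simp add: P'_def Om_def)
  next
    case (2 p)
    then obtain d x k where p: "p = (d, x, k)" "odd d" "odd x" by (auto simp: P'_def Om_def)
    obtain t where t: "x + d = 2 * t" using p(2,3) by (meson even_add evenE)
    hence "- x - 2 * d + d = 2 * (- t)" by simp
    hence "(- x - 2 * d + d) div 2 = - t" by (metis nonzero_mult_div_cancel_left zero_neq_numeral)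
    thus ?case using p t by simp
  next
    case (3 p)
    then obtain d x k where p: "p = (d, x, k)" "odd d" "odd x" "\<not> 4 dvd x + d" by (auto simp: P'_def Om_def)
    hence "odd ((x + d) div 2)" by presburger
    thus ?case using p by (simp add: h_def sgn2_def)
  qed
  have hM: "sum h Mi = 0"
  proof (rule sum_antisym[of _ "\<lambda>(d, x, k). (8 * k - d - 2 * x, 2 * d + 3 * x - 8 * k, (x + d) div 2 - k)"], goal_cases)
    case (1 p)
    then obtain d x k where p: "p = (d, x, k)" "d > 0" "k > 0" "odd d" "odd x" "\<not> 4 dvd x + d"
      "x^2 + 8 * d * k = M" "x + d > 2 * k" "d + 2 * x - 8 * k < 0" by (auto simp: Mi_def Om_def)
    obtain t where t: "x + d = 2 * t" using p(4,5) by (meson even_add evenE)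
    hence x: "x = 2 * t - d" by simp
    have "(2 * d + 3 * x - 8 * k)^2 + 8 * (8 * k - d - 2 * x) * (t - k) = M"
      using p(7) unfolding x by (simp add: power2_eq_square algebra_simps)
    moreover have "2 * d + 3 * x - 8 * k + (8 * k - d - 2 * x) = x + d" by simp
    moreover have "odd (8 * k - d - 2 * x)" "odd (2 * d + 3 * x - 8 * k)" using p(4,5) by auto
    moreover have "\<not> 4 dvd d + x" using p(6) by (simp add: add.commute)
    ultimately show ?case using p t by (simp add: Mi_def Om_def)
  next
    case (2 p)
    then obtain d x k where p: "p = (d, x, k)" "odd d" "odd x" by (auto simp: Mi_def Om_def)
    have "2 * d + 3 * x - 8 * k + (8 * k - d - 2 * x) = x + d" by simp
    moreover obtain t where t: "x + d = 2 * t" using p(2,3) by (meson even_add evenE)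
    hence "x = 2 * t - d" by simp
    ultimately show ?case using p t by simp
  next
    case (3 p)
    then obtain d x k where p: "p = (d, x, k)" "odd d" "odd x" "\<not> 4 dvd x + d" by (auto simp: Mi_def Om_def)
    have "chi4 (8 * k - d - 2 * x) = chi4 (- (d + 2))" using p(3) by (intro chi4_cong) presburger
    also have "\<dots> = chi4 d" unfolding chi4_minus chi4_add2[OF p(2)] by simp
    finally have "chi4 (8 * k - d - 2 * x) = chi4 d" .
    moreover have "odd ((x + d) div 2)" using p by presburger
    ultimately show ?case using p by (simp add: h_def sgn2_def)
  qed
  have "sum h Om = sum h P + (sum h P' + (sum h Mi + sum h B))"
  proof -
    have f: "finite P" "finite P'" "finite Mi" "finite B"
      using finOm by (auto intro: finite_subset simp: part)
    have "Mi \<inter> B = {}" "P' \<inter> (Mi \<union> B) = {}" "P \<inter> (P' \<union> (Mi \<union> B)) = {}"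
      by (auto simp: Mi_def B_def P'_def P_def)
    thus ?thesis unfolding part using f by (simp add: sum.union_disjoint)
  qed
  hence "sum h Om = sum h B" using hP hP' hM by simp
  also have "sum h B = (\<Sum>(d, k) | d > 0 \<and> k > 0 \<and> odd d \<and> odd k \<and> (2 * k + d)^2 = M. - chi4 d)"
  proof (rule sum.reindex_bij_witness[of _ "\<lambda>(d, k). (d, 2 * k - d, k)" "\<lambda>(d, x, k). (d, k)"], goal_cases)
    case (1 p) thus ?case by (cases p) (auto simp: B_def)
  next
    case (2 p)
    then obtain d x k where p: "p = (d, x, k)" "d > 0" "k > 0" "odd d" "odd x" "\<not> 4 dvd x + d"
      "x^2 + 8 * d * k = M" "x + d = 2 * k" by (auto simp: B_def Om_def)
    have x: "x = 2 * k - d" using p(8) by simp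
    have "(2 * k + d)^2 = M" using p(7) unfolding x by (simp add: power2_eq_square algebra_simps)
    moreover have "odd k" using p(6) unfolding p(8) by presburger
    ultimately show ?case using p by simp
  next
    case (3 p) thus ?case by (cases p) auto
  next
    case (4 p)
    then obtain d k where p: "p = (d, k)" "d > 0" "k > 0" "odd d" "odd k" "(2 * k + d)^2 = M" by auto
    have "(2 * k - d)^2 + 8 * d * k = M" unfolding p(6)[symmetric] by (simp add: power2_eq_square algebra_simps)
    moreover have "\<not> 4 dvd 2 * k - d + d" using p(5) by presburger
    ultimately show ?case using p by (simp add: B_def Om_def)
  next
    case (5 p)
    then obtain d x k where p: "p = (d, x, k)" "\<not> 4 dvd x + d" "x + d = 2 * k" by (auto simp: B_def Om_def)
    have "odd k" using p(2) unfolding p(3) by presburger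
    thus ?case using p by (simp add: h_def sgn2_def)
  qed
  finally show ?thesis unfolding Om_def h_def .
qed

text \<open>For odd d and x exactly one of x + d and -x + d is divisible by 4, so the half excluded
  in \<open>jacobi_lambert_half\<close> is the mirror image of the half treated there.\<close>

lemma jacobi_lambert:
  fixes M :: int
  shows "(\<Sum>(d, x, k) | d > 0 \<and> k > 0 \<and> odd d \<and> odd x \<and> x^2 + 8 * d * k = M. sgn2 k * chi4 d)
    = 2 * (\<Sum>(d, k) | d > 0 \<and> k > 0 \<and> odd d \<and> odd k \<and> (2 * k + d)^2 = M. - chi4 d)"
proof -
  let ?A = "{(d, x, k). d > 0 \<and> k > 0 \<and> odd d \<and> odd x \<and> \<not> 4 dvd x + d \<and> x^2 + 8 * d * k = M}"
  let ?B = "{(d, x, k). d > 0 \<and> k > 0 \<and> odd d \<and> odd x \<and> 4 dvd x + d \<and> x^2 + 8 * d * k = M}"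
  let ?O = "{(d, x, k). d > 0 \<and> k > 0 \<and> odd d \<and> odd x \<and> x^2 + 8 * d * k = M}"
  have fin: "finite ?O" by (rule finite_subset[OF _ finite_forms8[of M]]) auto
  have O: "?O = ?A \<union> ?B" by auto
  have fA: "finite ?A" by (rule finite_subset[OF _ fin]) auto
  have fB: "finite ?B" by (rule finite_subset[OF _ fin]) auto
  have "?A \<inter> ?B = {}" by auto
  hence "(\<Sum>(d, x, k)\<in>?O. sgn2 k * chi4 d) = (\<Sum>(d, x, k)\<in>?A. sgn2 k * chi4 d) + (\<Sum>(d, x, k)\<in>?B. sgn2 k * chi4 d)"
    unfolding O using fA fB by (rule sum.union_disjoint[rotated 2])
  moreover have "(\<Sum>(d, x, k)\<in>?B. sgn2 k * chi4 d) = (\<Sum>(d, x, k)\<in>?A. sgn2 k * chi4 d)"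
  proof (rule sum.reindex_bij_witness[of _ "\<lambda>(d, x, k). (d, - x, k)" "\<lambda>(d, x, k). (d, - x, k)"], goal_cases)
    case (2 p)
    then obtain d x k where p: "p = (d, x, k)" "p \<in> ?B" by (cases p) auto
    hence "odd d" "4 dvd x + d" by auto
    hence "\<not> 4 dvd - x + d" by presburger
    thus ?case using p by simp
  next
    case (4 p)
    then obtain d x k where p: "p = (d, x, k)" "p \<in> ?A" by (cases p) auto
    hence "odd d" "odd x" "\<not> 4 dvd x + d" by auto
    hence "4 dvd - x + d" by presburger
    thus ?case using p by simp
  qed auto
  ultimately show ?thesis unfolding jacobi_lambert_half by simp
qed

lemma sum_chi4_below:
  fixes y :: int
  assumes "odd y" "y > 0"
  shows "4 * (\<Sum>(d, k) | d > 0 \<and> k > 0 \<and> odd d \<and> odd k \<and> (2 * k + d)^2 = y^2. - chi4 d) = y * chi4 y - 1"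
proof -
  \<comment> \<open>The number of odd positive k with 2k < y. Each contributes the same amount
    \<open>chi4 y\<close>, because d = y - 2k is y + 2 modulo 4.\<close>
  let ?c = "if y mod 4 = 1 then (y - 1) div 4 else (y + 1) div 4"
  have "(\<Sum>(d, k) | d > 0 \<and> k > 0 \<and> odd d \<and> odd k \<and> (2 * k + d)^2 = y^2. - chi4 d) = (\<Sum>j\<in>{1..?c}. chi4 y)"
  proof (rule sum.reindex_bij_witness[of _ "\<lambda>j. (y - 2 * (2 * j - 1), 2 * j - 1)" "\<lambda>(d, k). (k + 1) div 2"], goal_cases)
    case (1 p)
    then obtain d k where p: "p = (d, k)" "d > 0" "k > 0" "odd d" "odd k" "(2 * k + d)^2 = y^2" by auto
    have e: "2 * k + d = y" using power2_eq_imp_eq[OF p(6)] p assms by simp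
    obtain i where "k = 2 * i + 1" using p(5) by (rule oddE)
    thus ?case using p e by simp
  next
    case (2 p)
    then obtain d k where p: "p = (d, k)" "d > 0" "k > 0" "odd d" "odd k" "(2 * k + d)^2 = y^2" by auto
    have e: "2 * k + d = y" using power2_eq_imp_eq[OF p(6)] p assms by simp
    obtain i where i: "k = 2 * i + 1" using p(5) by (rule oddE)
    have "(k + 1) div 2 = i + 1" using i by simp
    moreover have "i + 1 \<le> ?c" using e i p(2) assms by (simp add: e[symmetric]) presburger
    ultimately show ?case using p i by simp
  next
    case (3 j) thus ?case by simp
  next
    case (4 j)
    hence j: "1 \<le> j" "j \<le> ?c" by auto
    have "y - 2 * (2 * j - 1) > 0" using j assms by (auto split: if_splits)
    thus ?case using j assms by simp
  next
    case (5 p)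
    then obtain d k where p: "p = (d, k)" "d > 0" "k > 0" "odd d" "odd k" "(2 * k + d)^2 = y^2" by auto
    have e: "2 * k + d = y" using power2_eq_imp_eq[OF p(6)] p assms by simp
    have "chi4 y = chi4 (d + 2)" using p(5) e by (intro chi4_cong) presburger
    thus ?case using p by (simp add: chi4_add2)
  qed
  also have "\<dots> = ?c * chi4 y"
  proof -
    have "?c \<ge> 0" using assms by simp presburger
    thus ?thesis by simp
  qed
  finally show ?thesis using odd_mod4[OF assms(1)]
  proof (elim disjE)
    assume "y mod 4 = 1"
    moreover from this have "4 * ((y - 1) div 4) = y - 1" by presburger
    ultimately show ?thesis if "(\<Sum>(d, k) | d > 0 \<and> k > 0 \<and> odd d \<and> odd k \<and> (2 * k + d)^2 = y^2. - chi4 d) = ?c * chi4 y"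
      using that by (simp add: chi4_def)
  next
    assume "y mod 4 = 3"
    moreover from this have "4 * ((y + 1) div 4) = y + 1" by presburger
    ultimately show ?thesis if "(\<Sum>(d, k) | d > 0 \<and> k > 0 \<and> odd d \<and> odd k \<and> (2 * k + d)^2 = y^2. - chi4 d) = ?c * chi4 y"
      using that by (simp add: chi4_def)
  qed
qed

text \<open>The sign is constant on each circle, since p + q and \<open>p^2 + q^2\<close> have equal
  parity; likewise k has the parity of c when d is odd. So this is \<open>r2_eq\<close> with a sign,
  written with the weight that occurs in \<open>jacobi_lambert\<close>.\<close>

lemma signed_two_squares:
  "(\<Sum>(p, q) | p^2 + q^2 = c. sgn2 (p + q)) = (if c = 0 then 1 else 4 * (\<Sum>(d, k) | (d, k) \<in> dpairs c \<and> odd d. sgn2 k * chi4 d))"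
proof -
  have s: "sgn2 (p + q) = sgn2 c" if "p^2 + q^2 = c" for p q
  proof -
    have "even (p^2 + q^2) \<longleftrightarrow> even (p + q)" by simp
    thus ?thesis using that by (simp add: sgn2_def)
  qed
  have "(\<Sum>(p, q) | p^2 + q^2 = c. sgn2 (p + q)) = (\<Sum>(p, q) | p^2 + q^2 = c. sgn2 c)"
    by (rule sum.cong) (auto simp: s)
  hence l: "(\<Sum>(p, q) | p^2 + q^2 = c. sgn2 (p + q)) = sgn2 c * r2 c"
    by (simp add: r2_def case_prod_beta mult.commute)
  have "(\<Sum>(d, k) | (d, k) \<in> dpairs c \<and> odd d. sgn2 k * chi4 d) = (\<Sum>(d, k) | (d, k) \<in> dpairs c \<and> odd d. sgn2 c * chi4 d)"
  proof (rule sum.cong)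
    fix p assume "p \<in> {(d, k). (d, k) \<in> dpairs c \<and> odd d}"
    then obtain d k where p: "p = (d, k)" "d * k = c" "odd d" by (auto simp: dpairs_def)
    have "even (d * k) \<longleftrightarrow> even k" using p(3) by simp
    hence "sgn2 k = sgn2 c" using p(2) by (simp add: sgn2_def)
    thus "(case p of (d, k) \<Rightarrow> sgn2 k * chi4 d) = (case p of (d, k) \<Rightarrow> sgn2 c * chi4 d)" using p by simp
  qed simp
  also have "\<dots> = (\<Sum>(d, k)\<in>dpairs c. sgn2 c * chi4 d)"
    by (rule sum.mono_neutral_left) (auto simp: chi4_even)
  also have "\<dots> = sgn2 c * lam4 c" by (simp add: lam4_def sum_distrib_left case_prod_beta)
  finally have r: "(\<Sum>(d, k) | (d, k) \<in> dpairs c \<and> odd d. sgn2 k * chi4 d) = sgn2 c * lam4 c" .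
  consider "c < 0" | "c = 0" | "c > 0" by linarith
  thus ?thesis
  proof cases
    case 1 thus ?thesis unfolding l r by (simp add: r2_neg lam4_def lam_neg)
  next
    case 2 thus ?thesis unfolding l by (simp add: r2_0 sgn2_def)
  next
    case 3 thus ?thesis unfolding l r by (simp add: r2_eq)
  qed
qed

text \<open>A coefficient of Jacobi's identity: the theta series of odd x times the square of the
  alternating theta series in 8p^2 is 2 eta(8 tau)^3, and the right side is the expansion of that
  cube. Vectors with p = q = 0 occur only when M is a square and contribute 2 in total; they
  compensate for the -1 in \<open>sum_chi4_below\<close>.\<close>

lemma jacobi_signed_sum:
  fixes M :: int
  assumes M: "M mod 8 = 1"
  shows "(\<Sum>(x, p, q) | odd x \<and> x^2 + 8 * (p^2 + q^2) = M. sgn2 (p + q)) = (\<Sum>y | y^2 = M. y * chi4 y)"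
proof -
  define I where "I = {x \<in> {- M..M}. odd x}"
  define c where "c x = (M - x^2) div 8" for x
  have finI: "finite I" by (simp add: I_def)
  have c: "M - x^2 = 8 * c x" if "odd x" for x
  proof -
    have "(M - x^2) mod 8 = 0" using odd_square_mod8[OF that] M by presburger
    thus ?thesis unfolding c_def by presburger
  qed
  have inI: "x \<in> I" if "odd x" "x^2 \<le> M" for x using that square_le_imp[of x M] by (simp add: I_def)
  define B where "B x = {(p, q). p^2 + q^2 = c x}" for x
  define D where "D x = {(d, k). (d, k) \<in> dpairs (c x) \<and> odd d}" for x
  have finD: "finite (D x)" for x unfolding D_def by (rule finite_subset[OF _ finite_dpairs[of "c x"]]) auto
  have S1: "{(x, p, q). odd x \<and> x^2 + 8 * (p^2 + q^2) = M} = Sigma I B"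
  proof (intro equalityI subsetI)
    fix t assume "t \<in> {(x, p, q). odd x \<and> x^2 + 8 * (p^2 + q^2) = M}"
    then obtain x p q where t: "t = (x, p, q)" "odd x" "x^2 + 8 * (p^2 + q^2) = M" by auto
    have "0 \<le> 8 * (p^2 + q^2)" by simp
    hence "x^2 \<le> M" using t(3) by linarith
    moreover have "8 * (p^2 + q^2) = 8 * c x"
      unfolding c[OF t(2), symmetric] t(3)[symmetric] by simp
    hence "p^2 + q^2 = c x" by simp
    ultimately show "t \<in> Sigma I B" using t inI by (simp add: B_def)
  next
    fix t assume "t \<in> Sigma I B"
    then obtain x p q where t: "t = (x, p, q)" "odd x" "p^2 + q^2 = c x" by (auto simp: I_def B_def)
    thus "t \<in> {(x, p, q). odd x \<and> x^2 + 8 * (p^2 + q^2) = M}" using c[OF t(2)] by simp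
  qed
  have "(\<Sum>(x, p, q)\<in>Sigma I B. sgn2 (p + q)) = (\<Sum>x\<in>I. \<Sum>(p, q)\<in>B x. sgn2 (p + q))"
    by (subst sum.Sigma) (auto simp: B_def finI)
  also have "\<dots> = (\<Sum>x\<in>I. if c x = 0 then 1 else 4 * (\<Sum>(d, k)\<in>D x. sgn2 k * chi4 d))"
    unfolding B_def D_def signed_two_squares by (rule refl)
  also have "\<dots> = (\<Sum>x\<in>I. (if c x = 0 then 1 else 0) + 4 * (\<Sum>(d, k)\<in>D x. sgn2 k * chi4 d))"
    by (rule sum.cong) (auto simp: D_def lam_neg)
  also have "\<dots> = (\<Sum>x\<in>I. if c x = 0 then 1 else 0) + 4 * (\<Sum>x\<in>I. \<Sum>(d, k)\<in>D x. sgn2 k * chi4 d)"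
    by (simp add: sum.distrib sum_distrib_left)
  also have "(\<Sum>x\<in>I. \<Sum>(d, k)\<in>D x. sgn2 k * chi4 d) = (\<Sum>(x, d, k)\<in>Sigma I D. sgn2 k * chi4 d)"
    by (subst sum.Sigma) (auto simp: finI finD)
  also have "\<dots> = (\<Sum>(d, x, k) | d > 0 \<and> k > 0 \<and> odd d \<and> odd x \<and> x^2 + 8 * d * k = M. sgn2 k * chi4 d)"
  proof (rule sum.reindex_bij_witness[of _ "\<lambda>(d, x, k). (x, d, k)" "\<lambda>(x, d, k). (d, x, k)"], goal_cases)
    case (2 t)
    then obtain x d k where t: "t = (x, d, k)" "odd x" "d > 0" "k > 0" "odd d" "d * k = c x"
      by (auto simp: I_def D_def dpairs_def)
    hence "x^2 + 8 * d * k = M" using c[OF t(2)] by (simp add: mult.assoc)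
    thus ?case using t by simp
  next
    case (4 t)
    then obtain x d k where t: "t = (d, x, k)" "odd x" "d > 0" "k > 0" "odd d" "x^2 + 8 * (d * k) = M"
      by (auto simp: mult.assoc)
    have "d * k = c x" using c[OF t(2)] t(6) by linarith
    moreover have "x^2 \<le> M" using mult_pos_pos[OF t(3,4)] t(6) by linarith
    ultimately show ?case using t inI by (simp add: D_def dpairs_def)
  qed auto
  also have "\<dots> = 2 * (\<Sum>(d, k) | d > 0 \<and> k > 0 \<and> odd d \<and> odd k \<and> (2 * k + d)^2 = M. - chi4 d)"
    by (rule jacobi_lambert)
  finally have main: "(\<Sum>(x, p, q)\<in>Sigma I B. sgn2 (p + q)) = (\<Sum>x\<in>I. if c x = 0 then 1 else 0)
      + 8 * (\<Sum>(d, k) | d > 0 \<and> k > 0 \<and> odd d \<and> odd k \<and> (2 * k + d)^2 = M. - chi4 d)" by simp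
  show ?thesis
  proof (cases "\<exists>y. y^2 = M")
    case True
    then obtain y0 where "y0^2 = M" by blast
    define y where "y = \<bar>y0\<bar>"
    have y: "y^2 = M" using \<open>y0^2 = M\<close> by (simp add: y_def)
    have "odd M" using M by presburger
    hence yo: "odd y" using y by auto
    hence y0: "y > 0" by (auto simp: y_def)
    have roots: "x^2 = M \<longleftrightarrow> x = y \<or> x = - y" for x using y by (metis power2_eq_iff)
    have "(\<Sum>x\<in>I. if c x = 0 then 1 else 0) = (\<Sum>x\<in>{y, - y}. 1 :: int)"
    proof -
      have "c x = 0 \<longleftrightarrow> x = y \<or> x = - y" if "x \<in> I" for x
        using c[of x] that roots[of x] by (auto simp: I_def)
      hence "(\<Sum>x\<in>I. if c x = 0 then 1 else 0) = (\<Sum>x\<in>I. if x \<in> {y, - y} then 1 else (0::int))"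
        by (intro sum.cong) auto
      also have "\<dots> = (\<Sum>x\<in>{y, - y}. 1)"
      proof -
        have "{y, - y} \<subseteq> I" using inI[of y] inI[of "- y"] yo y by auto
        hence "I \<inter> {y, - y} = {y, - y}" by blast
        moreover have "(\<Sum>x\<in>I. if x \<in> {y, - y} then 1 else (0::int)) = (\<Sum>x\<in>I \<inter> {y, - y}. 1)"
          by (rule sum.inter_restrict[symmetric]) (rule finI)
        ultimately show ?thesis by (simp only:)
      qed
      finally show ?thesis .
    qed
    also have "\<dots> = 2" using y0 by simp
    finally have c2: "(\<Sum>x\<in>I. if c x = 0 then 1 else 0 :: int) = 2" .
    have "{x. x^2 = M} = {y, - y}" using roots by auto
    hence rhs: "(\<Sum>y | y^2 = M. y * chi4 y) = 2 * (y * chi4 y)" using y0 by simp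
    show ?thesis unfolding S1 main c2 rhs using sum_chi4_below[OF yo y0] unfolding y by simp
  next
    case False
    have "(\<Sum>x\<in>I. if c x = 0 then 1 else 0 :: int) = 0"
    proof (rule sum.neutral, intro ballI)
      fix x assume "x \<in> I"
      hence "c x \<noteq> 0" using c[of x] False by (auto simp: I_def)
      thus "(if c x = 0 then 1 else 0 :: int) = 0" by simp
    qed
    thus ?thesis unfolding S1 main using False by simp
  qed
qed

section \<open>A product of two Lambert series\<close>

definition quads :: "int \<Rightarrow> (int \<times> int \<times> int \<times> int) set" where
  "quads N = {(d, k, e, l). d > 0 \<and> k > 0 \<and> e > 0 \<and> l > 0 \<and> d * k + e * l = N}"

lemma finite_quads [simp]: "finite (quads N)"
proof (rule finite_subset)
  show "quads N \<subseteq> {0..N} \<times> {0..N} \<times> {0..N} \<times> {0..N}"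
  proof
    fix p assume "p \<in> quads N"
    then obtain d k e l where p: "p = (d, k, e, l)" "d > 0" "k > 0" "e > 0" "l > 0" "d * k + e * l = N"
      by (auto simp: quads_def)
    hence "d * k \<le> N" "e * l \<le> N" using mult_pos_pos[OF p(2,3)] mult_pos_pos[OF p(4,5)] by linarith+
    thus "p \<in> {0..N} \<times> {0..N} \<times> {0..N} \<times> {0..N}"
      using p pos_factor_le[of d k N] pos_factor_le[of e l N] by auto
  qed
qed simp

section \<open>Liouville's bijection and the resulting identity\<close>

lemma liouville_shift:
  fixes F :: "int \<Rightarrow> int \<Rightarrow> int \<Rightarrow> int \<Rightarrow> int"
  shows "(\<Sum>(d, k, e, l) | (d, k, e, l) \<in> quads N \<and> Q (d - e) e \<and> d > e. F d k e l)
       = (\<Sum>(d, k, e, l) | (d, k, e, l) \<in> quads N \<and> Q d e \<and> l > k. F (d + e) k e (l - k))"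
  by (rule sum.reindex_bij_witness[of _ "\<lambda>(d, k, e, l). (d + e, k, e, l - k)" "\<lambda>(d, k, e, l). (d - e, k, e, l + k)"])
     (auto simp: quads_def algebra_simps)

lemma quads_swap:
  fixes F :: "int \<Rightarrow> int \<Rightarrow> int \<Rightarrow> int \<Rightarrow> int"
  shows "(\<Sum>(d, k, e, l) | (d, k, e, l) \<in> quads N \<and> Q d k e l. F d k e l)
       = (\<Sum>(d, k, e, l) | (d, k, e, l) \<in> quads N \<and> Q e l d k. F e l d k)"
  by (rule sum.reindex_bij_witness[of _ "\<lambda>(d, k, e, l). (e, l, d, k)" "\<lambda>(d, k, e, l). (e, l, d, k)"])
     (auto simp: quads_def algebra_simps)

lemma finite_quads_filter [simp]: "finite {(d, k, e, l). (d, k, e, l) \<in> quads N \<and> Q d k e l}"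
  by (rule finite_subset[OF _ finite_quads[of N]]) auto

lemma quads_split:
  fixes F :: "int \<Rightarrow> int \<Rightarrow> int \<Rightarrow> int \<Rightarrow> int"
  shows "(\<Sum>(d, k, e, l) | (d, k, e, l) \<in> quads N \<and> Q d k e l. F d k e l)
       = (\<Sum>(d, k, e, l) | (d, k, e, l) \<in> quads N \<and> Q d k e l \<and> R d k e l. F d k e l)
       + (\<Sum>(d, k, e, l) | (d, k, e, l) \<in> quads N \<and> Q d k e l \<and> \<not> R d k e l. F d k e l)"
proof -
  have "{(d, k, e, l). (d, k, e, l) \<in> quads N \<and> Q d k e l}
      = {(d, k, e, l). (d, k, e, l) \<in> quads N \<and> Q d k e l \<and> R d k e l}
      \<union> {(d, k, e, l). (d, k, e, l) \<in> quads N \<and> Q d k e l \<and> \<not> R d k e l}" by auto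
  thus ?thesis by (simp add: sum.union_disjoint disjoint_iff)
qed

text \<open>As N is odd, even d forces odd e and l. The shift sends the even d with d > e to pairs
  of odd d, e with l > k; by \<open>tau\<close> and the exchange of (d, k) with (e, l) these carry
  half of the whole odd sum, whence the factor 2. The even d with d < e cancel against those with k
  > l in the subtracted sum, and its part with k < l is again half of an odd sum, now over unequal d
  and e. The diagonals d = e and k = l, which the shift misses, remain as boundary terms.\<close>

lemma liouville_identity:
  fixes g :: "int \<Rightarrow> int \<Rightarrow> int \<Rightarrow> int" and N :: int
  assumes N: "odd N"
    and ev: "\<And>d k e. g (- d) (- k) (- e) = g d k e"
    and tau: "\<And>d k e l. even d \<Longrightarrow> d * k + e * l = N \<Longrightarrow> g d (k + l) (d - e) = g d k e"
  shows "2 * (\<Sum>(d, k, e, l) | (d, k, e, l) \<in> quads N \<and> even d. g d k e - g d k (- e))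
     = (\<Sum>(d, k, e, l) | (d, k, e, l) \<in> quads N \<and> odd d \<and> odd e. g (d + e) k e - g (d - e) k (- e))
     + (\<Sum>(d, k, e, l) | (d, k, e, l) \<in> quads N \<and> odd d \<and> odd e \<and> d = e. g 0 k (- e))
     - 2 * (\<Sum>(d, k, e, l) | (d, k, e, l) \<in> quads N \<and> even d \<and> k = l. g d k (- e))"
proof -
  let ?S = "\<lambda>Q F. \<Sum>(d, k, e, l) | (d, k, e, l) \<in> quads N \<and> Q d k e l. F d k e l"
  let ?g = "\<lambda>d k e l::int. g d k e" and ?gm = "\<lambda>d k e l::int. g d k (- e)"
  let ?gp = "\<lambda>d k e l::int. g (d + e) k e" and ?gd = "\<lambda>d k e l::int. g (d - e) k (- e)"
  have eo: "odd e \<and> odd l" if "(d, k, e, l) \<in> quads N" "even d" for d k e l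
  proof -
    have "odd (d * k + e * l)" using that N by (simp add: quads_def)
    thus ?thesis using that(2) by simp
  qed
  have kl: "k \<noteq> l" if "(d, k, e, l) \<in> quads N" "odd d" "odd e" for d k e l
  proof
    assume "k = l"
    hence "N = (d + e) * k" using that(1) by (auto simp: quads_def algebra_simps)
    thus False using that N by auto
  qed
  have s1: "?S (\<lambda>d k e l. even d) ?g
      = ?S (\<lambda>d k e l. even d \<and> d > e) ?g + ?S (\<lambda>d k e l. even d \<and> \<not> d > e) ?g"
    by (rule quads_split)
  have "?S (\<lambda>d k e l. even d \<and> d > e) ?g = ?S (\<lambda>d k e l. (odd (d - e) \<and> odd e) \<and> d > e) ?g"
    by (rule sum.cong) (use eo in auto)
  also have "\<dots> = ?S (\<lambda>d k e l. (odd d \<and> odd e) \<and> l > k) ?gp"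
    by (rule liouville_shift)
  finally have b1: "?S (\<lambda>d k e l. even d \<and> d > e) ?g
      = ?S (\<lambda>d k e l. (odd d \<and> odd e) \<and> l > k) ?gp" .
  have "?S (\<lambda>d k e l. even d \<and> \<not> d > e) ?g = ?S (\<lambda>d k e l. even d \<and> e > d) ?g"
  proof (rule sum.cong)
    have "d \<noteq> e" if "(d, k, e, l) \<in> quads N" "even d" for d k e l using eo[OF that] that by auto
    thus "{(d, k, e, l). (d, k, e, l) \<in> quads N \<and> even d \<and> \<not> d > e} = {(d, k, e, l). (d, k, e, l) \<in> quads N \<and> even d \<and> e > d}"
      by fastforce
  qed simp
  also have "\<dots> = ?S (\<lambda>d k e l. even e \<and> d > e) (\<lambda>d k e l. g e l d)" by (rule quads_swap)
  also have "\<dots> = ?S (\<lambda>d k e l. even e \<and> l > k) (\<lambda>d k e l. g e (l - k) (d + e))"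
    by (rule liouville_shift[where Q = "\<lambda>d e. even e"])
  also have "\<dots> = ?S (\<lambda>d k e l. even d \<and> k > l) (\<lambda>d k e l. g d (k - l) (e + d))" by (rule quads_swap)
  also have "\<dots> = ?S (\<lambda>d k e l. even d \<and> k > l) ?gm"
  proof (rule sum.cong)
    fix p assume "p \<in> {(d, k, e, l). (d, k, e, l) \<in> quads N \<and> even d \<and> k > l}"
    then obtain d k e l where p: "p = (d, k, e, l)" "even d" "d * k + (- e) * (- l) = N" by (auto simp: quads_def)
    \<comment> \<open>The symmetry \<open>tau\<close> is available for all integers, and is used
      here with -e and -l.\<close>
    have "g d (k - l) (e + d) = g d k (- e)" using tau[OF p(2,3)] by (simp add: add.commute)
    thus "(case p of (d, k, e, l) \<Rightarrow> g d (k - l) (e + d)) = (case p of (d, k, e, l) \<Rightarrow> g d k (- e))" using p by simp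
  qed simp
  finally have b2: "?S (\<lambda>d k e l. even d \<and> \<not> d > e) ?g
      = ?S (\<lambda>d k e l. even d \<and> k > l) ?gm" .
  have s2: "?S (\<lambda>d k e l. even d) ?gm
      = ?S (\<lambda>d k e l. even d \<and> k > l) ?gm + ?S (\<lambda>d k e l. even d \<and> \<not> k > l) ?gm"
    by (rule quads_split)
  have s3: "?S (\<lambda>d k e l. even d \<and> \<not> k > l) ?gm
      = ?S (\<lambda>d k e l. (even d \<and> \<not> k > l) \<and> k = l) ?gm
      + ?S (\<lambda>d k e l. (even d \<and> \<not> k > l) \<and> k \<noteq> l) ?gm"
    by (rule quads_split)
  have s4: "?S (\<lambda>d k e l. (even d \<and> \<not> k > l) \<and> k = l) ?gm = ?S (\<lambda>d k e l. even d \<and> k = l) ?gm"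
    by (rule sum.cong) auto
  have "?S (\<lambda>d k e l. (even d \<and> \<not> k > l) \<and> k \<noteq> l) ?gm = ?S (\<lambda>d k e l. even d \<and> l > k) (\<lambda>d k e l. g (d + e - e) k (- e))"
    by (rule sum.cong) auto
  also have "\<dots> = ?S (\<lambda>d k e l. even (d - e) \<and> d > e) ?gd"
    by (rule liouville_shift[where Q = "\<lambda>d e. even d" and F = "\<lambda>d k e l. g (d - e) k (- e)", symmetric])
  also have "\<dots> = ?S (\<lambda>d k e l. (odd d \<and> odd e) \<and> d > e) ?gd"
  proof (rule sum.cong)
    have "odd e" if "(d, k, e, l) \<in> quads N" "even (d - e)" for d k e l
    proof (rule ccontr)
      assume "\<not> odd e"
      hence "even (d * k + e * l)" using that(2) by simp
      moreover have "d * k + e * l = N" using that(1) by (simp add: quads_def)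
      ultimately show False using N by metis
    qed
    thus "{(d, k, e, l). (d, k, e, l) \<in> quads N \<and> even (d - e) \<and> d > e} = {(d, k, e, l). (d, k, e, l) \<in> quads N \<and> (odd d \<and> odd e) \<and> d > e}"
      by auto
  qed simp
  finally have b3: "?S (\<lambda>d k e l. (even d \<and> \<not> k > l) \<and> k \<noteq> l) ?gm
      = ?S (\<lambda>d k e l. (odd d \<and> odd e) \<and> d > e) ?gd" .
  have s5: "?S (\<lambda>d k e l. odd d \<and> odd e) ?gp
     = ?S (\<lambda>d k e l. (odd d \<and> odd e) \<and> l > k) ?gp
     + ?S (\<lambda>d k e l. (odd d \<and> odd e) \<and> \<not> l > k) ?gp"
    by (rule quads_split)
  have "?S (\<lambda>d k e l. (odd d \<and> odd e) \<and> \<not> l > k) ?gp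
     = ?S (\<lambda>d k e l. (odd e \<and> odd d) \<and> \<not> k > l) (\<lambda>d k e l. g (e + d) l d)" by (rule quads_swap)
  also have "\<dots> = ?S (\<lambda>d k e l. (odd d \<and> odd e) \<and> l > k) ?gp"
  proof (rule sum.cong)
    show "{(d, k, e, l). (d, k, e, l) \<in> quads N \<and> (odd e \<and> odd d) \<and> \<not> k > l} = {(d, k, e, l). (d, k, e, l) \<in> quads N \<and> (odd d \<and> odd e) \<and> l > k}"
      using kl by fastforce
    fix p assume "p \<in> {(d, k, e, l). (d, k, e, l) \<in> quads N \<and> (odd d \<and> odd e) \<and> l > k}"
    then obtain d k e l where p: "p = (d, k, e, l)" "even (d + e)" "(d + e) * k + e * (l - k) = N"
      by (auto simp: quads_def algebra_simps)
    have "g (e + d) l d = g (d + e) k e" using tau[OF p(2,3)] by (simp add: add.commute)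
    thus "(case p of (d, k, e, l) \<Rightarrow> g (e + d) l d) = (case p of (d, k, e, l) \<Rightarrow> g (d + e) k e)" using p by simp
  qed
  finally have b4: "?S (\<lambda>d k e l. (odd d \<and> odd e) \<and> \<not> l > k) ?gp
     = ?S (\<lambda>d k e l. (odd d \<and> odd e) \<and> l > k) ?gp" .
  have s6: "?S (\<lambda>d k e l. odd d \<and> odd e) ?gd
     = ?S (\<lambda>d k e l. (odd d \<and> odd e) \<and> d > e) ?gd
     + ?S (\<lambda>d k e l. (odd d \<and> odd e) \<and> \<not> d > e) ?gd"
    by (rule quads_split)
  have s7: "?S (\<lambda>d k e l. (odd d \<and> odd e) \<and> \<not> d > e) ?gd
     = ?S (\<lambda>d k e l. ((odd d \<and> odd e) \<and> \<not> d > e) \<and> d = e) ?gd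
     + ?S (\<lambda>d k e l. ((odd d \<and> odd e) \<and> \<not> d > e) \<and> d \<noteq> e) ?gd"
    by (rule quads_split)
  have s8: "?S (\<lambda>d k e l. ((odd d \<and> odd e) \<and> \<not> d > e) \<and> d = e) ?gd
     = ?S (\<lambda>d k e l. odd d \<and> odd e \<and> d = e) (\<lambda>d k e l. g 0 k (- e))"
    by (rule sum.cong) auto
  have "?S (\<lambda>d k e l. ((odd d \<and> odd e) \<and> \<not> d > e) \<and> d \<noteq> e) ?gd
     = ?S (\<lambda>d k e l. ((odd e \<and> odd d) \<and> \<not> e > d) \<and> e \<noteq> d) (\<lambda>d k e l. g (e - d) l (- d))" by (rule quads_swap)
  also have "\<dots> = ?S (\<lambda>d k e l. (odd d \<and> odd e) \<and> d > e) ?gd"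
  proof (rule sum.cong)
    fix p assume "p \<in> {(d, k, e, l). (d, k, e, l) \<in> quads N \<and> (odd d \<and> odd e) \<and> d > e}"
    then obtain d k e l where p: "p = (d, k, e, l)" "even (d - e)" "(d - e) * k + (- e) * (- k - l) = N"
      by (auto simp: quads_def algebra_simps)
    have "g (e - d) l (- d) = g (d - e) k (- e)" using tau[OF p(2,3)] ev[of "d - e" "- l" d] by simp
    thus "(case p of (d, k, e, l) \<Rightarrow> g (e - d) l (- d)) = (case p of (d, k, e, l) \<Rightarrow> g (d - e) k (- e))" using p by simp
  qed auto
  finally have b5: "?S (\<lambda>d k e l. ((odd d \<and> odd e) \<and> \<not> d > e) \<and> d \<noteq> e) ?gd
     = ?S (\<lambda>d k e l. (odd d \<and> odd e) \<and> d > e) ?gd" .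
  have t1: "?S (\<lambda>d k e l. even d) (\<lambda>d k e l. g d k e - g d k (- e))
     = ?S (\<lambda>d k e l. even d) ?g - ?S (\<lambda>d k e l. even d) ?gm"
    by (simp add: sum_subtractf case_prod_beta)
  have t2: "?S (\<lambda>d k e l. odd d \<and> odd e) (\<lambda>d k e l. g (d + e) k e - g (d - e) k (- e))
     = ?S (\<lambda>d k e l. odd d \<and> odd e) ?gp - ?S (\<lambda>d k e l. odd d \<and> odd e) ?gd"
    by (simp add: sum_subtractf case_prod_beta)
  have arith: "2 * (a - c) = f - h + h5 - 2 * c5"
    if "a = a1 + a2" "a1 = b1" "a2 = b2" "c = b2 + c2" "c2 = c3 + c4" "c3 = c5" "c4 = e1"
      "f = b1 + f2" "f2 = b1" "h = e1 + h2" "h2 = h3 + h4" "h3 = h5" "h4 = e1"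
    for a a1 a2 b1 b2 c c2 c3 c4 c5 e1 f f2 h h2 h3 h4 h5 :: int
    using that by (simp add: algebra_simps)
  show ?thesis
    unfolding t1 t2 by (rule arith[OF s1 b1 b2 s2 s3 s4 b3 s5 b4 s6 s7 s8 b5])
qed

section \<open>A kernel modulo 12 and its symmetries\<close>

lemma chi3_range: "chi3 d = - 1 \<or> chi3 d = 0 \<or> chi3 d = 1"
  by (simp add: chi3_def)

lemma chi3_self: "chi3 d mod 3 = d mod 3"
proof -
  have "d mod 3 = 0 \<or> d mod 3 = 1 \<or> d mod 3 = 2" by presburger
  thus ?thesis by (elim disjE) (simp_all add: chi3_def)
qed

lemma chi3_add: "chi3 (d + e) = chi3 (chi3 d + chi3 e)"
  by (rule chi3_cong) (metis chi3_self mod_add_eq)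

lemma chi3_diff: "chi3 (d - e) = chi3 (chi3 d - chi3 e)"
  by (rule chi3_cong) (metis chi3_self mod_diff_eq)

lemma chi3_zero_iff: "3 dvd d \<longleftrightarrow> chi3 d = 0"
  unfolding chi3_def by presburger

definition chi3z :: "int \<Rightarrow> int \<Rightarrow> int" where
  "chi3z d e = (if 3 dvd d then chi3 e else 0)"

text \<open>
  The kernel was found by linear algebra over functions on residues modulo 12: it has the symmetries
  required by \<open>liouville_identity\<close>, and it is the choice for which all terms except those of
  \<open>lambert_product_identity\<close> cancel.
\<close>

definition lrow :: "int \<Rightarrow> int \<Rightarrow> int \<Rightarrow> int" where
  "lrow r d e = (if r = 0 then - chi3 e else if r = 1 then chi3 (d - e)
     else if r = 2 then chi3 e - 3 * chi3 d + 3 * chi3z d e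
     else 3 * chi3 d - chi3 (d - e) + 3 * chi3z d e)"

text \<open>The row index \<open>k * e mod 4\<close> is unchanged when k and e are both negated, and
  becomes 1 - r under the symmetry \<open>tau\<close> of \<open>liouville_identity\<close>. In both
  cases \<open>chi4 e\<close> changes sign, matching the sign changes of
  \<open>lrow\<close>.\<close>

definition lkernel :: "int \<Rightarrow> int \<Rightarrow> int \<Rightarrow> int" where
  "lkernel d k e = (if 4 dvd d \<and> odd e then chi4 e * lrow (k * e mod 4) d e else 0)"

lemma mod4_cases: "(k::int) mod 4 = 0 \<or> k mod 4 = 1 \<or> k mod 4 = 2 \<or> k mod 4 = 3"
  by presburger

lemma chi3z_minus [simp]: "chi3z (- d) e = chi3z d e" "chi3z d (- e) = - chi3z d e"
  by (simp_all add: chi3z_def)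

lemma lrow_minus: "lrow r (- d) (- e) = - lrow r d e"
proof -
  have "chi3 (- d - - e) = - chi3 (d - e)" using chi3_minus[of "d - e"] by simp
  thus ?thesis unfolding lrow_def chi3z_minus chi3_minus by simp
qed

lemma lkernel_even: "lkernel (- d) (- k) (- e) = lkernel d k e"
  by (simp add: lkernel_def lrow_minus)

text \<open>The symmetry exchanges row 0 with row 1 and row 2 with row 3, so rows 1 and 3 of
  \<open>lrow\<close> are determined by rows 0 and 2.\<close>

lemma lrow_tau: "r = 0 \<or> r = 1 \<or> r = 2 \<or> r = 3 \<Longrightarrow> lrow ((1 - r) mod 4) d (d - e) = - lrow r d e"
proof -
  have z: "chi3z d (d - e) = - chi3z d e"
  proof -
    have "chi3 (d - e) = chi3 (- e)" if "3 dvd d" using that by (intro chi3_cong) presburger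
    thus ?thesis by (simp add: chi3z_def)
  qed
  have e: "d - (d - e) = e" by simp
  assume "r = 0 \<or> r = 1 \<or> r = 2 \<or> r = 3"
  thus ?thesis unfolding lrow_def z e by (elim disjE) simp_all
qed

text \<open>For 4 dividing d, \<open>(k + l) * (d - e)\<close> is \<open>- k * e - N\<close> modulo
  4, and \<open>N mod 4 = 3\<close> turns this into 1 - r. The sign of
  \<open>chi4 (d - e) = - chi4 e\<close> cancels the one in \<open>lrow_tau\<close>.\<close>

lemma lkernel_tau:
  assumes N: "N mod 4 = 3" and "even d" "d * k + e * l = N"
  shows "lkernel d (k + l) (d - e) = lkernel d k e"
proof (cases "4 dvd d \<and> odd e")
  case True
  then obtain c where c: "d = 4 * c" by (auto elim: dvdE)
  have "chi4 (d - e) = chi4 (- e)" unfolding c by (rule chi4_cong) presburger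
  hence c4: "chi4 (d - e) = - chi4 e" by simp
  have "(k + l) * (d - e) = 4 * (c * (2 * k + l)) - N - k * e"
    using assms(3) unfolding c by (simp add: algebra_simps)
  moreover have "(4 * a - N - b) mod 4 = (1 - b mod 4) mod 4" for a b using N by presburger
  ultimately have "((k + l) * (d - e)) mod 4 = (1 - k * e mod 4) mod 4" by simp
  moreover have "odd (d - e)" using True c by simp
  ultimately show ?thesis using True c4 lrow_tau[OF mod4_cases[of "k * e"], of d e] by (simp add: lkernel_def)
next
  case False
  thus ?thesis using assms(2) by (auto simp: lkernel_def)
qed

definition lwt :: "int \<Rightarrow> int \<Rightarrow> int" where
  "lwt r d = (if r = 0 then - 1 else if r = 2 then (if 3 dvd d then - 2 else 4)
      else if r = 1 then (if 3 dvd d then 3 else 0) else 0)"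

text \<open>A check over residues whose point is separation of variables: one term has only
  \<open>chi3 e\<close> from the second pair, the other only \<open>chi3 d\<close> from the first.
  With \<open>r = d * k mod 4\<close> and N = 3 modulo 4, \<open>(3 - r) mod 4\<close> is
  \<open>e * l mod 4\<close>, so the terms are exchanged by swapping (d, k) with (e, l), up to sign.
  The values of \<open>lwt\<close> are read off from the kernel for this purpose.\<close>

lemma lrow_odd:
  assumes "r = 0 \<or> r = 1 \<or> r = 2 \<or> r = 3"
  shows "lrow ((- r) mod 4) (d + e) e = chi3 e * lwt r d - chi3 d * lwt ((3 - r) mod 4) e"
proof -
  have a: "d + e - e = d" by simp
  show ?thesis using assms chi3_range[of d] chi3_range[of e]
    unfolding lrow_def lwt_def chi3z_def a chi3_zero_iff chi3_add[of d e]
    by (elim disjE; simp; simp add: chi3_def)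
qed

lemma lrow_even:
  assumes "r = 0 \<or> r = 1 \<or> r = 2 \<or> r = 3"
  shows "lrow r d e + lrow ((- r) mod 4) d (- e)
     = chi3 d * (if r = 1 \<or> r = 3 then 3 else if r = 2 then - 6 else 0) + chi4 r * chi3 e * (if 3 dvd d then - 5 else 1)"
proof -
  have a: "d - - e = d + e" by simp
  show ?thesis using assms chi3_range[of d] chi3_range[of e]
    unfolding lrow_def chi3z_def a chi3_zero_iff chi3_add[of d e] chi3_diff[of d e] chi3_minus
    by (elim disjE; simp add: chi4_def; simp add: chi3_def)
qed

lemma mod4_minus: "k * - e mod 4 = (- (k * e mod 4)) mod (4::int)"
  by (simp add: mod_minus_eq)

lemma lkernel_even_bracket:
  assumes "4 dvd d" "odd e"
  shows "lkernel d k e - lkernel d k (- e) = chi4 e * chi3 d * (if odd k then 3 else if k mod 4 = 2 then - 6 else 0)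
     + chi4 k * chi3 e * (if 3 dvd d then - 5 else 1)"
proof -
  let ?r = "k * e mod 4"
  have e: "e mod 4 = 1 \<or> e mod 4 = 3" using assms by presburger
  have r: "?r = ((k mod 4) * (e mod 4)) mod 4" by (simp add: mod_mult_eq)
  have K: "(if ?r = 1 \<or> ?r = 3 then 3 else if ?r = 2 then - 6 else (0::int)) = (if odd k then 3 else if k mod 4 = 2 then - 6 else 0)"
  proof -
    have "odd k \<longleftrightarrow> k mod 4 = 1 \<or> k mod 4 = 3" by presburger
    thus ?thesis using mod4_cases[of k] e unfolding r by (elim disjE) simp_all
  qed
  have "chi4 ?r = chi4 (k * e)" by (rule chi4_cong) simp
  hence "chi4 e * chi4 ?r = chi4 k * (chi4 e * chi4 e)" by (simp add: chi4_mult)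
  hence c: "chi4 e * chi4 ?r = chi4 k" by (simp add: chi4_odd_square[OF assms(2)])
  have "lkernel d k e - lkernel d k (- e) = chi4 e * (lrow ?r d e + lrow ((- ?r) mod 4) d (- e))"
    using assms unfolding lkernel_def mod4_minus by (simp add: algebra_simps)
  also have "\<dots> = chi4 e * chi3 d * (if odd k then 3 else if k mod 4 = 2 then - 6 else 0)
     + (chi4 e * chi4 ?r) * chi3 e * (if 3 dvd d then - 5 else 1)"
    unfolding lrow_even[OF mod4_cases] K by (simp only: distrib_left mult.assoc)
  finally show ?thesis unfolding c .
qed

text \<open>Of d + e and d - e exactly one is divisible by 4, so only one kernel value is present.
  The second case is the first with -e for e, and both lead to the same separated
  expression.\<close>

lemma lkernel_odd_bracket:
  assumes N: "N mod 4 = 3" "d * k + e * l = N" and o: "odd d" "odd e"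
  shows "lkernel (d + e) k e - lkernel (d - e) k (- e)
    = - (chi4 d * chi3 e * lwt (d * k mod 4) d) - chi4 e * chi3 d * lwt (e * l mod 4) e"
proof -
  let ?a = "d * k mod 4"
  have el: "e * l mod 4 = (3 - ?a) mod 4"
  proof -
    have "e * l = N - d * k" using N(2) by simp
    moreover have "(N - b) mod 4 = (3 - b mod 4) mod 4" for b using N(1) by presburger
    ultimately show ?thesis by simp
  qed
  show ?thesis
  proof (cases "4 dvd d + e")
    case True
    have n: "\<not> 4 dvd d - e" using True o by presburger
    have "chi4 e = chi4 (- d)" using True by (intro chi4_cong) presburger
    hence c: "chi4 d = - chi4 e" by simp
    obtain t where "d + e = 4 * t" using True by (rule dvdE)
    hence ee: "e = 4 * t - d" by simp
    have "k * e = 4 * (k * t) - d * k" unfolding ee by (simp add: algebra_simps)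
    moreover have "(4 * x - y) mod 4 = (- (y mod 4)) mod 4" for x y :: int by presburger
    ultimately have "k * e mod 4 = (- ?a) mod 4" by simp
    hence "lkernel (d + e) k e - lkernel (d - e) k (- e) = chi4 e * lrow ((- ?a) mod 4) (d + e) e"
      using True n o by (simp add: lkernel_def)
    thus ?thesis unfolding lrow_odd[OF mod4_cases] el c by (simp add: algebra_simps)
  next
    case False
    have n: "4 dvd d - e" using False o by presburger
    have c: "chi4 d = chi4 e" using n by (intro chi4_cong) presburger
    obtain t where "d - e = 4 * t" using n by (rule dvdE)
    hence ee: "e = d - 4 * t" by simp
    have "k * - e = 4 * (k * t) - d * k" unfolding ee by (simp add: algebra_simps)
    moreover have "(4 * x - y) mod 4 = (- (y mod 4)) mod 4" for x y :: int by presburger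
    ultimately have "k * - e mod 4 = (- ?a) mod 4" by simp
    hence "lkernel (d + e) k e - lkernel (d - e) k (- e) = chi4 e * lrow ((- ?a) mod 4) (d + - e) (- e)"
      using False n o by (simp add: lkernel_def)
    moreover have "lwt r (- e) = lwt r e" for r by (simp add: lwt_def)
    ultimately show ?thesis unfolding lrow_odd[OF mod4_cases] el c by (simp add: algebra_simps)
  qed
qed

section \<open>The two sides of Liouville's identity for this kernel\<close>

definition lodd :: "int \<Rightarrow> int \<Rightarrow> int \<Rightarrow> int" where
  "lodd d k e = - (chi4 d * chi3 e * lwt (d * k mod 4) d)"

abbreviation qsum :: "int \<Rightarrow> (int \<Rightarrow> int \<Rightarrow> int \<Rightarrow> int \<Rightarrow> int) \<Rightarrow> int" where
  "qsum N F \<equiv> (\<Sum>(d, k, e, l)\<in>quads N. F d k e l)"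

lemma qsum_filter:
  "(\<Sum>(d, k, e, l) | (d, k, e, l) \<in> quads N \<and> Q d k e l. F d k e l)
   = qsum N (\<lambda>d k e l. if Q d k e l then F d k e l else 0)"
  by (rule sum.mono_neutral_cong_left) (auto split: prod.splits)

lemma qsum_cong:
  "(\<And>d k e l. (d, k, e, l) \<in> quads N \<Longrightarrow> F d k e l = G d k e l) \<Longrightarrow> qsum N F = qsum N G"
  by (rule sum.cong) auto

lemma qsum_swap: "qsum N (\<lambda>d k e l. F d k e l) = qsum N (\<lambda>d k e l. F e l d k)"
  by (rule sum.reindex_bij_witness[of _ "\<lambda>(d, k, e, l). (e, l, d, k)" "\<lambda>(d, k, e, l). (e, l, d, k)"])
     (auto simp: quads_def algebra_simps)

lemma qsum_swap_dk: "qsum N (\<lambda>d k e l. F d k e l) = qsum N (\<lambda>d k e l. F k d e l)"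
  by (rule sum.reindex_bij_witness[of _ "\<lambda>(d, k, e, l). (k, d, e, l)" "\<lambda>(d, k, e, l). (k, d, e, l)"])
     (auto simp: quads_def algebra_simps)

lemma qsum_add: "qsum N (\<lambda>d k e l. F d k e l + G d k e l) = qsum N F + qsum N G"
  by (simp add: sum.distrib case_prod_beta)

lemma qsum_scale: "qsum N (\<lambda>d k e l. c * F d k e l) = c * qsum N F"
  by (simp add: sum_distrib_left case_prod_beta)

text \<open>When 4 divides d, \<open>e * l\<close> is 3 modulo 4, so exchanging e and l reverses
  \<open>chi4 e\<close>; this kills the part of the bracket containing \<open>chi3 d\<close>. In the
  rest d and k are exchanged, which turns the weights into those of the product of the series for
  \<open>chi4\<close> and \<open>chi3\<close>.\<close>

lemma sum_even_bracket:
  assumes N: "N mod 4 = 3"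
  shows "(\<Sum>(d, k, e, l) | (d, k, e, l) \<in> quads N \<and> even d. lkernel d k e - lkernel d k (- e))
     = qsum N (\<lambda>d k e l. if 4 dvd k then chi4 d * chi3 e else 0)
     - 6 * qsum N (\<lambda>d k e l. if 4 dvd k \<and> 3 dvd k then chi4 d * chi3 e else 0)"
proof -
  have eo: "odd e" and el: "chi4 l = - chi4 e" if q: "(d, k, e, l) \<in> quads N" and d: "4 dvd d" for d k e l
  proof -
    obtain c where "d = 4 * c" using d by (rule dvdE)
    hence "4 * (c * k) + e * l = N" using q by (simp add: quads_def mult.assoc)
    moreover have "(4 * a + b) mod 4 = b mod 4" for a b :: int by simp
    ultimately have m: "e * l mod 4 = 3" using N by metis
    have "q mod 4 = 3 \<Longrightarrow> odd q" for q :: int by presburger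
    hence "odd (e * l)" using m by blast
    thus "odd e" by simp
    have "chi4 (e * l) = - 1" using m by (simp add: chi4_def)
    hence "chi4 e * chi4 l = - 1" by (simp only: chi4_mult)
    thus "chi4 l = - chi4 e" unfolding chi4_def by (auto split: if_splits)
  qed
  define K where "K k = (if odd k then 3 else if k mod 4 = 2 then - 6 else (0::int))" for k :: int
  have z: "qsum N (\<lambda>d k e l. if 4 dvd d then chi4 e * chi3 d * K k else 0) = 0"
  proof (rule sum_antisym[of _ "\<lambda>(d, k, e, l). (d, k, l, e)"], goal_cases)
    case (3 p)
    then obtain d k e l where p: "p = (d, k, e, l)" "(d, k, e, l) \<in> quads N" by (cases p) auto
    thus ?case using el[OF p(2)] by simp
  qed (auto simp: quads_def mult.commute)
  have "(\<Sum>(d, k, e, l) | (d, k, e, l) \<in> quads N \<and> even d. lkernel d k e - lkernel d k (- e))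
     = qsum N (\<lambda>d k e l. if even d then lkernel d k e - lkernel d k (- e) else 0)"
    by (rule qsum_filter)
  also have "\<dots> = qsum N (\<lambda>d k e l. (if 4 dvd d then chi4 e * chi3 d * K k else 0)
      + ((if 4 dvd d then chi4 k * chi3 e else 0) + (- 6) * (if 4 dvd d \<and> 3 dvd d then chi4 k * chi3 e else 0)))"
  proof (rule qsum_cong)
    fix d k e l assume q: "(d, k, e, l) \<in> quads N"
    show "(if even d then lkernel d k e - lkernel d k (- e) else 0) = (if 4 dvd d then chi4 e * chi3 d * K k else 0)
      + ((if 4 dvd d then chi4 k * chi3 e else 0) + (- 6) * (if 4 dvd d \<and> 3 dvd d then chi4 k * chi3 e else 0))"
    proof (cases "4 dvd d")
      case True
      hence "even d" by (meson dvd_trans even_numeral)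
      thus ?thesis using lkernel_even_bracket[OF True eo[OF q True], of k] True by (simp add: K_def)
    next
      case False thus ?thesis by (simp add: lkernel_def)
    qed
  qed
  also have "\<dots> = qsum N (\<lambda>d k e l. if 4 dvd d then chi4 k * chi3 e else 0)
     + (- 6) * qsum N (\<lambda>d k e l. if 4 dvd d \<and> 3 dvd d then chi4 k * chi3 e else 0)"
    unfolding qsum_add qsum_scale z by simp
  also have "qsum N (\<lambda>d k e l. if 4 dvd d then chi4 k * chi3 e else 0) = qsum N (\<lambda>d k e l. if 4 dvd k then chi4 d * chi3 e else 0)"
    by (rule qsum_swap_dk)
  also have "qsum N (\<lambda>d k e l. if 4 dvd d \<and> 3 dvd d then chi4 k * chi3 e else 0)
      = qsum N (\<lambda>d k e l. if 4 dvd k \<and> 3 dvd k then chi4 d * chi3 e else 0)"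
    by (rule qsum_swap_dk)
  also have "a + (- 6) * b = a - 6 * b" for a b :: int by simp
  finally show ?thesis .
qed

text \<open>The bracket is \<open>lodd d k e\<close> plus its image under swapping the pairs, so its
  sum is twice that of \<open>lodd\<close>. The terms with 3 dividing d and
  \<open>d * k mod 4 = 1\<close> cancel among themselves: (d, k) and (3k, d/3) have the same
  product, but opposite \<open>chi4\<close> in the first entry. The coefficients 1, -4 and 6 are the
  values of \<open>- lwt\<close>, with -4 + 6 = 2 when 3 divides d.\<close>

lemma sum_odd_bracket:
  assumes N: "N mod 4 = 3"
  shows "(\<Sum>(d, k, e, l) | (d, k, e, l) \<in> quads N \<and> odd d \<and> odd e. lkernel (d + e) k e - lkernel (d - e) k (- e))
     = 2 * qsum N (\<lambda>d k e l. if 4 dvd k then chi4 d * chi3 e else 0)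
     - 8 * qsum N (\<lambda>d k e l. if k mod 4 = 2 then chi4 d * chi3 e else 0)
     + 12 * qsum N (\<lambda>d k e l. if k mod 4 = 2 \<and> 3 dvd d then chi4 d * chi3 e else 0)"
proof -
  let ?z = "\<lambda>d k e l :: int. if odd d \<and> odd e \<and> 3 dvd d \<and> d * k mod 4 = 1 then chi4 d * chi3 e else 0"
  have zero: "qsum N ?z = 0"
  proof -
    let ?A = "{(d, k, e, l). (d, k, e, l) \<in> quads N \<and> (odd d \<and> odd e \<and> 3 dvd d \<and> d * k mod 4 = 1)}"
    have "(\<Sum>(d, k, e, l)\<in>?A. chi4 d * chi3 e) = 0"
    proof (rule sum_antisym[of _ "\<lambda>(d, k, e, l). (3 * k, d div 3, e, l)"], goal_cases)
      case (1 p)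
      then obtain d k e l where p: "p = (d, k, e, l)" "(d, k, e, l) \<in> quads N" "odd d" "odd e" "3 dvd d" "d * k mod 4 = 1"
        by auto
      obtain c where c: "d = 3 * c" using p(5) by (rule dvdE)
      have "q mod 4 = 1 \<Longrightarrow> odd q" for q :: int by presburger
      hence "odd (d * k)" using p(6) by blast
      hence "odd k" by simp
      moreover have "3 * k * c = d * k" using c by simp
      ultimately show ?case using p c by (auto simp: quads_def algebra_simps)
    next
      case (2 p) thus ?case by (cases p) auto
    next
      case (3 p)
      then obtain d k e l where p: "p = (d, k, e, l)" "d * k mod 4 = 1" by auto
      have "chi4 (d * k) = 1" using p(2) by (simp add: chi4_def)
      hence "chi4 d * chi4 k = 1" by (simp only: chi4_mult)
      hence "chi4 k = chi4 d" by (auto simp: zmult_eq_1_iff)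
      moreover have "chi4 (3 * k) = - chi4 k" by (simp add: chi4_mult chi4_def[of 3])
      ultimately show ?case using p by simp
    qed
    thus ?thesis by (simp only: qsum_filter)
  qed
  have v: "(if odd d \<and> odd e then lodd d k e else 0) = ((if 4 dvd k then chi4 d * chi3 e else 0)
     + ((- 4) * (if k mod 4 = 2 then chi4 d * chi3 e else 0)
     + (6 * (if k mod 4 = 2 \<and> 3 dvd d then chi4 d * chi3 e else 0) + (- 3) * ?z d k e l)))"
    if q: "(d, k, e, l) \<in> quads N" for d k e l
  proof (cases "odd d")
    case False thus ?thesis by (simp add: chi4_even)
  next
    case d: True
    have eo: "odd e" if "even k"
    proof -
      have "odd N" using N by presburger
      moreover have "d * k + e * l = N" using q by (simp add: quads_def)
      ultimately have "odd (d * k + e * l)" by simp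
      thus ?thesis using that by simp
    qed
    define r where "r = d * k mod 4"
    have r: "r = ((d mod 4) * (k mod 4)) mod 4" unfolding r_def by (simp add: mod_mult_eq)
    have d4: "d mod 4 = 1 \<or> d mod 4 = 3" using d by presburger
    have "k mod 4 = 0 \<and> r = 0 \<or> k mod 4 = 2 \<and> r = 2 \<or> (k mod 4 = 1 \<or> k mod 4 = 3) \<and> (r = 1 \<or> r = 3)"
      using mod4_cases[of k] d4 unfolding r by (elim disjE) simp_all
    thus ?thesis
    proof (elim disjE conjE)
      assume k: "k mod 4 = 0" "r = 0"
      hence "odd e" "4 dvd k" using eo by presburger+
      thus ?thesis using k d unfolding lodd_def lwt_def r_def[symmetric] by simp
    next
      assume k: "k mod 4 = 2" "r = 2"
      hence "odd e" "\<not> 4 dvd k" using eo by presburger+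
      thus ?thesis using k d unfolding lodd_def lwt_def r_def[symmetric] by simp
    next
      assume k: "k mod 4 = 1" "r = 1"
      hence "\<not> 4 dvd k" by presburger
      thus ?thesis using k d unfolding lodd_def lwt_def r_def[symmetric] by simp
    next
      assume k: "k mod 4 = 1" "r = 3"
      hence "\<not> 4 dvd k" by presburger
      thus ?thesis using k d unfolding lodd_def lwt_def r_def[symmetric] by simp
    next
      assume k: "k mod 4 = 3" "r = 1"
      hence "\<not> 4 dvd k" by presburger
      thus ?thesis using k d unfolding lodd_def lwt_def r_def[symmetric] by simp
    next
      assume k: "k mod 4 = 3" "r = 3"
      hence "\<not> 4 dvd k" by presburger
      thus ?thesis using k d unfolding lodd_def lwt_def r_def[symmetric] by simp
    qed
  qed
  have "(\<Sum>(d, k, e, l) | (d, k, e, l) \<in> quads N \<and> odd d \<and> odd e. lkernel (d + e) k e - lkernel (d - e) k (- e))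
     = qsum N (\<lambda>d k e l. if odd d \<and> odd e then lkernel (d + e) k e - lkernel (d - e) k (- e) else 0)"
    by (rule qsum_filter)
  also have "\<dots> = qsum N (\<lambda>d k e l. (if odd d \<and> odd e then lodd d k e else 0) + (if odd e \<and> odd d then lodd e l d else 0))"
    by (rule qsum_cong) (auto simp: quads_def lkernel_odd_bracket[OF N] lodd_def)
  also have "\<dots> = qsum N (\<lambda>d k e l. if odd d \<and> odd e then lodd d k e else 0) + qsum N (\<lambda>d k e l. if odd e \<and> odd d then lodd e l d else 0)"
    by (rule qsum_add)
  also have "qsum N (\<lambda>d k e l. if odd e \<and> odd d then lodd e l d else 0) = qsum N (\<lambda>d k e l. if odd d \<and> odd e then lodd d k e else 0)"
    by (rule qsum_swap)
  finally have e1: "(\<Sum>(d, k, e, l) | (d, k, e, l) \<in> quads N \<and> odd d \<and> odd e. lkernel (d + e) k e - lkernel (d - e) k (- e))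
     = qsum N (\<lambda>d k e l. if odd d \<and> odd e then lodd d k e else 0) + qsum N (\<lambda>d k e l. if odd d \<and> odd e then lodd d k e else 0)" .
  have "qsum N (\<lambda>d k e l. if odd d \<and> odd e then lodd d k e else 0)
     = qsum N (\<lambda>d k e l. (if 4 dvd k then chi4 d * chi3 e else 0)
     + ((- 4) * (if k mod 4 = 2 then chi4 d * chi3 e else 0)
     + (6 * (if k mod 4 = 2 \<and> 3 dvd d then chi4 d * chi3 e else 0) + (- 3) * ?z d k e l)))"
    by (rule qsum_cong) (rule v)
  also have "\<dots> = qsum N (\<lambda>d k e l. if 4 dvd k then chi4 d * chi3 e else 0)
     + ((- 4) * qsum N (\<lambda>d k e l. if k mod 4 = 2 then chi4 d * chi3 e else 0)
     + 6 * qsum N (\<lambda>d k e l. if k mod 4 = 2 \<and> 3 dvd d then chi4 d * chi3 e else 0))"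
    unfolding qsum_add qsum_scale zero by simp
  finally have e2: "qsum N (\<lambda>d k e l. if odd d \<and> odd e then lodd d k e else 0)
     = qsum N (\<lambda>d k e l. if 4 dvd k then chi4 d * chi3 e else 0)
     + ((- 4) * qsum N (\<lambda>d k e l. if k mod 4 = 2 then chi4 d * chi3 e else 0)
     + 6 * qsum N (\<lambda>d k e l. if k mod 4 = 2 \<and> 3 dvd d then chi4 d * chi3 e else 0))" .
  have "x + ((- 4) * y + 6 * z) + (x + ((- 4) * y + 6 * z)) = 2 * x - 8 * y + 12 * z" for x y z :: int
    by simp
  thus ?thesis unfolding e1 e2 .
qed

section \<open>Boundary terms: sums of functions of period 4\<close>

lemma periodic4:
  fixes f :: "int \<Rightarrow> int"
  assumes f: "\<And>k. f (k + 4) = f k" and "i \<ge> 0"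
  shows "f (k + 4 * i) = f k"
  using assms(2)
proof (induction i rule: int_ge_induct)
  case (step i)
  have "f (k + 4 * (i + 1)) = f (k + 4 * i + 4)" by (simp add: algebra_simps)
  thus ?case using step f by simp
qed simp

lemma sum_periodic4:
  fixes f :: "int \<Rightarrow> int" and j :: int
  assumes "\<And>k. f (k + 4) = f k" "j \<ge> 0"
  shows "(\<Sum>k\<in>{1..4 * j}. f k) = j * (f 0 + f 1 + f 2 + f 3)"
  using assms(2)
proof (induction j rule: int_ge_induct)
  case base thus ?case by simp
next
  case (step i)
  have p: "f (k + 4 * i) = f k" for k by (rule periodic4[of f, OF assms(1) step(1)])
  have "{1..4 * (i + 1)} = {1..4 * i} \<union> {1 + 4 * i, 2 + 4 * i, 3 + 4 * i, 0 + 4 * (i + 1)}"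
    using step(1) by auto
  moreover have "{1..4 * i} \<inter> {1 + 4 * i, 2 + 4 * i, 3 + 4 * i, 0 + 4 * (i + 1)} = {}" by auto
  ultimately have "(\<Sum>k\<in>{1..4 * (i + 1)}. f k) = (\<Sum>k\<in>{1..4 * i}. f k) + (\<Sum>k\<in>{1 + 4 * i, 2 + 4 * i, 3 + 4 * i, 0 + 4 * (i + 1)}. f k)"
    by (simp add: sum.union_disjoint)
  also have "(\<Sum>k\<in>{1 + 4 * i, 2 + 4 * i, 3 + 4 * i, 0 + 4 * (i + 1)}. f k) = f 1 + (f 2 + (f 3 + f 0))"
  proof -
    have "f (0 + 4 * (i + 1)) = f 0" using p[of 4] assms(1)[of 0] by (simp add: algebra_simps)
    thus ?thesis using p[of 1] p[of 2] p[of 3] by simp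
  qed
  finally show ?case using step by (simp add: algebra_simps)
qed

lemma sum_periodic4_odd:
  fixes f :: "int \<Rightarrow> int" and m :: int
  assumes f: "\<And>k. f (k + 4) = f k" and m: "m > 0" "odd m"
  shows "(\<Sum>k\<in>{1..<m}. f k) = (m div 4) * (f 0 + f 1 + f 2 + f 3) + (if m mod 4 = 1 then 0 else f 1 + f 2)"
proof -
  define j where "j = m div 4"
  have j: "j \<ge> 0" using m by (simp add: j_def)
  have p: "f (k + 4 * j) = f k" for k by (rule periodic4[of f, OF f j])
  show ?thesis
  proof (cases "m mod 4 = 1")
    case True
    hence "m = 4 * j + 1" unfolding j_def by presburger
    hence "{1..<m} = {1..4 * j}" by auto
    thus ?thesis using sum_periodic4[of f, OF f j] True by (simp add: j_def)
  next
    case False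
    hence "m mod 4 = 3" using m by presburger
    hence "m = 4 * j + 3" unfolding j_def by presburger
    hence "{1..<m} = {1..4 * j} \<union> {1 + 4 * j, 2 + 4 * j}" using j by auto
    moreover have "{1..4 * j} \<inter> {1 + 4 * j, 2 + 4 * j} = {}" by auto
    ultimately have "(\<Sum>k\<in>{1..<m}. f k) = (\<Sum>k\<in>{1..4 * j}. f k) + (\<Sum>k\<in>{1 + 4 * j, 2 + 4 * j}. f k)"
      by (simp add: sum.union_disjoint)
    thus ?thesis using sum_periodic4[of f, OF f j] False p[of 1] p[of 2] by (simp add: j_def)
  qed
qed

lemma dpairs_chi4:
  assumes N: "N mod 4 = 3" and "(d, m) \<in> dpairs N"
  shows "odd d" "odd m" "d > 0" "m > 0" "chi4 m = - chi4 d"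
proof -
  have p: "d > 0" "m > 0" "d * m = N" using assms(2) by (auto simp: dpairs_def)
  thus "d > 0" "m > 0" by auto
  have "odd N" using N by presburger
  hence "odd (d * m)" using p by simp
  thus "odd d" "odd m" by simp_all
  have "chi4 (d * m) = - 1" using p N by (simp add: chi4_def)
  hence "chi4 d * chi4 m = - 1" by (simp only: chi4_mult)
  thus "chi4 m = - chi4 d" unfolding chi4_def by (auto split: if_splits)
qed

text \<open>With d = e the equation becomes d(k + l) = N, so k runs through 1, ..., m - 1 for m = k
  + l. Up to the factor \<open>chi4 d * chi3 d\<close> the kernel takes the values -1, -1, 4, 4 in
  rows 0 to 3. Their mean 3/2 gives \<open>3 * m\<close> after doubling, and the incomplete last
  period gives the rest.\<close>

lemma boundary_diagonal:
  assumes N: "N mod 4 = 3"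
  shows "2 * (\<Sum>(d, k, e, l) | (d, k, e, l) \<in> quads N \<and> odd d \<and> odd e \<and> d = e. lkernel 0 k (- e))
    = (\<Sum>(d, m)\<in>dpairs N. chi4 d * chi3 d * (3 * m + 2 + 5 * chi4 d))"
proof -
  let ?S = "Sigma (dpairs N) (\<lambda>(d, m). {1..<m})"
  have "(\<Sum>(d, k, e, l) | (d, k, e, l) \<in> quads N \<and> odd d \<and> odd e \<and> d = e. lkernel 0 k (- e))
      = (\<Sum>(p, k)\<in>?S. case p of (d, m) \<Rightarrow> lkernel 0 k (- d))"
  proof (rule sum.reindex_bij_witness[of _ "\<lambda>((d, m), k). (d, k, d, m - k)" "\<lambda>(d, k, e, l). ((d, k + l), k)"], goal_cases)
    case (4 p)
    then obtain d m k where p: "p = ((d, m), k)" "(d, m) \<in> dpairs N" "1 \<le> k" "k < m" by auto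
    thus ?case using dpairs_chi4(1)[OF N p(2)] by (auto simp: quads_def dpairs_def algebra_simps)
  qed (auto simp: quads_def dpairs_def algebra_simps)
  also have "\<dots> = (\<Sum>p\<in>dpairs N. \<Sum>k\<in>(case p of (d, m) \<Rightarrow> {1..<m}). case p of (d, m) \<Rightarrow> lkernel 0 k (- d))"
    by (rule sum.Sigma[symmetric]) auto
  finally have "2 * (\<Sum>(d, k, e, l) | (d, k, e, l) \<in> quads N \<and> odd d \<and> odd e \<and> d = e. lkernel 0 k (- e))
     = (\<Sum>p\<in>dpairs N. 2 * (\<Sum>k\<in>(case p of (d, m) \<Rightarrow> {1..<m}). case p of (d, m) \<Rightarrow> lkernel 0 k (- d)))"
    by (simp only: sum_distrib_left)
  also have "\<dots> = (\<Sum>(d, m)\<in>dpairs N. chi4 d * chi3 d * (3 * m + 2 + 5 * chi4 d))"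
  proof (rule sum.cong)
    fix p assume "p \<in> dpairs N"
    then obtain d m where p: "p = (d, m)" "(d, m) \<in> dpairs N" by (cases p) auto
    note dm = dpairs_chi4[OF N p(2)]
    define f where "f k = (if k * - d mod 4 = 0 \<or> k * - d mod 4 = 1 then - 1 else (4::int))" for k
    have f4: "f (k + 4) = f k" for k
    proof -
      have "(k + 4) * - d = k * - d + 4 * (- d)" by (simp add: algebra_simps)
      hence "(k + 4) * - d mod 4 = k * - d mod 4" by (metis mod_mult_self2)
      thus ?thesis by (simp only: f_def)
    qed
    have g: "lkernel 0 k (- d) = chi4 d * chi3 d * f k" for k
      using mod4_cases[of "k * - d"] dm(1)
      unfolding lkernel_def lrow_def chi3z_def f_def
      by (elim disjE) (simp_all add: chi3_def[of 0])
    have "2 * (\<Sum>k\<in>{1..<m}. f k) = 3 * m + 2 + 5 * chi4 d"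
    proof -
      have "d mod 4 = 1 \<and> m mod 4 = 3 \<or> d mod 4 = 3 \<and> m mod 4 = 1"
        using dm odd_mod4[of d] odd_mod4[of m] by (auto simp: chi4_def)
      thus ?thesis
      proof (elim disjE conjE)
        assume a: "d mod 4 = 1" "m mod 4 = 3"
        have "(- d) mod 4 = 3" "2 * - d mod 4 = 2" "3 * - d mod 4 = 1" using a(1) by presburger+
        hence "f 0 = - 1" "f 1 = 4" "f 2 = 4" "f 3 = - 1" by (simp_all add: f_def)
        hence "(\<Sum>k\<in>{1..<m}. f k) = 6 * (m div 4) + 8" using sum_periodic4_odd[of f, OF f4 dm(4,2)] a by simp
        moreover have "m = 4 * (m div 4) + 3" using a(2) by presburger
        moreover have "chi4 d = 1" using a(1) by (simp add: chi4_def)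
        ultimately show ?thesis by linarith
      next
        assume a: "d mod 4 = 3" "m mod 4 = 1"
        have "(- d) mod 4 = 1" "2 * - d mod 4 = 2" "3 * - d mod 4 = 3" using a(1) by presburger+
        hence "f 0 = - 1" "f 1 = - 1" "f 2 = 4" "f 3 = 4" by (simp_all add: f_def)
        hence "(\<Sum>k\<in>{1..<m}. f k) = 6 * (m div 4)" using sum_periodic4_odd[of f, OF f4 dm(4,2)] a by simp
        moreover have "m = 4 * (m div 4) + 1" using a(2) by presburger
        moreover have "chi4 d = - 1" using a(1) by (simp add: chi4_def)
        ultimately show ?thesis by linarith
      qed
    qed
    hence "2 * (\<Sum>k\<in>{1..<m}. lkernel 0 k (- d)) = chi4 d * chi3 d * (3 * m + 2 + 5 * chi4 d)"
      unfolding g sum_distrib_left[symmetric] by (metis mult.left_commute)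
    thus "2 * (\<Sum>k\<in>(case p of (d, m) \<Rightarrow> {1..<m}). case p of (d, m) \<Rightarrow> lkernel 0 k (- d))
      = (case p of (d, m) \<Rightarrow> chi4 d * chi3 d * (3 * m + 2 + 5 * chi4 d))" using p by simp
  qed simp
  finally show ?thesis .
qed

text \<open>With k = l the equation becomes (d + e)k = N. Only d divisible by 4 contribute, always
  through row 1 and with the same value, so the sum counts the multiples of 4 below m = d + e. Four
  times that number is \<open>m - 2 + chi4 m\<close>.\<close>

lemma boundary_codiagonal:
  assumes N: "N mod 4 = 3"
  shows "4 * (\<Sum>(d, k, e, l) | (d, k, e, l) \<in> quads N \<and> even d \<and> k = l. lkernel d k (- e))
    = - (\<Sum>(m, k)\<in>dpairs N. chi4 m * chi3 m * (m - 2 + chi4 m))"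
proof -
  let ?S = "Sigma (dpairs N) (\<lambda>(m, k). {1..<m})"
  have g0: "even d" if "lkernel d k e \<noteq> 0" for d k e
  proof -
    have "4 dvd d" using that unfolding lkernel_def by presburger
    thus ?thesis by presburger
  qed
  have "(\<Sum>(d, k, e, l) | (d, k, e, l) \<in> quads N \<and> even d \<and> k = l. lkernel d k (- e))
      = (\<Sum>(d, k, e, l) | (d, k, e, l) \<in> quads N \<and> k = l. lkernel d k (- e))"
    by (rule sum.mono_neutral_left) (auto dest: g0)
  also have "\<dots> = (\<Sum>(p, d)\<in>?S. case p of (m, k) \<Rightarrow> lkernel d k (- (m - d)))"
  proof (rule sum.reindex_bij_witness[of _ "\<lambda>((m, k), d). (d, k, m - d, k)" "\<lambda>(d, k, e, l). ((d + e, k), d)"], goal_cases)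
  qed (auto simp: quads_def dpairs_def algebra_simps)
  also have "\<dots> = (\<Sum>p\<in>dpairs N. \<Sum>d\<in>(case p of (m, k) \<Rightarrow> {1..<m}). case p of (m, k) \<Rightarrow> lkernel d k (- (m - d)))"
    by (rule sum.Sigma[symmetric]) auto
  finally have "4 * (\<Sum>(d, k, e, l) | (d, k, e, l) \<in> quads N \<and> even d \<and> k = l. lkernel d k (- e))
      = (\<Sum>p\<in>dpairs N. 4 * (\<Sum>d\<in>(case p of (m, k) \<Rightarrow> {1..<m}). case p of (m, k) \<Rightarrow> lkernel d k (- (m - d))))"
    by (simp only: sum_distrib_left)
  also have "\<dots> = (\<Sum>(m, k)\<in>dpairs N. - (chi4 m * chi3 m * (m - 2 + chi4 m)))"
  proof (rule sum.cong)
    fix p assume "p \<in> dpairs N"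
    then obtain m k where p: "p = (m, k)" "(m, k) \<in> dpairs N" by (cases p) auto
    note mk = dpairs_chi4[OF N p(2)]
    define f where "f d = (if 4 dvd d then 1 else (0::int))" for d :: int
    have f4: "f (d + 4) = f d" for d
    proof -
      have "4 dvd d + 4 \<longleftrightarrow> 4 dvd d" by presburger
      thus ?thesis by (simp only: f_def)
    qed
    have g: "lkernel d k (- (m - d)) = - (chi4 m * chi3 m) * f d" for d
    proof (cases "4 dvd d")
      case True
      then obtain c where c: "d = 4 * c" by (rule dvdE)
      have o: "odd (- (m - d))" using mk(1) c by simp
      have "k * - (m - d) = 4 * (k * c) - N" using p(2) unfolding c by (simp add: dpairs_def algebra_simps)
      moreover have "(4 * a - N) mod 4 = 1" for a using N by presburger
      ultimately have r: "k * - (m - d) mod 4 = 1" by simp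
      have "chi4 (- (m - d)) = chi4 (- m)" unfolding c by (rule chi4_cong) presburger
      hence c4: "chi4 (- (m - d)) = - chi4 m" by simp
      have "d - - (m - d) = m" by simp
      thus ?thesis using True o unfolding lkernel_def r c4 lrow_def by (simp add: f_def)
    next
      case False thus ?thesis by (simp add: lkernel_def f_def)
    qed
    have "4 * (\<Sum>d\<in>{1..<m}. f d) = m - 2 + chi4 m"
    proof -
      have s: "(\<Sum>d\<in>{1..<m}. f d) = m div 4" using sum_periodic4_odd[of f, OF f4 mk(3,1)] by (simp add: f_def)
      have "m mod 4 = 1 \<or> m mod 4 = 3" using mk(1) by presburger
      thus ?thesis
      proof
        assume a: "m mod 4 = 1"
        moreover have "m = 4 * (m div 4) + 1" using a by presburger
        ultimately show ?thesis unfolding s by (simp add: chi4_def)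
      next
        assume a: "m mod 4 = 3"
        moreover have "m = 4 * (m div 4) + 3" using a by presburger
        ultimately show ?thesis unfolding s by (simp add: chi4_def)
      qed
    qed
    hence "4 * (\<Sum>d\<in>{1..<m}. lkernel d k (- (m - d))) = - (chi4 m * chi3 m) * (m - 2 + chi4 m)"
      unfolding g sum_distrib_left[symmetric] by (metis mult.left_commute)
    thus "4 * (\<Sum>d\<in>(case p of (m, k) \<Rightarrow> {1..<m}). case p of (m, k) \<Rightarrow> lkernel d k (- (m - d)))
      = (case p of (m, k) \<Rightarrow> - (chi4 m * chi3 m * (m - 2 + chi4 m)))" using p by simp
  qed simp
  finally show ?thesis by (simp add: sum_negf case_prod_beta)
qed

text \<open>The sum over all k divisible by 4 has coefficient 2 on both sides of Liouville's
  identity and drops out. In the boundary terms the constants 2 and -2 cancel, and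
  \<open>6 * chi4 d\<close> squares away to \<open>6 * lam3 N\<close>, which is later matched by the
  representations with x = y = 0 in \<open>reps3_even\<close>.\<close>

lemma lambert_product_identity:
  assumes N: "N mod 4 = 3"
  shows "2 * (8 * qsum N (\<lambda>d k e l. if k mod 4 = 2 then chi4 d * chi3 e else 0)
      - 12 * qsum N (\<lambda>d k e l. if k mod 4 = 2 \<and> 3 dvd d then chi4 d * chi3 e else 0)
      - 12 * qsum N (\<lambda>d k e l. if 4 dvd k \<and> 3 dvd k then chi4 d * chi3 e else 0))
    = (\<Sum>(d, m)\<in>dpairs N. chi4 d * chi3 d * (3 * m + d)) + 6 * lam3 N"
proof -
  let ?b1 = "\<Sum>(d, k, e, l) | (d, k, e, l) \<in> quads N \<and> odd d \<and> odd e \<and> d = e. lkernel 0 k (- e)"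
  let ?b2 = "\<Sum>(d, k, e, l) | (d, k, e, l) \<in> quads N \<and> even d \<and> k = l. lkernel d k (- e)"
  have o: "odd N" using N by presburger
  have "2 * (\<Sum>(d, k, e, l) | (d, k, e, l) \<in> quads N \<and> even d. lkernel d k e - lkernel d k (- e))
     = (\<Sum>(d, k, e, l) | (d, k, e, l) \<in> quads N \<and> odd d \<and> odd e. lkernel (d + e) k e - lkernel (d - e) k (- e)) + ?b1 - 2 * ?b2"
    by (rule liouville_identity[OF o]) (use lkernel_even lkernel_tau[OF N] in auto)
  note L = this[unfolded sum_even_bracket[OF N] sum_odd_bracket[OF N]]
  have arith: "2 * (8 * x - 12 * y - 12 * z) = 2 * b1 - 4 * b2"
    if "2 * (w - 6 * z) = 2 * w - 8 * x + 12 * y + b1 - 2 * b2" for x y z w b1 b2 :: int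
    using that by (simp add: algebra_simps)
  have "2 * (8 * qsum N (\<lambda>d k e l. if k mod 4 = 2 then chi4 d * chi3 e else 0)
      - 12 * qsum N (\<lambda>d k e l. if k mod 4 = 2 \<and> 3 dvd d then chi4 d * chi3 e else 0)
      - 12 * qsum N (\<lambda>d k e l. if 4 dvd k \<and> 3 dvd k then chi4 d * chi3 e else 0)) = 2 * ?b1 - 4 * ?b2"
    by (rule arith[OF L])
  also have "\<dots> = (\<Sum>(d, m)\<in>dpairs N. chi4 d * chi3 d * (3 * m + 2 + 5 * chi4 d))
     + (\<Sum>(d, m)\<in>dpairs N. chi4 d * chi3 d * (d - 2 + chi4 d))"
    unfolding boundary_diagonal[OF N] boundary_codiagonal[OF N] diff_minus_eq_add by (rule refl)
  also have "\<dots> = (\<Sum>(d, m)\<in>dpairs N. chi4 d * chi3 d * (3 * m + d)) + (\<Sum>(d, m)\<in>dpairs N. 6 * chi3 d)"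
    unfolding sum.distrib[symmetric]
  proof (rule sum.cong)
    fix p assume "p \<in> dpairs N"
    then obtain d m where p: "p = (d, m)" "(d, m) \<in> dpairs N" by (cases p) auto
    have c: "chi4 d * chi4 d = 1" by (rule chi4_odd_square) (rule dpairs_chi4(1)[OF N p(2)])
    have "chi4 d * chi3 d * (3 * m + 2 + 5 * chi4 d) + chi4 d * chi3 d * (d - 2 + chi4 d)
      = chi4 d * chi3 d * (3 * m + d) + 6 * ((chi4 d * chi4 d) * chi3 d)" by (simp add: algebra_simps)
    thus "(case p of (d, m) \<Rightarrow> chi4 d * chi3 d * (3 * m + 2 + 5 * chi4 d)) + (case p of (d, m) \<Rightarrow> chi4 d * chi3 d * (d - 2 + chi4 d))
      = (case p of (d, m) \<Rightarrow> chi4 d * chi3 d * (3 * m + d)) + (case p of (d, m) \<Rightarrow> 6 * chi3 d)"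
      using p c by simp
  qed simp
  also have "(\<Sum>(d, m)\<in>dpairs N. 6 * chi3 d) = 6 * lam3 N"
    by (simp add: lam3_def sum_distrib_left case_prod_beta)
  finally show ?thesis .
qed

section \<open>From divisor sums to quaternary forms\<close>

lemma lambert_conv:
  fixes m N :: int
  assumes m: "m \<ge> 1"
  shows "(\<Sum>((d, k), (e, l)) | (d > 0 \<and> k > 0 \<and> Q d k) \<and> (e > 0 \<and> l > 0) \<and> m * (d * k) + e * l = N. chi4 d * chi3 e)
    = (\<Sum>c\<in>{0..N}. (\<Sum>(d, k) | (d, k) \<in> dpairs c \<and> Q d k. chi4 d) * lam3 (N - m * c))"
proof -
  let ?P = "\<lambda>(d, k). d > 0 \<and> k > 0 \<and> Q d k" and ?R = "\<lambda>(e::int, l::int). e > 0 \<and> l > 0"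
  let ?f = "\<lambda>(d, k). d * k :: int"
  have f1: "{p. ?P p \<and> ?f p = c} = {(d, k). (d, k) \<in> dpairs c \<and> Q d k}" for c by (auto simp: dpairs_def)
  have f2: "{q. ?R q \<and> ?f q = c} = dpairs c" for c by (auto simp: dpairs_def)
  have "(\<Sum>(p, q)\<in>{(p, q). ?P p \<and> ?R q \<and> m * ?f p + ?f q = N}. chi4 (fst p) * chi3 (fst q))
    = (\<Sum>c\<in>{0..N}. (\<Sum>p | ?P p \<and> ?f p = c. chi4 (fst p)) * (\<Sum>q | ?R q \<and> ?f q = N - m * c. chi3 (fst q)))"
  proof (rule sum_conv)
    show "finite {p. ?P p \<and> ?f p = c}" for c unfolding f1 by (rule finite_subset[OF _ finite_dpairs[of c]]) auto
    show "finite {q. ?R q \<and> ?f q = c}" for c unfolding f2 by simp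
  qed (use m in auto)
  moreover have s: "{((d, k), (e, l)). (d > 0 \<and> k > 0 \<and> Q d k) \<and> (e > 0 \<and> l > 0) \<and> m * (d * k) + e * l = N}
     = {(p, q). ?P p \<and> ?R q \<and> m * ?f p + ?f q = N}" by auto
  ultimately show ?thesis unfolding s f1 f2 lam3_def by (simp add: case_prod_beta)
qed

text \<open>Even d have weight 0. If for odd d the condition on k amounts to a condition
  \<open>R\<close> on \<open>c = d * k\<close> alone, it can be taken out of the divisor
  sum.\<close>

lemma lam4_restrict:
  assumes a: "\<And>d k. (d, k) \<in> dpairs c \<Longrightarrow> odd d \<Longrightarrow> R \<longleftrightarrow> Q k"
  shows "(\<Sum>(d, k) | (d, k) \<in> dpairs c \<and> Q k. chi4 d) = (if R then lam4 c else 0)"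
proof (cases R)
  case True
  have "lam4 c = (\<Sum>(d, k) | (d, k) \<in> dpairs c \<and> Q k. chi4 d)"
    unfolding lam4_def
  proof (rule sum.mono_neutral_right)
    show "\<forall>p\<in>dpairs c - {(d, k). (d, k) \<in> dpairs c \<and> Q k}. (case p of (d, k) \<Rightarrow> chi4 d) = 0"
      using a True chi4_even by fastforce
  qed auto
  thus ?thesis using True by simp
next
  case False
  have "(\<Sum>(d, k) | (d, k) \<in> dpairs c \<and> Q k. chi4 d) = 0"
    by (rule sum.neutral) (use a False chi4_even in fastforce)
  thus ?thesis using False by simp
qed

lemma lam4_k2:
  "(\<Sum>(d, k) | (d, k) \<in> dpairs c \<and> k mod 4 = 2. chi4 d) = (if c mod 4 = 2 then lam4 c else 0)"
proof (rule lam4_restrict)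
  fix d k assume dk: "(d, k) \<in> dpairs c" "odd d"
  have "c = d * k" using dk(1) by (simp add: dpairs_def)
  moreover have "d * k mod 4 = ((d mod 4) * (k mod 4)) mod 4" by (simp add: mod_mult_eq)
  ultimately have c: "c mod 4 = ((d mod 4) * (k mod 4)) mod 4" by simp
  show "c mod 4 = 2 \<longleftrightarrow> k mod 4 = 2"
    unfolding c using odd_mod4[OF dk(2)] mod4_cases[of k] by (elim disjE) simp_all
qed

lemma lam4_k0:
  "(\<Sum>(d, k) | (d, k) \<in> dpairs c \<and> 4 dvd k. chi4 d) = (if 4 dvd c then lam4 c else 0)"
proof (rule lam4_restrict)
  fix d k assume dk: "(d, k) \<in> dpairs c" "odd d"
  have "coprime (2 ^ 2) d" using dk(2) by (subst coprime_power_left_iff) auto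
  hence "coprime 4 d" by simp
  moreover have "c = d * k" using dk(1) by (simp add: dpairs_def)
  ultimately show "4 dvd c \<longleftrightarrow> 4 dvd k" by (simp add: coprime_dvd_mult_right_iff)
qed

lemma qsum_X0:
  "qsum N (\<lambda>d k e l. if k mod 4 = 2 then chi4 d * chi3 e else 0)
   = (\<Sum>c\<in>{0..N}. (if c mod 4 = 2 then lam4 c else 0) * lam3 (N - c))"
proof -
  have "qsum N (\<lambda>d k e l. if k mod 4 = 2 then chi4 d * chi3 e else 0)
     = (\<Sum>(d, k, e, l) | (d, k, e, l) \<in> quads N \<and> k mod 4 = 2. chi4 d * chi3 e)"
    by (rule qsum_filter[symmetric])
  also have "\<dots> = (\<Sum>((d, k), (e, l)) | (d > 0 \<and> k > 0 \<and> k mod 4 = 2) \<and> (e > 0 \<and> l > 0) \<and> 1 * (d * k) + e * l = N. chi4 d * chi3 e)"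
    by (rule sum.reindex_bij_witness[of _ "\<lambda>((d, k), (e, l)). (d, k, e, l)" "\<lambda>(d, k, e, l). ((d, k), (e, l))"])
       (auto simp: quads_def)
  also have "\<dots> = (\<Sum>c\<in>{0..N}. (\<Sum>(d, k) | (d, k) \<in> dpairs c \<and> k mod 4 = 2. chi4 d) * lam3 (N - 1 * c))"
    by (rule lambert_conv) simp
  finally show ?thesis by (simp only: lam4_k2 mult_1)
qed

text \<open>Writing d = 3d' moves the 3 in front of the first product; \<open>chi4 3 = - 1\<close>
  causes the minus sign. In \<open>qsum_XB\<close> the 3 is taken out of k, which carries no
  character, and the sign stays.\<close>

lemma qsum_XA:
  "qsum N (\<lambda>d k e l. if k mod 4 = 2 \<and> 3 dvd d then chi4 d * chi3 e else 0)
   = - (\<Sum>c\<in>{0..N}. (if c mod 4 = 2 then lam4 c else 0) * lam3 (N - 3 * c))"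
proof -
  have "qsum N (\<lambda>d k e l. if k mod 4 = 2 \<and> 3 dvd d then chi4 d * chi3 e else 0)
     = (\<Sum>(d, k, e, l) | (d, k, e, l) \<in> quads N \<and> k mod 4 = 2 \<and> 3 dvd d. chi4 d * chi3 e)"
    by (rule qsum_filter[symmetric])
  also have "\<dots> = (\<Sum>((d, k), (e, l)) | (d > 0 \<and> k > 0 \<and> k mod 4 = 2) \<and> (e > 0 \<and> l > 0) \<and> 3 * (d * k) + e * l = N. - (chi4 d * chi3 e))"
  proof (rule sum.reindex_bij_witness[of _ "\<lambda>((d, k), (e, l)). (3 * d, k, e, l)" "\<lambda>(d, k, e, l). ((d div 3, k), (e, l))"], goal_cases)
    case (5 p)
    then obtain d k e l where p: "p = (d, k, e, l)" "3 dvd d" by auto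
    then obtain c where c: "d = 3 * c" by (auto elim: dvdE)
    have "chi4 (3 * c) = - chi4 c" by (simp add: chi4_mult chi4_def[of 3])
    thus ?case using p c by simp
  qed (auto simp: quads_def)
  also have "\<dots> = - (\<Sum>((d, k), (e, l)) | (d > 0 \<and> k > 0 \<and> k mod 4 = 2) \<and> (e > 0 \<and> l > 0) \<and> 3 * (d * k) + e * l = N. chi4 d * chi3 e)"
    unfolding sum_negf[symmetric] by (rule sum.cong) auto
  also have "\<dots> = - (\<Sum>c\<in>{0..N}. (\<Sum>(d, k) | (d, k) \<in> dpairs c \<and> k mod 4 = 2. chi4 d) * lam3 (N - 3 * c))"
    by (subst lambert_conv) simp_all
  finally show ?thesis by (simp only: lam4_k2)
qed

lemma qsum_XB:
  "qsum N (\<lambda>d k e l. if 4 dvd k \<and> 3 dvd k then chi4 d * chi3 e else 0)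
   = (\<Sum>c\<in>{0..N}. (if 4 dvd c then lam4 c else 0) * lam3 (N - 3 * c))"
proof -
  have "qsum N (\<lambda>d k e l. if 4 dvd k \<and> 3 dvd k then chi4 d * chi3 e else 0)
     = (\<Sum>(d, k, e, l) | (d, k, e, l) \<in> quads N \<and> 4 dvd k \<and> 3 dvd k. chi4 d * chi3 e)"
    by (rule qsum_filter[symmetric])
  also have "\<dots> = (\<Sum>((d, k), (e, l)) | (d > 0 \<and> k > 0 \<and> 4 dvd k) \<and> (e > 0 \<and> l > 0) \<and> 3 * (d * k) + e * l = N. chi4 d * chi3 e)"
  proof (rule sum.reindex_bij_witness[of _ "\<lambda>((d, k), (e, l)). (d, 3 * k, e, l)" "\<lambda>(d, k, e, l). ((d, k div 3), (e, l))"], goal_cases)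
    case (2 p)
    then obtain d k e l where p: "p = (d, k, e, l)" "(d, k, e, l) \<in> quads N" "3 dvd k" "4 dvd k" by auto
    obtain c where c: "k = 3 * c" using p(3) by (rule dvdE)
    have "4 dvd c" using p(4) unfolding c by presburger
    thus ?case using p c by (auto simp: quads_def)
  qed (auto simp: quads_def)
  also have "\<dots> = (\<Sum>c\<in>{0..N}. (\<Sum>(d, k) | (d, k) \<in> dpairs c \<and> 4 dvd k. chi4 d) * lam3 (N - 3 * c))"
    by (rule lambert_conv) simp
  finally show ?thesis by (simp only: lam4_k0)
qed

section \<open>Lattice point counts as convolutions\<close>

lemma card_theta_conv:
  fixes m N :: int
  assumes m: "m \<ge> 1"
  shows "int (card {((x, y), (z, v)). Q x y \<and> m * (x^2 + y^2) + (z^2 + 3 * v^2) = N})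
    = (\<Sum>c\<in>{0..N}. int (card {(x, y). Q x y \<and> x^2 + y^2 = c}) * r13 (N - m * c))"
proof -
  let ?P = "\<lambda>(x, y). Q x y" and ?f = "\<lambda>(x, y). x^2 + y^2 :: int" and ?g = "\<lambda>(z, v). z^2 + 3 * v^2 :: int"
  have f1: "{p. ?P p \<and> ?f p = c} = {(x, y). Q x y \<and> x^2 + y^2 = c}" for c by auto
  have f2: "{q. True \<and> ?g q = c} = {(z, v). z^2 + 3 * v^2 = c}" for c by auto
  have s: "{((x, y), (z, v)). Q x y \<and> m * (x^2 + y^2) + (z^2 + 3 * v^2) = N}
     = {(p, q). ?P p \<and> True \<and> m * ?f p + ?g q = N}" by auto
  have "(\<Sum>(p, q)\<in>{(p, q). ?P p \<and> True \<and> m * ?f p + ?g q = N}. 1 * 1 :: int)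
    = (\<Sum>c\<in>{0..N}. (\<Sum>p | ?P p \<and> ?f p = c. 1) * (\<Sum>q | True \<and> ?g q = N - m * c. 1))"
  proof (rule sum_conv)
    show "finite {p. ?P p \<and> ?f p = c}" for c unfolding f1 by (rule finite_subset[OF _ finite_r2[of c]]) auto
    show "finite {q. True \<and> ?g q = c}" for c unfolding f2 by (rule finite_r13)
  qed (use m in auto)
  thus ?thesis unfolding f1 f2 s r13_def by (simp add: case_prod_beta)
qed

lemma card_odd_squares:
  "int (card {(x::int, y::int). (odd x \<and> odd y) \<and> x^2 + y^2 = c}) = (if c mod 4 = 2 then 4 * lam4 c else 0)"
proof -
  have "(odd x \<and> odd y) \<longleftrightarrow> (x^2 + y^2) mod 4 = 2" for x y :: int
    using square_mod4[of x] square_mod4[of y] by (cases "even x"; cases "even y") (simp_all, presburger+)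
  hence s: "{(x::int, y::int). (odd x \<and> odd y) \<and> x^2 + y^2 = c} = (if c mod 4 = 2 then {(x, y). x^2 + y^2 = c} else {})"
    by auto
  show ?thesis
  proof (cases "c mod 4 = 2")
    case True
    have "r2 c = 4 * lam4 c"
    proof (cases "c > 0")
      case False
      hence "c < 0" using True by (cases "c = 0") auto
      thus ?thesis by (simp add: r2_neg lam4_def lam_neg)
    qed (rule r2_eq)
    thus ?thesis unfolding s using True by (simp add: r2_def)
  next
    case False thus ?thesis unfolding s by simp
  qed
qed

text \<open>The extra summand reflects \<open>r2 0 = 1\<close>, whereas \<open>lam4 0 = 0\<close>
  because 0 has no divisor pairs. It produces the term \<open>2 * lam3 N\<close> in
  \<open>card_reps3_even\<close>.\<close>

lemma card_even_squares:
  "int (card {(x::int, y::int). (even x \<and> even y) \<and> x^2 + y^2 = c}) = (if 4 dvd c then 4 * lam4 c else 0) + (if c = 0 then 1 else 0)"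
proof -
  have "(even x \<and> even y) \<longleftrightarrow> 4 dvd (x^2 + y^2)" for x y :: int
    using square_mod4[of x] square_mod4[of y] by (cases "even x"; cases "even y") (simp_all, presburger+)
  hence s: "{(x::int, y::int). (even x \<and> even y) \<and> x^2 + y^2 = c} = (if 4 dvd c then {(x, y). x^2 + y^2 = c} else {})"
    by auto
  show ?thesis
  proof (cases "4 dvd c")
    case True
    consider "c < 0" | "c = 0" | "c > 0" by linarith
    hence "r2 c = 4 * lam4 c + (if c = 0 then 1 else 0)"
      by cases (simp_all add: r2_neg r2_0 r2_eq lam4_def lam_neg)
    thus ?thesis unfolding s using True by (simp add: r2_def)
  next
    case False thus ?thesis unfolding s by auto
  qed
qed

definition reps_odd :: "int \<Rightarrow> ((int \<times> int) \<times> int \<times> int) set" where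
  "reps_odd N = {((x, y), (z, v)). (odd x \<and> odd y) \<and> 1 * (x^2 + y^2) + (z^2 + 3 * v^2) = N}"

definition reps3_odd :: "int \<Rightarrow> ((int \<times> int) \<times> int \<times> int) set" where
  "reps3_odd N = {((x, y), (z, v)). (odd x \<and> odd y) \<and> 3 * (x^2 + y^2) + (z^2 + 3 * v^2) = N}"

definition reps3_even :: "int \<Rightarrow> ((int \<times> int) \<times> int \<times> int) set" where
  "reps3_even N = {((x, y), (z, v)). (even x \<and> even y) \<and> 3 * (x^2 + y^2) + (z^2 + 3 * v^2) = N}"

text \<open>Two odd squares sum to c = 2 modulo 4, so \<open>N - m * c\<close> is odd and
  \<open>r13_eq\<close> applies. The factor 8 is 4 from \<open>r2_eq\<close> times 2 from
  \<open>r13_eq\<close>.\<close>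

lemma card_odd_theta_conv:
  fixes m N :: int
  assumes "odd N" "odd m" "m \<ge> 1"
  shows "int (card {((x::int, y::int), (z, v)). (odd x \<and> odd y) \<and> m * (x^2 + y^2) + (z^2 + 3 * v^2) = N})
    = 8 * (\<Sum>c\<in>{0..N}. (if c mod 4 = 2 then lam4 c else 0) * lam3 (N - m * c))"
  unfolding card_theta_conv[OF assms(3)] sum_distrib_left
proof (rule sum.cong)
  fix c
  show "int (card {(x::int, y::int). (odd x \<and> odd y) \<and> x^2 + y^2 = c}) * r13 (N - m * c)
    = 8 * ((if c mod 4 = 2 then lam4 c else 0) * lam3 (N - m * c))"
  proof (cases "c mod 4 = 2")
    case True
    hence "even c" by presburger
    hence "odd (N - m * c)" using assms by simp
    thus ?thesis unfolding card_odd_squares using True by (simp add: r13_eq)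
  next
    case False thus ?thesis unfolding card_odd_squares by simp
  qed
qed simp

lemma card_reps_odd:
  assumes "odd N"
  shows "int (card (reps_odd N)) = 8 * qsum N (\<lambda>d k e l. if k mod 4 = 2 then chi4 d * chi3 e else 0)"
  using card_odd_theta_conv[OF assms, of 1] unfolding qsum_X0 reps_odd_def by simp

lemma card_reps3_odd:
  assumes "odd N"
  shows "int (card (reps3_odd N)) = - 8 * qsum N (\<lambda>d k e l. if k mod 4 = 2 \<and> 3 dvd d then chi4 d * chi3 e else 0)"
  using card_odd_theta_conv[OF assms, of 3] unfolding qsum_XA reps3_odd_def minus_mult_minus by simp

lemma card_reps3_even:
  assumes "odd N" "N \<ge> 0"
  shows "int (card (reps3_even N)) = 8 * qsum N (\<lambda>d k e l. if 4 dvd k \<and> 3 dvd k then chi4 d * chi3 e else 0) + 2 * lam3 N"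
proof -
  have "int (card (reps3_even N)) = (\<Sum>c\<in>{0..N}. int (card {(x::int, y::int). (even x \<and> even y) \<and> x^2 + y^2 = c}) * r13 (N - 3 * c))"
    unfolding reps3_even_def by (rule card_theta_conv) simp
  also have "\<dots> = (\<Sum>c\<in>{0..N}. 8 * ((if 4 dvd c then lam4 c else 0) * lam3 (N - 3 * c)) + (if c = 0 then 2 * lam3 N else 0))"
  proof (rule sum.cong)
    fix c
    show "int (card {(x::int, y::int). (even x \<and> even y) \<and> x^2 + y^2 = c}) * r13 (N - 3 * c)
      = 8 * ((if 4 dvd c then lam4 c else 0) * lam3 (N - 3 * c)) + (if c = 0 then 2 * lam3 N else 0)"
    proof (cases "4 dvd c")
      case True
      hence "odd (N - 3 * c)" using assms by presburger
      thus ?thesis unfolding card_even_squares using True by (simp add: r13_eq algebra_simps)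
    next
      case False thus ?thesis unfolding card_even_squares by auto
    qed
  qed simp
  also have "\<dots> = 8 * (\<Sum>c\<in>{0..N}. (if 4 dvd c then lam4 c else 0) * lam3 (N - 3 * c)) + 2 * lam3 N"
    using assms(2) by (simp only: sum.distrib sum_distrib_left) simp
  finally show ?thesis unfolding qsum_XB .
qed

section \<open>Evaluating the difference D - K\<close>

lemma square_mod8: "(v::int)^2 mod 8 = (if odd v then 1 else if 4 dvd v then 0 else 4)"
proof (cases "even v")
  case True
  then obtain t where t: "v = 2 * t" by (rule evenE)
  show ?thesis
  proof (cases "even t")
    case True
    then obtain s where "t = 2 * s" by (rule evenE)
    thus ?thesis using t by (simp add: power2_eq_square)
  next
    case False
    hence "t^2 mod 8 = 1" by (rule odd_square_mod8)
    moreover have "v^2 = 4 * t^2" using t by (simp add: power2_eq_square)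
    ultimately have "v^2 mod 8 = 4" by presburger
    moreover have "\<not> 4 dvd v" using False t by presburger
    ultimately show ?thesis using True by simp
  qed
qed (simp add: odd_square_mod8)

lemma finite_sphere4:
  assumes "\<And>x y z v :: int. Q x y z v \<Longrightarrow> x^2 \<le> N \<and> y^2 \<le> N \<and> z^2 \<le> N \<and> v^2 \<le> N"
  shows "finite {((x, y), (z, v)). Q x y z v}"
proof (rule finite_subset)
  show "{((x, y), (z, v)). Q x y z v} \<subseteq> ({- N..N} \<times> {- N..N}) \<times> ({- N..N} \<times> {- N..N})"
  proof
    fix p assume "p \<in> {((x, y), (z, v)). Q x y z v}"
    then obtain x y z v where p: "p = ((x, y), (z, v))" "Q x y z v" by auto
    thus "p \<in> ({- N..N} \<times> {- N..N}) \<times> ({- N..N} \<times> {- N..N})"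
      using assms[OF p(2)] square_le_imp[of x N] square_le_imp[of y N] square_le_imp[of z N] square_le_imp[of v N] by auto
  qed
qed simp

lemma sphere_bounds:
  fixes x y z v N :: int
  assumes "3 * (x^2 + y^2) + (z^2 + 3 * v^2) = N"
  shows "x^2 \<le> N \<and> y^2 \<le> N \<and> z^2 \<le> N \<and> v^2 \<le> N"
proof -
  have aux: "a \<le> N \<and> b \<le> N \<and> c \<le> N \<and> d \<le> N"
    if "a \<ge> 0" "b \<ge> 0" "c \<ge> 0" "d \<ge> 0" "3 * a + 3 * b + c + 3 * d = N" for a b c d :: int
    using that by auto
  have "3 * x^2 + 3 * y^2 + z^2 + 3 * v^2 = N" using assms by simp
  thus ?thesis by (intro aux) simp_all
qed

lemma finite_reps3_even [simp]: "finite (reps3_even N)"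
  unfolding reps3_even_def by (rule finite_sphere4[of _ N]) (use sphere_bounds in blast)

lemma reps3_odd_parity:
  fixes x y z v N :: int
  assumes "N mod 8 = 7" "odd x" "odd y" "3 * (x^2 + y^2) + (z^2 + 3 * v^2) = N"
  shows "odd z \<and> 4 dvd v"
proof -
  have a: "q mod 8 = 1" if "3 * (a + b) + q = N" "a mod 8 = 1" "b mod 8 = 1" for a b q
  proof -
    have "a = 8 * (a div 8) + 1" "b = 8 * (b div 8) + 1" using that(2,3) by presburger+
    hence "a + b = 8 * (a div 8 + b div 8) + 2" by simp
    hence "q = N - 6 - 8 * (3 * (a div 8 + b div 8))" using that(1) by simp
    moreover have "(N - 6 - 8 * t) mod 8 = 1" for t using assms(1) by presburger
    ultimately show ?thesis by metis
  qed
  have "(z^2 + 3 * v^2) mod 8 = 1"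
    by (rule a[OF assms(4) odd_square_mod8[OF assms(2)] odd_square_mod8[OF assms(3)]])
  hence "(z^2 mod 8 + 3 * (v^2 mod 8)) mod 8 = 1" by presburger
  thus ?thesis unfolding square_mod8 by (auto split: if_splits)
qed

lemma reps3_even_parity:
  fixes x y z v N :: int
  assumes "N mod 8 = 7" "even x" "even y" "3 * (x^2 + y^2) + (z^2 + 3 * v^2) = N"
  shows "even z \<and> odd v"
proof -
  have a: "q mod 4 = 3" if "3 * (a + b) + q = N" "a mod 4 = 0" "b mod 4 = 0" for a b q
  proof -
    have "a = 4 * (a div 4)" "b = 4 * (b div 4)" using that(2,3) by presburger+
    hence "a + b = 4 * (a div 4 + b div 4)" by simp
    hence "q = N - 4 * (3 * (a div 4 + b div 4))" using that(1) by simp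
    moreover have "(N - 4 * t) mod 4 = 3" for t using assms(1) by presburger
    ultimately show ?thesis by metis
  qed
  have "(z^2 + 3 * v^2) mod 4 = 3"
    by (rule a[OF assms(4) even_square_mod4[OF assms(2)] even_square_mod4[OF assms(3)]])
  hence "(z^2 mod 8 + 3 * (v^2 mod 8)) mod 4 = 3" by presburger
  thus ?thesis unfolding square_mod8 by (auto split: if_splits)
qed

text \<open>Fix an odd y and a v divisible by 4. Then \<open>z^2 + 3 * x^2\<close> must equal four
  times an odd number, and the solutions with odd z and x are twice as many as those with even z and
  x. The latter become elements of \<open>reps3_even\<close> after exchanging y and v, which have
  the same coefficient 3; the parity lemmas show that no element is missed.\<close>

lemma card_reps3_odd_even:
  assumes N: "N mod 8 = 7"
  shows "card (reps3_odd N) = 2 * card {((x, y), (z, v)). ((x, y), (z, v)) \<in> reps3_even N \<and> 4 dvd y}"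
proof -
  define J where "J = {(y, v). y \<in> {- N..N} \<and> v \<in> {- N..N} \<and> odd y \<and> 4 dvd v}"
  define Fo where "Fo = (\<lambda>(y, v). {(z, x). z^2 + 3 * x^2 = N - 3 * y^2 - 3 * v^2 \<and> odd z})"
  define Fe where "Fe = (\<lambda>(y, v). {(z, x). z^2 + 3 * x^2 = N - 3 * y^2 - 3 * v^2 \<and> even z})"
  have finJ: "finite J" by (rule finite_subset[of _ "{- N..N} \<times> {- N..N}"]) (auto simp: J_def)
  have fin: "finite (Fo p)" "finite (Fe p)" for p by (cases p; simp add: Fo_def Fe_def)+
  have par: "odd x \<longleftrightarrow> odd z" if "z^2 + 3 * x^2 = N - 3 * y^2 - 3 * v^2" "odd y" "4 dvd v" for x y z v :: int
  proof -
    have "even v" using that(3) by presburger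
    moreover have "odd N" using N by presburger
    ultimately have "even (N - 3 * y^2 - 3 * v^2)" using that(2) by simp
    hence "even (z^2 + 3 * x^2)" using that(1) by simp
    thus ?thesis by auto
  qed
  have eq: "card (Fo p) = 2 * card (Fe p)" if pJ: "p \<in> J" for p
  proof -
    obtain y v where p: "p = (y, v)" "odd y" "4 dvd v" using pJ by (auto simp: J_def)
    have "y^2 mod 8 = 1" using p(2) by (rule odd_square_mod8)
    moreover have "v^2 mod 8 = 0"
    proof -
      have "even v" using p(3) by presburger
      thus ?thesis using p(3) by (simp add: square_mod8)
    qed
    ultimately have b: "(N - 3 * y^2 - 3 * v^2) mod 8 = 4" using N by presburger
    define m where "m = (N - 3 * y^2 - 3 * v^2) div 4"
    have "q = 4 * (q div 4) \<and> odd (q div 4)" if "q mod 8 = 4" for q :: int using that by presburger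
    hence m: "N - 3 * y^2 - 3 * v^2 = 4 * m" "odd m" using b unfolding m_def by blast+
    have "int (card (Fo p)) = 2 * r13 m" using r13_odd4[OF m(2)] by (simp add: Fo_def p(1) m(1))
    moreover have "int (card (Fe p)) = r13 m" using r13_even4[of m] by (simp add: Fe_def p(1) m(1))
    ultimately show ?thesis by simp
  qed
  have "card (reps3_odd N) = card (Sigma J Fo)"
  proof (rule card_bij_witness[of _ "\<lambda>((x, y), (z, v)). ((y, v), (z, x))" _ "\<lambda>((y, v), (z, x)). ((x, y), (z, v))"], goal_cases)
    case (1 p)
    then obtain x y z v where p: "p = ((x, y), (z, v))" "odd x" "odd y" "3 * (x^2 + y^2) + (z^2 + 3 * v^2) = N"
      by (auto simp: reps3_odd_def)
    have "odd z \<and> 4 dvd v" by (rule reps3_odd_parity[OF N p(2-4)])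
    moreover have "y^2 \<le> N" "v^2 \<le> N" using sphere_bounds[OF p(4)] by auto
    ultimately show ?case using p square_le_imp[of y N] square_le_imp[of v N] by (auto simp: J_def Fo_def)
  next
    case (2 p)
    then obtain x y z v where p: "p = ((y, v), (z, x))" "odd y" "4 dvd v" "odd z" "z^2 + 3 * x^2 = N - 3 * y^2 - 3 * v^2"
      by (auto simp: J_def Fo_def)
    have "odd x" using par[OF p(5,2,3)] p(4) by simp
    moreover have "3 * (x^2 + y^2) + (z^2 + 3 * v^2) = N" using p(5) by simp
    ultimately show ?case using p by (simp add: reps3_odd_def)
  qed auto
  also have "\<dots> = (\<Sum>p\<in>J. card (Fo p))" using finJ fin by (intro card_SigmaI) auto
  also have "\<dots> = 2 * (\<Sum>p\<in>J. card (Fe p))" unfolding sum_distrib_left by (rule sum.cong) (auto simp: eq)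
  also have "(\<Sum>p\<in>J. card (Fe p)) = card (Sigma J Fe)" using finJ fin by (intro card_SigmaI[symmetric]) auto
  also have "card (Sigma J Fe) = card {((x, y), (z, v)). ((x, y), (z, v)) \<in> reps3_even N \<and> 4 dvd y}"
  proof (rule card_bij_witness[of _ "\<lambda>((v, y), (z, x)). ((x, y), (z, v))" _ "\<lambda>((x, y), (z, v)). ((v, y), (z, x))"], goal_cases)
    case (1 p)
    then obtain v y z x where p: "p = ((v, y), (z, x))" "odd v" "4 dvd y" "even z" "z^2 + 3 * x^2 = N - 3 * v^2 - 3 * y^2"
      by (auto simp: J_def Fe_def)
    have "even x" using par[OF p(5,2,3)] p(4) by simp
    moreover have "even y" using p(3) by presburger
    moreover have "3 * (x^2 + y^2) + (z^2 + 3 * v^2) = N" using p(5) by simp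
    ultimately show ?case using p by (simp add: reps3_even_def)
  next
    case (2 p)
    then obtain x y z v where p: "p = ((x, y), (z, v))" "even x" "even y" "3 * (x^2 + y^2) + (z^2 + 3 * v^2) = N" "4 dvd y"
      by (auto simp: reps3_even_def)
    have "even z \<and> odd v" by (rule reps3_even_parity[OF N p(2-4)])
    moreover have "y^2 \<le> N" "v^2 \<le> N" using sphere_bounds[OF p(4)] by auto
    ultimately show ?case using p square_le_imp[of y N] square_le_imp[of v N] by (auto simp: J_def Fe_def)
  qed auto
  finally show ?thesis .
qed

text \<open>With A and B the numbers of elements of \<open>reps3_even\<close> with y divisible and
  not divisible by 4, the difference is 2A - (A + B) = A - B, the count signed by the parity of
  y/2.\<close>

lemma reps3_odd_minus_even:
  assumes N: "N mod 8 = 7"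
  shows "int (card (reps3_odd N)) - int (card (reps3_even N)) = (\<Sum>((x, y), (z, v))\<in>reps3_even N. sgn2 (y div 2))"
proof -
  let ?A = "{((x, y), (z, v)). ((x, y), (z, v)) \<in> reps3_even N \<and> 4 dvd y}"
  let ?B = "{((x, y), (z, v)). ((x, y), (z, v)) \<in> reps3_even N \<and> \<not> 4 dvd y}"
  have fin: "finite ?A" "finite ?B" by (rule finite_subset[OF _ finite_reps3_even[of N]]; auto)+
  have u: "reps3_even N = ?A \<union> ?B" by auto
  have d: "?A \<inter> ?B = {}" by auto
  have "(\<Sum>((x, y), (z, v))\<in>reps3_even N. sgn2 (y div 2)) = (\<Sum>((x, y), (z, v))\<in>?A. sgn2 (y div 2)) + (\<Sum>((x, y), (z, v))\<in>?B. sgn2 (y div 2))"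
    by (subst u) (rule sum.union_disjoint[OF fin d])
  also have "(\<Sum>((x, y), (z, v))\<in>?A. sgn2 (y div 2)) = (\<Sum>p\<in>?A. 1)"
  proof (rule sum.cong, goal_cases)
    case (2 p)
    have "4 dvd y \<Longrightarrow> even (y div 2)" for y :: int by presburger
    thus ?case using 2 by (auto simp: sgn2_def)
  qed simp
  also have "(\<Sum>((x, y), (z, v))\<in>?B. sgn2 (y div 2)) = (\<Sum>p\<in>?B. - 1)"
  proof (rule sum.cong, goal_cases)
    case (2 p)
    have "even y \<Longrightarrow> \<not> 4 dvd y \<Longrightarrow> odd (y div 2)" for y :: int by presburger
    thus ?case using 2 by (auto simp: sgn2_def reps3_even_def)
  qed simp
  finally have s: "(\<Sum>((x, y), (z, v))\<in>reps3_even N. sgn2 (y div 2)) = int (card ?A) * 1 + int (card ?B) * - 1"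
    by (simp only: sum_constant)
  have "card (reps3_even N) = card ?A + card ?B" by (subst u) (rule card_Un_disjoint[OF fin d])
  thus ?thesis unfolding s card_reps3_odd_even[OF N] by simp
qed

text \<open>If 4 does not divide x - y, exactly one of x/2 and y/2 is odd, and exchanging x and y
  reverses the sign. Otherwise x = 2(p + q) and y = 2(p - q), so that \<open>3 * (x^2 + y^2)\<close>
  is \<open>24 * (p^2 + q^2)\<close> and the sign is \<open>sgn2 (p + q)\<close>. For each z this is
  the left side of \<open>jacobi_signed_sum\<close> at M = (N - z^2)/3.\<close>

lemma reps3_even_signed:
  assumes N: "N mod 8 = 7"
  shows "(\<Sum>((x, y), (z, v))\<in>reps3_even N. sgn2 (y div 2)) = (\<Sum>(z, y) | z^2 + 3 * y^2 = N. y * chi4 y)"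
proof -
  let ?A = "{((x, y), (z, v)). ((x, y), (z, v)) \<in> reps3_even N \<and> 4 dvd x - y}"
  let ?B = "{((x, y), (z, v)). ((x, y), (z, v)) \<in> reps3_even N \<and> \<not> 4 dvd x - y}"
  have fin: "finite ?A" "finite ?B" by (rule finite_subset[OF _ finite_reps3_even[of N]]; auto)+
  have u: "reps3_even N = ?A \<union> ?B" by auto
  have d: "?A \<inter> ?B = {}" by auto
  have B0: "(\<Sum>((x, y), (z, v))\<in>?B. sgn2 (y div 2)) = 0"
  proof (rule sum_antisym[of _ "\<lambda>((x, y), (z, v)). ((y, x), (z, v))"], goal_cases)
    case (1 p)
    then obtain x y z v where p: "p = ((x, y), (z, v))" "((x, y), (z, v)) \<in> reps3_even N" "\<not> 4 dvd x - y" by auto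
    have "\<not> 4 dvd y - x" using p(3) by presburger
    thus ?case using p by (simp add: reps3_even_def add.commute)
  next
    case (2 p) thus ?case by auto
  next
    case (3 p)
    then obtain x y z v where p: "p = ((x, y), (z, v))" "even x" "even y" "\<not> 4 dvd x - y" by (auto simp: reps3_even_def)
    have "even (x div 2) \<longleftrightarrow> odd (y div 2)" using p(2-4) by presburger
    thus ?case using p by (simp add: sgn2_def)
  qed
  define I where "I = {- N..N}"
  define C where "C z = {(v, p, q). odd v \<and> z^2 + 3 * (v^2 + 8 * (p^2 + q^2)) = N}" for z :: int
  have bnd: "z^2 \<le> N \<and> v^2 \<le> N \<and> p^2 \<le> N \<and> q^2 \<le> N" if "z^2 + 3 * (v^2 + 8 * (p^2 + q^2)) = N" for z v p q :: int
  proof -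
    have aux: "a \<le> N \<and> b \<le> N \<and> c \<le> N \<and> d \<le> N"
      if "a \<ge> 0" "b \<ge> 0" "c \<ge> 0" "d \<ge> 0" "a + 3 * b + 24 * c + 24 * d = N" for a b c d :: int
      using that by auto
    have "z^2 + 3 * v^2 + 24 * p^2 + 24 * q^2 = N" using that by simp
    thus ?thesis by (intro aux) simp_all
  qed
  have finC: "finite (C z)" for z
  proof (rule finite_subset)
    show "C z \<subseteq> {- N..N} \<times> {- N..N} \<times> {- N..N}"
    proof
      fix t assume "t \<in> C z"
      then obtain v p q where t: "t = (v, p, q)" "z^2 + 3 * (v^2 + 8 * (p^2 + q^2)) = N" by (auto simp: C_def)
      thus "t \<in> {- N..N} \<times> {- N..N} \<times> {- N..N}"
        using bnd[OF t(2)] square_le_imp[of v N] square_le_imp[of p N] square_le_imp[of q N] by auto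
    qed
  qed simp
  have "(\<Sum>((x, y), (z, v))\<in>?A. sgn2 (y div 2)) = (\<Sum>(z, v, p, q)\<in>Sigma I C. sgn2 (p + q))"
  proof (rule sum.reindex_bij_witness[of _ "\<lambda>(z, v, p, q). ((2 * (p + q), 2 * (p - q)), (z, v))"
        "\<lambda>((x, y), (z, v)). (z, v, (x - y) div 4 + y div 2, (x - y) div 4)"], goal_cases)
    case (1 t)
    then obtain x y z v where t: "t = ((x, y), (z, v))" "even x" "even y" "4 dvd x - y" by (auto simp: reps3_even_def)
    obtain b where b: "y = 2 * b" using t(3) by (rule evenE)
    obtain c where "x - y = 4 * c" using t(4) by (rule dvdE)
    hence "x = 2 * (2 * c + b)" using b by simp
    thus ?case using t b by simp
  next
    case (2 t)
    then obtain x y z v where t: "t = ((x, y), (z, v))" "even x" "even y" "4 dvd x - y"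
      "3 * (x^2 + y^2) + (z^2 + 3 * v^2) = N" by (auto simp: reps3_even_def)
    obtain b where b: "y = 2 * b" using t(3) by (rule evenE)
    obtain c where "x - y = 4 * c" using t(4) by (rule dvdE)
    hence x: "x = 2 * (2 * c + b)" using b by simp
    have "odd v" using reps3_even_parity[OF N t(2,3,5)] by simp
    moreover have "z^2 + 3 * (v^2 + 8 * ((c + b)^2 + c^2)) = N"
      using t(5) unfolding x b by (simp add: power2_eq_square algebra_simps)
    moreover have "z \<in> I" using sphere_bounds[OF t(5)] square_le_imp[of z N] by (auto simp: I_def)
    moreover have "(x - y) div 4 = c" using x b by simp
    ultimately show ?case using t b by (simp add: C_def)
  next
    case (3 t) thus ?case by auto
  next
    case (4 t)
    then obtain z v p q where t: "t = (z, v, p, q)" "z^2 + 3 * (v^2 + 8 * (p^2 + q^2)) = N" by (auto simp: C_def)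
    have "3 * ((2 * (p + q))\<^sup>2 + (2 * (p - q))\<^sup>2) + (z^2 + 3 * v^2) = N"
      using t(2) by (simp add: power2_eq_square algebra_simps)
    thus ?case using t(1) by (simp add: reps3_even_def)
  next
    case (5 t)
    then obtain x y z v where t: "t = ((x, y), (z, v))" "even x" "even y" "4 dvd x - y" by (auto simp: reps3_even_def)
    have "sgn2 (a + b + a) = sgn2 b" for a b by (simp add: sgn2_def)
    thus ?case using t by simp
  qed
  also have "\<dots> = (\<Sum>z\<in>I. \<Sum>(v, p, q)\<in>C z. sgn2 (p + q))"
    by (subst sum.Sigma) (auto simp: I_def finC)
  also have "\<dots> = (\<Sum>z\<in>I. \<Sum>y | z^2 + 3 * y^2 = N. y * chi4 y)"
  proof (rule sum.cong)
    fix z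
    show "(\<Sum>(v, p, q)\<in>C z. sgn2 (p + q)) = (\<Sum>y | z^2 + 3 * y^2 = N. y * chi4 y)"
    \<comment> \<open>For a z without such an M neither side has any terms: v and y are odd, so a
      solution would make (N - z^2)/3 an integer that is 1 modulo 8.\<close>
    proof (cases "\<exists>M. N - z^2 = 3 * M \<and> M mod 8 = 1")
      case True
      then obtain M where M: "N - z^2 = 3 * M" "M mod 8 = 1" by blast
      have e: "z^2 + 3 * a = N \<longleftrightarrow> a = M" for a using M(1) by auto
      have "C z = {(v, p, q). odd v \<and> v^2 + 8 * (p^2 + q^2) = M}" unfolding C_def e ..
      thus ?thesis unfolding e using jacobi_signed_sum[OF M(2)] by simp
    next
      case False
      have "C z = {}"
      proof (rule ccontr)
        assume "C z \<noteq> {}"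
        then obtain v p q where c: "odd v" "z^2 + 3 * (v^2 + 8 * (p^2 + q^2)) = N" by (auto simp: C_def)
        have "(v^2 + 8 * (p^2 + q^2)) mod 8 = 1" using odd_square_mod8[OF c(1)] by presburger
        moreover have "N - z^2 = 3 * (v^2 + 8 * (p^2 + q^2))" using c(2) by simp
        ultimately show False using False by blast
      qed
      moreover have "{y. z^2 + 3 * y^2 = N} = {}"
      proof (rule ccontr)
        assume "{y. z^2 + 3 * y^2 = N} \<noteq> {}"
        then obtain y where y: "z^2 + 3 * y^2 = N" by auto
        have "3 * ((0::int)^2 + 0^2) + (z^2 + 3 * y^2) = N" using y by simp
        hence "odd y" using reps3_even_parity[OF N, of 0 0 z y] by simp
        hence "y^2 mod 8 = 1" by (rule odd_square_mod8)
        moreover have "N - z^2 = 3 * y^2" using y by simp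
        ultimately show False using False by blast
      qed
      ultimately show ?thesis by simp
    qed
  qed simp
  also have "\<dots> = (\<Sum>(z, y)\<in>Sigma I (\<lambda>z. {y. z^2 + 3 * y^2 = N}). y * chi4 y)"
  proof (rule sum.Sigma)
    have "finite {y. z^2 + 3 * y^2 = N}" for z :: int
    proof -
      have "{y. z^2 + 3 * y^2 = N} = snd ` ({(a, b). a^2 + 3 * b^2 = N} \<inter> {(a, b). a = z})" by force
      thus ?thesis by simp
    qed
    thus "\<forall>z\<in>I. finite {y. z^2 + 3 * y^2 = N}" by blast
  qed (simp add: I_def)
  also have "Sigma I (\<lambda>z. {y. z^2 + 3 * y^2 = N}) = {(z, y). z^2 + 3 * y^2 = N}"
  proof (intro equalityI subsetI)
    fix t assume "t \<in> {(z, y). z^2 + 3 * y^2 = N}"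
    then obtain z y where t: "t = (z, y)" "z^2 + 3 * y^2 = N" by auto
    have "z^2 \<le> N" using t(2) zero_le_power2[of y] by linarith
    thus "t \<in> Sigma I (\<lambda>z. {y. z^2 + 3 * y^2 = N})" using t square_le_imp[of z N] by (auto simp: I_def)
  qed auto
  finally have A: "(\<Sum>((x, y), (z, v))\<in>?A. sgn2 (y div 2)) = (\<Sum>(z, y) | z^2 + 3 * y^2 = N. y * chi4 y)" .
  have "(\<Sum>((x, y), (z, v))\<in>reps3_even N. sgn2 (y div 2)) = (\<Sum>((x, y), (z, v))\<in>?A. sgn2 (y div 2)) + (\<Sum>((x, y), (z, v))\<in>?B. sgn2 (y div 2))"
    by (subst u) (rule sum.union_disjoint[OF fin d])
  thus ?thesis unfolding A B0 by simp
qed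

text \<open>The rotation replaces w by z + y. From N = 7 modulo 8, z is 2 modulo 4 and y is odd, so
  \<open>chi4 (z + y) = - chi4 y\<close>; the part with factor z cancels under the sign change of z.
  The factor 2 comes from \<open>hex_odd_split\<close>.\<close>

lemma cusp_sum_rotate:
  assumes N: "N mod 8 = 7"
  shows "(\<Sum>(u, w) | u^2 + 3 * w^2 = 4 * N \<and> odd u. w * chi4 w) = - 2 * (\<Sum>(z, y) | z^2 + 3 * y^2 = N. y * chi4 y)"
proof -
  have o: "odd N" using N by presburger
  have "(\<Sum>(u, w) | u^2 + 3 * w^2 = 4 * N \<and> odd u. w * chi4 w)
     = 2 * (\<Sum>(u, w) | u^2 + 3 * w^2 = 4 * N \<and> odd u \<and> 4 dvd u - w. w * chi4 w)"
    by (rule hex_odd_split) simp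
  also have "(\<Sum>(u, w) | u^2 + 3 * w^2 = 4 * N \<and> odd u \<and> 4 dvd u - w. w * chi4 w)
     = (\<Sum>(z, y) | z^2 + 3 * y^2 = N. (z + y) * chi4 (z + y))"
    by (rule hex_rotate_sum[OF o])
  also have "\<dots> = (\<Sum>(z, y) | z^2 + 3 * y^2 = N. - (z * chi4 y) + - (y * chi4 y))"
  proof (rule sum.cong)
    fix p assume "p \<in> {(z, y). z^2 + 3 * y^2 = N}"
    then obtain z y where p: "p = (z, y)" "z^2 + 3 * y^2 = N" by auto
    have "3 * ((0::int)^2 + 0^2) + (z^2 + 3 * y^2) = N" using p by simp
    hence yz: "even z" "odd y" using reps3_even_parity[OF N, of 0 0 z y] by simp_all
    have "y^2 mod 8 = 1" using yz(2) by (rule odd_square_mod8)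
    hence "z^2 mod 8 = 4" using p(2) N by presburger
    hence "\<not> 4 dvd z" using yz by (auto simp: square_mod8)
    hence "chi4 (z + y) = chi4 (y + 2)" using yz by (intro chi4_cong) presburger
    hence "chi4 (z + y) = - chi4 y" by (simp add: chi4_add2[OF yz(2)])
    thus "(case p of (z, y) \<Rightarrow> (z + y) * chi4 (z + y)) = (case p of (z, y) \<Rightarrow> - (z * chi4 y) + - (y * chi4 y))"
      using p by (simp add: algebra_simps)
  qed simp
  also have "\<dots> = (\<Sum>(z, y) | z^2 + 3 * y^2 = N. - (z * chi4 y)) + (\<Sum>(z, y) | z^2 + 3 * y^2 = N. - (y * chi4 y))"
    unfolding sum.distrib[symmetric] by (rule sum.cong) auto
  also have "(\<Sum>(z, y) | z^2 + 3 * y^2 = N. - (z * chi4 y)) = 0"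
    by (rule sum_antisym[of _ "\<lambda>(z, y). (- z, y)"]) auto
  also have "(\<Sum>(z, y) | z^2 + 3 * y^2 = N. - (y * chi4 y)) = - (\<Sum>(z, y) | z^2 + 3 * y^2 = N. y * chi4 y)"
    unfolding sum_negf[symmetric] by (rule sum.cong) auto
  finally show ?thesis by simp
qed

lemma reps_odd_count:
  assumes N: "N mod 8 = 7" "N \<ge> 0"
  shows "4 * int (card (reps_odd N)) = 2 * (\<Sum>(d, m)\<in>dpairs N. chi4 d * chi3 d * (3 * m + d))
     + 3 * (\<Sum>(u, w) | u^2 + 3 * w^2 = 4 * N \<and> odd u. w * chi4 w)"
proof -
  let ?E = "\<Sum>(d, m)\<in>dpairs N. chi4 d * chi3 d * (3 * m + d)"
  let ?Y = "\<Sum>(z, y) | z^2 + 3 * y^2 = N. y * chi4 y"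
  have o: "odd N" and n4: "N mod 4 = 3" using N by presburger+
  have "int (card (reps3_odd N)) - int (card (reps3_even N)) = ?Y"
    by (simp only: reps3_odd_minus_even[OF N(1)] reps3_even_signed[OF N(1)])
  moreover have "2 * int (card (reps_odd N)) + 3 * (int (card (reps3_odd N)) - int (card (reps3_even N))) = ?E"
  proof -
    have arith: "2 * T + 3 * (D - K) = E" if "2 * (8 * a - 12 * b - 12 * c) = E + 6 * l" "T = 8 * a" "D = - 8 * b" "K = 8 * c + 2 * l"
      for T D K E a b c l :: int using that by simp
    show ?thesis
      by (rule arith[OF lambert_product_identity[OF n4] card_reps_odd[OF o] card_reps3_odd[OF o] card_reps3_even[OF o N(2)]])
  qed
  moreover have "(\<Sum>(u, w) | u^2 + 3 * w^2 = 4 * N \<and> odd u. w * chi4 w) = - 2 * ?Y"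
    by (rule cusp_sum_rotate[OF N(1)])
  moreover have "4 * T = 2 * E + 3 * C" if "DK = Y" "2 * T + 3 * DK = E" "C = - 2 * Y" for T E C DK Y :: int
    using that by simp
  ultimately show ?thesis by blast
qed

section \<open>The Kronecker symbol\<close>

lemma Legendre_mod3:
  assumes "\<not> 3 dvd a"
  shows "Legendre a 3 = chi3 a"
proof -
  have "a mod 3 = 1 \<or> a mod 3 = 2" using assms by presburger
  thus ?thesis
  proof
    assume a: "a mod 3 = 1"
    have "QuadRes 3 a" unfolding QuadRes_def by (rule exI[of _ 1]) (simp add: cong_def a)
    thus ?thesis using a by (simp add: Legendre_def chi3_def cong_def)
  next
    assume a: "a mod 3 = 2"
    have "\<not> QuadRes 3 a"
    proof
      assume "QuadRes 3 a"
      then obtain y :: int where "y^2 mod 3 = 2" using a by (auto simp: QuadRes_def cong_def)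
      moreover have "y^2 mod 3 = 0 \<or> y^2 mod 3 = 1"
        using square_mod3[of y] by (cases "3 dvd y") (auto simp: power2_eq_square)
      ultimately show False by auto
    qed
    thus ?thesis using a by (simp add: Legendre_def chi3_def cong_def)
  qed
qed

text \<open>Quadratic reciprocity for 3 and p: as (3 - 1)/2 = 1, the sign is
  \<open>(- 1) ^ ((p - 1) div 2)\<close>, which is \<open>chi4 p\<close>, and \<open>chi3 p\<close>
  is its own inverse.\<close>

lemma kronecker_prime_3:
  assumes p: "prime (p::nat)" "p \<noteq> 2" "p \<noteq> 3"
  shows "kronecker_prime 3 p = chi4 (int p) * chi3 (int p)"
proof -
  have p2: "p > 2" using p prime_ge_2_nat[of p] by simp
  have po: "odd p" using p by (metis prime_odd_nat p2)
  have p3: "\<not> 3 dvd int p"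
  proof
    assume "3 dvd int p"
    hence "3 dvd p" by presburger
    moreover have "prime (3::nat)" by simp
    ultimately have "3 = p" using p(1) by (intro primes_dvd_imp_eq)
    thus False using p(3) by simp
  qed
  have "prime (3::nat)" by simp
  hence "Legendre (int p) (int 3) * Legendre (int 3) (int p) = (- 1) ^ ((p - 1) div 2 * ((3 - 1) div 2))"
    by (intro Quadratic_Reciprocity) (use p p2 in auto)
  hence L: "chi3 (int p) * Legendre 3 (int p) = (- 1) ^ ((p - 1) div 2)"
    using Legendre_mod3[OF p3] by simp
  have c: "(- 1 :: int) ^ ((p - 1) div 2) = chi4 (int p)"
  proof -
    have "p mod 4 = 1 \<and> even ((p - 1) div 2) \<or> p mod 4 = 3 \<and> odd ((p - 1) div 2)" using po by presburger
    moreover have "int p mod 4 = int (p mod 4)" by (simp add: zmod_int)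
    ultimately show ?thesis by (auto simp: chi4_def)
  qed
  have "chi3 (int p) * chi3 (int p) = 1" using p3 unfolding chi3_def by presburger
  hence "Legendre 3 (int p) = chi3 (int p) * (chi3 (int p) * Legendre 3 (int p))" by (simp add: mult.assoc[symmetric])
  thus ?thesis using p(2) L c by (simp add: kronecker_prime_def)
qed

lemma chi43_prod: "chi4 (\<Prod>p\<in>A. f p) * chi3 (\<Prod>p\<in>A. f p) = (\<Prod>p\<in>A. chi4 (f p) * chi3 (f p))"
  by (induction A rule: infinite_finite_induct) (simp_all add: chi4_mult chi3_mult chi4_def[of 1] chi3_def[of 1])

lemma chi43_power: "chi4 (a ^ j) * chi3 (a ^ j) = (chi4 a * chi3 a) ^ j"
  by (induction j) (simp_all add: chi4_mult chi3_mult chi4_def[of 1] chi3_def[of 1])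

lemma kronecker_3:
  assumes d: "odd (d::nat)" "\<not> 3 dvd d"
  shows "kronecker 3 (int d) = chi4 (int d) * chi3 (int d)"
proof -
  have d0: "d > 0" using d(1) by (cases d) auto
  have "kronecker 3 (int d) = (\<Prod>p\<in>prime_factors d. kronecker_prime 3 p ^ multiplicity p d)"
    using d0 by (simp add: kronecker_def)
  also have "\<dots> = (\<Prod>p\<in>prime_factors d. chi4 (int p ^ multiplicity p d) * chi3 (int p ^ multiplicity p d))"
  proof (rule prod.cong)
    fix p assume "p \<in> prime_factors d"
    hence p: "prime p" "p dvd d" by (auto simp: in_prime_factors_iff)
    have p23: "p \<noteq> 2" "p \<noteq> 3" using p(2) d by auto
    show "kronecker_prime 3 p ^ multiplicity p d = chi4 (int p ^ multiplicity p d) * chi3 (int p ^ multiplicity p d)"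
      by (simp only: kronecker_prime_3[OF p(1) p23] chi43_power)
  qed simp
  also have "\<dots> = chi4 (\<Prod>p\<in>prime_factors d. int p ^ multiplicity p d) * chi3 (\<Prod>p\<in>prime_factors d. int p ^ multiplicity p d)"
    by (rule chi43_prod[symmetric])
  also have "(\<Prod>p\<in>prime_factors d. int p ^ multiplicity p d) = int d"
  proof -
    have "int (\<Prod>p\<in>prime_factors d. p ^ multiplicity p d) = int d"
      using prime_factorization_nat[OF d0] by simp
    thus ?thesis by simp
  qed
  finally show ?thesis .
qed

text \<open>Since \<open>chi3\<close> vanishes on multiples of 3, the whole power of 3 goes into the
  cofactor, \<open>m = 3 ^ \<beta> * (n1 div d)\<close>. In the part containing m, replacing d by
  n1/d extracts the symbol of n1, because the symbol is multiplicative with values 1 and -1 on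
  divisors of n1.\<close>

lemma eisenstein_sum:
  fixes \<beta> n1 :: nat
  assumes n1: "n1 > 0" "odd n1" "\<not> 3 dvd n1"
  shows "(\<Sum>(d, m)\<in>dpairs (3 ^ \<beta> * int n1). chi4 d * chi3 d * (3 * m + d))
    = (3 ^ (\<beta> + 1) * kronecker 3 (int n1) + 1) * (\<Sum>d | d dvd n1. int d * kronecker 3 (int d))"
proof -
  let ?N = "3 ^ \<beta> * int n1"
  define D where "D = {d. d dvd n1}"
  have cop: "coprime d (3 ^ \<beta>)" if "\<not> 3 dvd d" for d :: int
  proof -
    have "coprime 3 d" using that by (intro prime_imp_coprime) simp_all
    thus ?thesis by (simp add: coprime_commute)
  qed
  have split: "nat d dvd n1 \<and> m = 3 ^ \<beta> * int (n1 div nat d)" if "d > 0" "d * m = ?N" "\<not> 3 dvd d" for d m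
  proof -
    have "d dvd 3 ^ \<beta> * int n1" using that(2) by (metis dvd_triv_left)
    hence "d dvd int n1" using cop[OF that(3)] by (simp add: coprime_dvd_mult_right_iff)
    then obtain c where c: "int n1 = d * c" by (rule dvdE)
    have "d * m = d * (3 ^ \<beta> * c)" using that(2) c by (simp add: mult_ac)
    hence "m = 3 ^ \<beta> * c" using that(1) by simp
    moreover have "int (n1 div nat d) = c" using c that(1) by (simp add: zdiv_int)
    moreover have "int (nat d) dvd int n1" using that(1) c by simp
    ultimately show ?thesis by (simp only: int_dvd_int_iff)
  qed
  have dodd: "odd d" "\<not> 3 dvd d" if "d \<in> D" for d
    using that n1 unfolding D_def by (auto dest: dvd_trans)
  have k: "kronecker 3 (int d) = chi4 (int d) * chi3 (int d)" if "d \<in> D" for d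
    by (rule kronecker_3) (use dodd[OF that] in auto)
  let ?X = "\<lambda>d::nat. chi4 (int d) * chi3 (int d)"
  have sq: "?X d * ?X d = 1" if "d \<in> D" for d
  proof -
    have "chi4 (int d) * chi4 (int d) = 1" using dodd[OF that] by (intro chi4_odd_square) simp
    moreover have "chi3 (int d) * chi3 (int d) = 1"
    proof -
      have "\<not> 3 dvd int d" using dodd[OF that] by presburger
      thus ?thesis unfolding chi3_def by presburger
    qed
    moreover have "?X d * ?X d = (chi4 (int d) * chi4 (int d)) * (chi3 (int d) * chi3 (int d))" by (simp only: mult_ac)
    ultimately show ?thesis by simp
  qed
  have "(\<Sum>(d, m)\<in>dpairs ?N. chi4 d * chi3 d * (3 * m + d))
     = (\<Sum>(d, m) | (d, m) \<in> dpairs ?N \<and> \<not> 3 dvd d. chi4 d * chi3 d * (3 * m + d))"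
    by (rule sum.mono_neutral_right) (auto simp: chi3_dvd)
  also have "\<dots> = (\<Sum>d\<in>D. ?X d * (3 * (3 ^ \<beta> * int (n1 div d)) + int d))"
  proof (rule sum.reindex_bij_witness[of _ "\<lambda>d. (int d, 3 ^ \<beta> * int (n1 div d))" "\<lambda>(d, m). nat d"], goal_cases)
    case (1 p)
    then obtain d m where p: "p = (d, m)" "d > 0" "m > 0" "d * m = ?N" "\<not> 3 dvd d" by (auto simp: dpairs_def)
    have "m = 3 ^ \<beta> * int (n1 div nat d)" using split[OF p(2,4,5)] by simp
    thus ?case using p by simp
  next
    case (2 p)
    then obtain d m where p: "p = (d, m)" "d > 0" "m > 0" "d * m = ?N" "\<not> 3 dvd d" by (auto simp: dpairs_def)
    thus ?case using split[OF p(2,4,5)] by (simp add: D_def)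
  next
    case (3 d) thus ?case by simp
  next
    case (4 d)
    hence "d dvd n1" by (simp add: D_def)
    then obtain c where c: "n1 = d * c" by (rule dvdE)
    hence dc: "d > 0" "c > 0" using n1(1) by auto
    have "\<not> 3 dvd int d" using dodd[OF 4] by presburger
    thus ?case using c dc by (simp add: dpairs_def)
  next
    case (5 p)
    then obtain d m where p: "p = (d, m)" "d > 0" "m > 0" "d * m = ?N" "\<not> 3 dvd d" by (auto simp: dpairs_def)
    have "m = 3 ^ \<beta> * int (n1 div nat d)" using split[OF p(2,4,5)] by simp
    thus ?case using p by simp
  qed
  also have "\<dots> = 3 ^ (\<beta> + 1) * (\<Sum>d\<in>D. ?X d * int (n1 div d)) + (\<Sum>d\<in>D. ?X d * int d)"
    unfolding sum_distrib_left sum.distrib[symmetric] by (rule sum.cong) (auto simp: algebra_simps)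
  also have "(\<Sum>d\<in>D. ?X d * int (n1 div d)) = (\<Sum>d\<in>D. ?X n1 * (?X d * int d))"
  proof (rule sum.reindex_bij_witness[of _ "\<lambda>d. n1 div d" "\<lambda>d. n1 div d"], goal_cases)
    case (5 d)
    hence "d dvd n1" by (simp add: D_def)
    then obtain c where c: "n1 = d * c" by (rule dvdE)
    hence dc: "d > 0" "c > 0" using n1(1) by auto
    have cD: "c \<in> D" using c by (simp add: D_def)
    have "?X n1 = ?X d * ?X c" unfolding c by (simp add: chi4_mult chi3_mult mult_ac)
    hence "?X n1 * ?X c = ?X d * (?X c * ?X c)" by (simp only: mult.assoc)
    hence "?X n1 * ?X c = ?X d" by (simp only: sq[OF cD] mult_1_right)
    thus ?case using c dc by (simp add: mult.assoc[symmetric])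
  qed (use n1 in \<open>auto simp: D_def div_div_eq_right elim!: dvdE\<close>)
  also have "\<dots> = ?X n1 * (\<Sum>d\<in>D. ?X d * int d)" by (simp only: sum_distrib_left)
  also have "(\<Sum>d\<in>D. ?X d * int d) = (\<Sum>d\<in>D. int d * kronecker 3 (int d))"
    by (rule sum.cong) (auto simp: k)
  also have "?X n1 = kronecker 3 (int n1)" by (rule k[symmetric]) (simp add: D_def)
  finally show ?thesis unfolding D_def by (simp add: algebra_simps)
qed

section \<open>From triangular numbers to squares, and from integers to positive integers\<close>

lemma triangular_square: "8 * (x * (x - 1) div 2) + 1 = (2 * x - 1)^2" for x :: int
proof -
  have "even (x * (x - 1))" by simp
  hence "2 * (x * (x - 1) div 2) = x * (x - 1)" by (rule dvd_mult_div_cancel)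
  moreover have "8 * q + 1 = 4 * (2 * q) + (1::int)" for q by simp
  ultimately have "8 * (x * (x - 1) div 2) + 1 = 4 * (x * (x - 1)) + 1" by metis
  thus ?thesis by (simp add: power2_eq_square algebra_simps)
qed

lemma reps_odd_parity:
  fixes x y z v N :: int
  assumes "N mod 8 = 7" "odd x" "odd y" "x^2 + y^2 + (z^2 + 3 * v^2) = N"
  shows "odd z \<and> even v \<and> \<not> 4 dvd v"
proof -
  have a: "q mod 8 = 5" if "a + b + q = N" "a mod 8 = 1" "b mod 8 = 1" for a b q
    using that assms(1) by presburger
  have "(z^2 + 3 * v^2) mod 8 = 5"
    by (rule a[OF assms(4) odd_square_mod8[OF assms(2)] odd_square_mod8[OF assms(3)]])
  hence "(z^2 mod 8 + 3 * (v^2 mod 8)) mod 8 = 5" by presburger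
  thus ?thesis unfolding square_mod8 by (auto split: if_splits)
qed

text \<open>The last square is written \<open>12 * (2 * w - 1)^2 = 3 * v^2\<close> with
  \<open>v = 2 * (2 * w - 1)\<close>. Completing squares thus requires z odd and v = 2 modulo 4;
  both follow from odd x and y by reduction modulo 8, so \<open>reps_odd\<close> records the parity
  of x and y only.\<close>

lemma t_eq_card_reps_odd: "t 1 1 1 12 n = card (reps_odd (8 * int n + 15))"
proof -
  let ?N = "8 * int n + 15"
  have N: "?N mod 8 = 7" by presburger
  have key: "int n = int 1 * (x * (x - 1) div 2) + int 1 * (y * (y - 1) div 2) + int 1 * (z * (z - 1) div 2) + int 12 * (w * (w - 1) div 2)
     \<longleftrightarrow> 1 * ((2 * x - 1)^2 + (2 * y - 1)^2) + ((2 * z - 1)^2 + 3 * (2 * (2 * w - 1))\<^sup>2) = ?N" for x y z w :: int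
  proof -
    have e: "3 * (2 * (2 * w - 1))\<^sup>2 = 12 * (2 * w - 1)^2" by (simp add: power2_eq_square algebra_simps)
    have "n' = a + b + c + 12 * d \<longleftrightarrow> 1 * ((8 * a + 1) + (8 * b + 1)) + ((8 * c + 1) + 12 * (8 * d + 1)) = 8 * n' + 15"
      for n' a b c d :: int by auto
    thus ?thesis unfolding e triangular_square[symmetric] by simp
  qed
  show ?thesis unfolding t_def
  proof (rule card_bij_witness[of _ "\<lambda>(x, y, z, w). ((2 * x - 1, 2 * y - 1), (2 * z - 1, 2 * (2 * w - 1)))" _
      "\<lambda>((x, y), (z, v)). ((x + 1) div 2, (y + 1) div 2, (z + 1) div 2, (v div 2 + 1) div 2)"], goal_cases)
    case (1 p)
    then obtain x y z w where p: "p = (x, y, z, w)"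
      "int n = int 1 * (x * (x - 1) div 2) + int 1 * (y * (y - 1) div 2) + int 1 * (z * (z - 1) div 2) + int 12 * (w * (w - 1) div 2)"
      by auto
    have "1 * ((2 * x - 1)^2 + (2 * y - 1)^2) + ((2 * z - 1)^2 + 3 * (2 * (2 * w - 1))\<^sup>2) = ?N"
      using p(2) unfolding key .
    thus ?case unfolding p(1) reps_odd_def by simp
  next
    case (2 q)
    then obtain x y z v where q: "q = ((x, y), (z, v))" "odd x" "odd y" "1 * (x^2 + y^2) + (z^2 + 3 * v^2) = ?N"
      by (auto simp: reps_odd_def)
    have zv: "odd z" "even v" "\<not> 4 dvd v" using reps_odd_parity[OF N q(2,3), of z v] q(4) by simp_all
    have half: "\<exists>a. u = 2 * a - 1" if "odd u" for u :: int using that by presburger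
    obtain a b c where abc: "x = 2 * a - 1" "y = 2 * b - 1" "z = 2 * c - 1"
      using half[OF q(2)] half[OF q(3)] half[OF zv(1)] by blast
    obtain d where d: "v = 2 * (2 * d - 1)"
    proof -
      have "v = 2 * (2 * ((v + 2) div 4) - 1)" using zv(2,3) by presburger
      thus ?thesis by (rule that)
    qed
    have "int n = int 1 * (a * (a - 1) div 2) + int 1 * (b * (b - 1) div 2) + int 1 * (c * (c - 1) div 2) + int 12 * (d * (d - 1) div 2)"
      unfolding key using q(4) unfolding abc d .
    thus ?case unfolding q(1) abc d by simp
  next
    case (3 p) thus ?case by (cases p) simp
  next
    case (4 q)
    then obtain x y z v where q: "q = ((x, y), (z, v))" "odd x" "odd y" "1 * (x^2 + y^2) + (z^2 + 3 * v^2) = ?N"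
      by (auto simp: reps_odd_def)
    have zv: "odd z" "even v" "\<not> 4 dvd v" using reps_odd_parity[OF N q(2,3), of z v] q(4) by simp_all
    have "2 * ((u + 1) div 2) - 1 = u" if "odd u" for u :: int using that by presburger
    moreover have "2 * (2 * ((v div 2 + 1) div 2) - 1) = v" using zv(2,3) by presburger
    ultimately show ?case using q zv by simp
  qed
qed

text \<open>Both coordinates are odd, hence nonzero, and \<open>w * chi4 w\<close> is even in w, so
  the four sign choices contribute equally. For odd b the power of -1 is
  \<open>chi4 b\<close>.\<close>

lemma cusp_sum_nat:
  fixes N :: nat
  shows "(\<Sum>(u, w) | u^2 + 3 * w^2 = 4 * int N \<and> odd u. w * chi4 w)
    = 4 * (\<Sum>(a, b)\<in>{(a::nat, b::nat). a > 0 \<and> b > 0 \<and> odd a \<and> 4 * N = a ^ 2 + 3 * b ^ 2}. (- 1) ^ ((b - 1) div 2) * int b)"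
proof -
  let ?A = "{(u, w). u^2 + 3 * w^2 = 4 * int N \<and> odd u}"
  let ?P = "{(u, w). u^2 + 3 * w^2 = 4 * int N \<and> odd u \<and> u > 0}"
  let ?M = "{(u, w). u^2 + 3 * w^2 = 4 * int N \<and> odd u \<and> u < 0}"
  let ?PP = "{(u, w). u^2 + 3 * w^2 = 4 * int N \<and> odd u \<and> u > 0 \<and> w > 0}"
  let ?PM = "{(u, w). u^2 + 3 * w^2 = 4 * int N \<and> odd u \<and> u > 0 \<and> w < 0}"
  have wo: "odd w" if "u^2 + 3 * w^2 = 4 * int N" "odd u" for u w :: int
    using hex_parity[OF that(1)] that(2) by auto
  have A: "?A = ?P \<union> ?M"
  proof -
    have "u > 0 \<or> u < 0" if "odd u" for u :: int using that by (cases "u = 0") auto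
    thus ?thesis by auto
  qed
  have P: "?P = ?PP \<union> ?PM"
  proof -
    have "w > 0 \<or> w < 0" if "u^2 + 3 * w^2 = 4 * int N" "odd u" for u w :: int
      using wo[OF that] by (cases "w = 0") auto
    thus ?thesis by auto
  qed
  have d1: "?P \<inter> ?M = {}" and d2: "?PP \<inter> ?PM = {}" by auto
  have "(\<Sum>(u, w)\<in>?A. w * chi4 w) = (\<Sum>(u, w)\<in>?P. w * chi4 w) + (\<Sum>(u, w)\<in>?M. w * chi4 w)"
    unfolding A by (rule sum.union_disjoint) (use d1 in auto)
  also have "(\<Sum>(u, w)\<in>?M. w * chi4 w) = (\<Sum>(u, w)\<in>?P. w * chi4 w)"
    by (rule sum.reindex_bij_witness[of _ "\<lambda>(u, w). (- u, w)" "\<lambda>(u, w). (- u, w)"]) auto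
  finally have s1: "(\<Sum>(u, w)\<in>?A. w * chi4 w) = (\<Sum>(u, w)\<in>?P. w * chi4 w) + (\<Sum>(u, w)\<in>?P. w * chi4 w)" .
  have "(\<Sum>(u, w)\<in>?P. w * chi4 w) = (\<Sum>(u, w)\<in>?PP. w * chi4 w) + (\<Sum>(u, w)\<in>?PM. w * chi4 w)"
    unfolding P by (rule sum.union_disjoint) (use d2 in auto)
  also have "(\<Sum>(u, w)\<in>?PM. w * chi4 w) = (\<Sum>(u, w)\<in>?PP. w * chi4 w)"
    by (rule sum.reindex_bij_witness[of _ "\<lambda>(u, w). (u, - w)" "\<lambda>(u, w). (u, - w)"]) auto
  finally have s2: "(\<Sum>(u, w)\<in>?P. w * chi4 w) = (\<Sum>(u, w)\<in>?PP. w * chi4 w) + (\<Sum>(u, w)\<in>?PP. w * chi4 w)" .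
  have eqv: "4 * N = a ^ 2 + 3 * b ^ 2 \<longleftrightarrow> (int a)^2 + 3 * (int b)^2 = 4 * int N" for a b :: nat
  proof -
    have "4 * N = a ^ 2 + 3 * b ^ 2 \<longleftrightarrow> int (4 * N) = int (a ^ 2 + 3 * b ^ 2)" by (rule of_nat_eq_iff[symmetric])
    thus ?thesis by auto
  qed
  have "(\<Sum>(u, w)\<in>?PP. w * chi4 w)
    = (\<Sum>(a, b)\<in>{(a::nat, b::nat). a > 0 \<and> b > 0 \<and> odd a \<and> 4 * N = a ^ 2 + 3 * b ^ 2}. (- 1) ^ ((b - 1) div 2) * int b)"
  proof (rule sum.reindex_bij_witness[of _ "\<lambda>(a, b). (int a, int b)" "\<lambda>(u, w). (nat u, nat w)"], goal_cases)
    case (1 p) thus ?case by auto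
  next
    case (2 p)
    then obtain u w where p: "p = (u, w)" "u^2 + 3 * w^2 = 4 * int N" "odd u" "u > 0" "w > 0" by auto
    thus ?case unfolding eqv by (simp add: even_nat_iff)
  next
    case (3 p) thus ?case by auto
  next
    case (4 p) thus ?case unfolding eqv by auto
  next
    case (5 p)
    then obtain u w where p: "p = (u, w)" "u^2 + 3 * w^2 = 4 * int N" "odd u" "u > 0" "w > 0" by auto
    define b where "b = nat w"
    have b: "w = int b" using p(5) by (simp add: b_def)
    have "odd b" using wo[OF p(2,3)] b by simp
    hence "b mod 4 = 1 \<and> even ((b - 1) div 2) \<or> b mod 4 = 3 \<and> odd ((b - 1) div 2)" by presburger
    moreover have "int b mod 4 = int (b mod 4)" by (simp add: zmod_int)
    ultimately have "(- 1 :: int) ^ ((b - 1) div 2) = chi4 (int b)" by (auto simp: chi4_def)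
    thus ?case using p b by simp
  qed
  thus ?thesis unfolding s1 s2 by simp
qed

theorem theorem4p5:
  fixes n \<beta> n\<^sub>1 :: nat
  assumes "n > 0"
    and "8 * n + 15 = 3 ^ \<beta> * n\<^sub>1"
    and "n\<^sub>1 > 0"
    and "\<not> 3 dvd n\<^sub>1"
  shows "real (t 1 1 1 12 n) =
      1 / 2 * (3 ^ (\<beta> + 1) * real_of_int (kronecker 3 (int n\<^sub>1)) + 1) *
        (\<Sum>d | d dvd n\<^sub>1. real d * real_of_int (kronecker 3 (int d)))
      + 3 * (\<Sum>(a, b) \<in> {(a :: nat, b :: nat). a > 0 \<and> b > 0 \<and> odd a \<and>
                4 * (8 * n + 15) = a ^ 2 + 3 * b ^ 2}.
              (-1) ^ ((b - 1) div 2) * real b)"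
proof -
  define N where "N = 8 * n + 15"
  define E where "E = (\<Sum>d | d dvd n\<^sub>1. int d * kronecker 3 (int d))"
  define C where "C = (\<Sum>(a, b)\<in>{(a::nat, b::nat). a > 0 \<and> b > 0 \<and> odd a \<and> 4 * N = a ^ 2 + 3 * b ^ 2}. (- 1) ^ ((b - 1) div 2) * int b)"
  have N: "int N mod 8 = 7" unfolding N_def by presburger
  have Ni: "int N = 3 ^ \<beta> * int n\<^sub>1" using assms(2) unfolding N_def by (metis of_nat_mult of_nat_power of_nat_numeral)
  have "odd N" unfolding N_def by simp
  hence o: "odd n\<^sub>1" using assms(2) unfolding N_def by (metis even_mult_iff)
  have tT: "t 1 1 1 12 n = card (reps_odd (int N))" unfolding t_eq_card_reps_odd N_def by simp
  have c: "(\<Sum>(u, w) | u\<^sup>2 + 3 * w\<^sup>2 = 4 * int N \<and> odd u. w * chi4 w) = 4 * C"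
    unfolding C_def by (rule cusp_sum_nat)
  have e: "(\<Sum>(d, m)\<in>dpairs (int N). chi4 d * chi3 d * (3 * m + d)) = (3 ^ (\<beta> + 1) * kronecker 3 (int n\<^sub>1) + 1) * E"
    unfolding Ni E_def by (rule eisenstein_sum[OF assms(3) o assms(4)])
  \<comment> \<open>Up to here the identity is kept integral by the common factor 4; dividing by it
    over the reals gives the coefficients 1/2 and 3.\<close>
  have "4 * int (card (reps_odd (int N))) = 2 * ((3 ^ (\<beta> + 1) * kronecker 3 (int n\<^sub>1) + 1) * E) + 3 * (4 * C)"
    using reps_odd_count[OF N] unfolding c e by simp
  hence "real_of_int (4 * int (card (reps_odd (int N)))) = real_of_int (2 * ((3 ^ (\<beta> + 1) * kronecker 3 (int n\<^sub>1) + 1) * E) + 3 * (4 * C))"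
    by (simp only:)
  hence "real (t 1 1 1 12 n) = 1 / 2 * (3 ^ (\<beta> + 1) * real_of_int (kronecker 3 (int n\<^sub>1)) + 1) * real_of_int E + 3 * real_of_int C"
    unfolding tT by simp
  moreover have "real_of_int E = (\<Sum>d | d dvd n\<^sub>1. real d * real_of_int (kronecker 3 (int d)))"
    unfolding E_def by simp
  moreover have "real_of_int C = (\<Sum>(a, b) \<in> {(a :: nat, b :: nat). a > 0 \<and> b > 0 \<and> odd a \<and>
                4 * (8 * n + 15) = a ^ 2 + 3 * b ^ 2}. (-1) ^ ((b - 1) div 2) * real b)"
    unfolding C_def N_def of_int_sum by (rule sum.cong) auto
  ultimately show ?thesis by (simp only:)
qed

end
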